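(* Let $S$ be a codimension-two spacelike submanifold in a spacetime $(M,g)$ of dimension $n+2\ge4$ that admits an umbilical lightlike normal section $\xi$. Suppose that $S$ is simply connected. If $\bigl(\widetilde R(X,Y)\xi\bigr)^\perp=0$ for all $X,Y\in\mathfrak X(S)$, where $\widetilde R$ is the curvature tensor of $M$, then $\xi$ can be rescaled to be parallel with respect to the normal connection on $S$. Moreover, $S$ has a flat normal connection and the normal holonomy group of $S$ is trivial.
   Context: A spacetime $(M,g)$ is a connected time-oriented Lorentzian manifold of signature $(-,+,\dots,+)$. A vector $v$ is lightlike if $g(v,v)=0$ and $v\ne0$. A codimension-two spacelike submanifold is an immersion $\psi\colon S\to M$ of a connected $n$-manifold whose induced metric is Riemannian. $(\cdot)^\perp$ is projection onto the normal bundle. For a normal field $\zeta$, the Weingarten formula $\widetilde\nabla_X\zeta=-A_\zeta X+\nabla^\perp_X\zeta$ defines the shape operator $A_\zeta$ and the normal connection $\nabla^\perp$. An umbilical lightlike normal section is a globally defined lightlike normal vector field $\xi$ with $A_\xi=\rho I$ for some function $\rho$. "$\xi$ can be rescaled to be parallel" means that there is a nowhere vanishing smooth function $h$ on $S$ with $\nabla^\perp(h\xi)=0$. Flat normal connection means that the curvature of $\nabla^\perp$ vanishes; the normal holonomy group is the holonomy group of $\nabla^\perp$. *)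

theory Defs
  imports "HOL-Analysis.Analysis"
begin

subsection \<open>Smooth manifolds\<close>

text \<open>
  Only used on open sets \<open>S\<close>, where \<open>frechet_derivative f (at x)\<close> is the full derivative.
\<close>

primrec Ck_on :: "nat \<Rightarrow> 'a::euclidean_space set \<Rightarrow> ('a \<Rightarrow> 'b::real_normed_vector) \<Rightarrow> bool" where
  "Ck_on 0 S f \<longleftrightarrow> continuous_on S f"
| "Ck_on (Suc k) S f \<longleftrightarrow>
     (\<forall>x\<in>S. f differentiable (at x)) \<and>
     (\<forall>v. Ck_on k S (\<lambda>x. frechet_derivative f (at x) v))"

definition smooth_on :: "'a::euclidean_space set \<Rightarrow> ('a \<Rightarrow> 'b::real_normed_vector) \<Rightarrow> bool" where
  "smooth_on S f \<longleftrightarrow> (\<forall>k. Ck_on k S f)"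

text \<open>
  A chart is a domain together with a coordinate map (whose values off the domain are
  irrelevant).  A manifold is a whole Hausdorff second countable type with a smooth atlas;
  the atlas need not be maximal.
\<close>

type_synonym ('a, 'e) chart = "'a set \<times> ('a \<Rightarrow> 'e)"

abbreviation dom_chart :: "('a, 'e) chart \<Rightarrow> 'a set" where
  "dom_chart c \<equiv> fst c"

abbreviation coord :: "('a, 'e) chart \<Rightarrow> 'a \<Rightarrow> 'e" where
  "coord c \<equiv> snd c"

abbreviation chart_inv :: "('a, 'e) chart \<Rightarrow> 'e \<Rightarrow> 'a" where
  "chart_inv c \<equiv> inv_into (dom_chart c) (coord c)"

definition is_chart :: "('a::topological_space, 'e::euclidean_space) chart \<Rightarrow> bool" where
  "is_chart c \<longleftrightarrow> open (dom_chart c) \<and> open (coord c ` dom_chart c) \<and>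
     homeomorphism (dom_chart c) (coord c ` dom_chart c) (coord c) (chart_inv c)"

definition smooth_atlas ::
    "('a::{t2_space, second_countable_topology}, 'e::euclidean_space) chart set \<Rightarrow> bool" where
  "smooth_atlas A \<longleftrightarrow>
     (\<forall>c\<in>A. is_chart c) \<and> (\<Union>c\<in>A. dom_chart c) = UNIV \<and>
     (\<forall>c\<in>A. \<forall>d\<in>A. smooth_on (coord c ` (dom_chart c \<inter> dom_chart d)) (coord d \<circ> chart_inv c))"

definition smooth_fun ::
    "('a, 'e::euclidean_space) chart set \<Rightarrow> ('a \<Rightarrow> real) \<Rightarrow> bool" where
  "smooth_fun A f \<longleftrightarrow> (\<forall>c\<in>A. smooth_on (coord c ` dom_chart c) (f \<circ> chart_inv c))"

definition smooth_map ::
    "('a::topological_space, 'd::euclidean_space) chart set \<Rightarrow>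
     ('b::topological_space, 'e::euclidean_space) chart set \<Rightarrow> ('a \<Rightarrow> 'b) \<Rightarrow> bool" where
  "smooth_map A B f \<longleftrightarrow> continuous_on UNIV f \<and>
     (\<forall>c\<in>A. \<forall>d\<in>B. smooth_on (coord c ` (dom_chart c \<inter> f -` dom_chart d))
        (coord d \<circ> f \<circ> chart_inv c))"


subsection \<open>Tangent vectors and vector fields\<close>

text \<open>
  A tangent vector at \<open>p\<close> is the family of its component vectors in all charts of the
  atlas around \<open>p\<close>, related by the Jacobians of the chart transitions; for definiteness
  the family is \<open>0\<close> elsewhere.
\<close>

type_synonym ('a, 'e) tvec = "('a, 'e) chart \<Rightarrow> 'e"

definition tangent_space ::
    "('a, 'e::euclidean_space) chart set \<Rightarrow> 'a \<Rightarrow> ('a, 'e) tvec set" where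
  "tangent_space A p = {v.
     (\<forall>c\<in>A. \<forall>d\<in>A. p \<in> dom_chart c \<inter> dom_chart d \<longrightarrow>
        v d = frechet_derivative (coord d \<circ> chart_inv c) (at (coord c p)) (v c)) \<and>
     (\<forall>c. c \<notin> A \<or> p \<notin> dom_chart c \<longrightarrow> v c = 0)}"

text \<open>
  The tangent vector at \<open>p \<in> dom_chart c\<close> with components \<open>u\<close> in the chart \<open>c\<close>.  For fixed
  \<open>u\<close> this is, on \<open>dom_chart c\<close>, a constant combination of the coordinate vector fields of \<open>c\<close>.
\<close>

definition coord_field ::
    "('a, 'e::euclidean_space) chart set \<Rightarrow> ('a, 'e) chart \<Rightarrow> 'e \<Rightarrow> 'a \<Rightarrow> ('a, 'e) tvec" where
  "coord_field A c u p = (\<lambda>d. if d \<in> A \<and> p \<in> dom_chart d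
     then frechet_derivative (coord d \<circ> chart_inv c) (at (coord c p)) u else 0)"

definition chart_at :: "('a, 'e) chart set \<Rightarrow> 'a \<Rightarrow> ('a, 'e) chart" where
  "chart_at A p = (SOME c. c \<in> A \<and> p \<in> dom_chart c)"

text \<open>
  Derivative at \<open>p\<close> in the direction \<open>v\<close> of a vector-valued function defined near \<open>p\<close>;
  by the chain rule the choice of the chart does not matter when \<open>v\<close> is a tangent vector at \<open>p\<close>.
\<close>

definition dir_deriv ::
    "('a, 'e::euclidean_space) chart set \<Rightarrow> ('a \<Rightarrow> 'b::real_normed_vector) \<Rightarrow> 'a \<Rightarrow>
     ('a, 'e) tvec \<Rightarrow> 'b" where
  "dir_deriv A f p v =
     (let c = chart_at A p in frechet_derivative (f \<circ> chart_inv c) (at (coord c p)) (v c))"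

definition differential ::
    "('a, 'd::euclidean_space) chart set \<Rightarrow> ('b, 'e::euclidean_space) chart set \<Rightarrow>
     ('a \<Rightarrow> 'b) \<Rightarrow> 'a \<Rightarrow> ('a, 'd) tvec \<Rightarrow> ('b, 'e) tvec" where
  "differential A B f p v = (\<lambda>c. if c \<in> B \<and> f p \<in> dom_chart c
     then dir_deriv A (coord c \<circ> f) p v else 0)"

text \<open>
  Smooth vector fields along a map \<open>f\<close>.  Vector fields on a manifold are those along \<open>id\<close>.
\<close>

definition smooth_field_along ::
    "('a, 'd::euclidean_space) chart set \<Rightarrow> ('b, 'e::euclidean_space) chart set \<Rightarrow>
     ('a \<Rightarrow> 'b) \<Rightarrow> ('a \<Rightarrow> ('b, 'e) tvec) \<Rightarrow> bool" where
  "smooth_field_along A B f V \<longleftrightarrow> (\<forall>p. V p \<in> tangent_space B (f p)) \<and>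
     (\<forall>c\<in>A. \<forall>d\<in>B. smooth_on (coord c ` (dom_chart c \<inter> f -` dom_chart d))
        (\<lambda>x. V (chart_inv c x) d))"

definition vector_fields ::
    "('a, 'e::euclidean_space) chart set \<Rightarrow> ('a \<Rightarrow> ('a, 'e) tvec) set" where
  "vector_fields A = {X. smooth_field_along A A id X}"

definition lie_bracket ::
    "('a, 'e::euclidean_space) chart set \<Rightarrow> ('a \<Rightarrow> ('a, 'e) tvec) \<Rightarrow> ('a \<Rightarrow> ('a, 'e) tvec) \<Rightarrow>
     'a \<Rightarrow> ('a, 'e) tvec" where
  "lie_bracket A X Y p = (\<lambda>c. if c \<in> A \<and> p \<in> dom_chart c
     then dir_deriv A (\<lambda>q. Y q c) p (X p) - dir_deriv A (\<lambda>q. X q c) p (Y p) else 0)"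


subsection \<open>Spacetimes\<close>

type_synonym ('a, 'e) metric = "'a \<Rightarrow> ('a, 'e) tvec \<Rightarrow> ('a, 'e) tvec \<Rightarrow> real"

definition metric_comp ::
    "('a, 'e::euclidean_space) chart set \<Rightarrow> ('a, 'e) metric \<Rightarrow> ('a, 'e) chart \<Rightarrow> 'a \<Rightarrow>
     'e \<Rightarrow> 'e \<Rightarrow> real" where
  "metric_comp A g c p u v = g p (coord_field A c u p) (coord_field A c v p)"

text \<open>Signature \<open>(-,+,\<dots>,+)\<close>: the vectors \<open>L i\<close> form an orthonormal basis, \<open>L b\<close> being timelike.\<close>

definition lorentz_form :: "('e::euclidean_space \<Rightarrow> 'e \<Rightarrow> real) \<Rightarrow> bool" where
  "lorentz_form B \<longleftrightarrow> bilinear B \<and> (\<forall>u v. B u v = B v u) \<and>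
     (\<exists>b\<in>Basis. \<exists>L :: 'e \<Rightarrow> 'e. linear L \<and> bij L \<and>
        (\<forall>i\<in>Basis. \<forall>j\<in>Basis. B (L i) (L j) = (if i \<noteq> j then 0 else if i = b then -1 else 1)))"

definition lorentz_metric :: "('a, 'e::euclidean_space) chart set \<Rightarrow> ('a, 'e) metric \<Rightarrow> bool" where
  "lorentz_metric A g \<longleftrightarrow> (\<forall>c\<in>A.
     (\<forall>p\<in>dom_chart c. lorentz_form (metric_comp A g c p)) \<and>
     (\<forall>u v. smooth_on (coord c ` dom_chart c) (\<lambda>x. metric_comp A g c (chart_inv c x) u v)))"

text \<open>The time orientation is given by a smooth timelike vector field \<open>T\<close>.\<close>

definition spacetime ::
    "('m::{t2_space, second_countable_topology}, 'e::euclidean_space) chart set \<Rightarrow>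
     ('m, 'e) metric \<Rightarrow> ('m \<Rightarrow> ('m, 'e) tvec) \<Rightarrow> bool" where
  "spacetime M g T \<longleftrightarrow> smooth_atlas M \<and> connected (UNIV :: 'm set) \<and> lorentz_metric M g \<and>
     T \<in> vector_fields M \<and> (\<forall>p. g p (T p) (T p) < 0)"

definition lightlike :: "('m, 'e::euclidean_space) metric \<Rightarrow> 'm \<Rightarrow> ('m, 'e) tvec \<Rightarrow> bool" where
  "lightlike g p v \<longleftrightarrow> g p v v = 0 \<and> v \<noteq> (\<lambda>c. 0)"


subsection \<open>Levi-Civita connection and curvature\<close>

text \<open>
  The connection form in the chart \<open>c\<close>, \<open>christoffel M g c p u v = \<Sum>\<^sub>i\<^sub>j\<^sub>k u\<^sup>i v\<^sup>j \<Gamma>\<^sup>k\<^sub>i\<^sub>j e\<^sub>k\<close>: the unique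
  torsion-free (symmetric) one that is compatible with the metric.
\<close>

definition christoffel ::
    "('m, 'e::euclidean_space) chart set \<Rightarrow> ('m, 'e) metric \<Rightarrow> ('m, 'e) chart \<Rightarrow> 'm \<Rightarrow>
     'e \<Rightarrow> 'e \<Rightarrow> 'e" where
  "christoffel M g c p = (THE \<Gamma>. (\<forall>u v. \<Gamma> u v = \<Gamma> v u) \<and>
     (\<forall>u v w. dir_deriv M (\<lambda>q. metric_comp M g c q u v) p (coord_field M c w p) =
        metric_comp M g c p (\<Gamma> w u) v + metric_comp M g c p u (\<Gamma> w v)))"

text \<open>
  The Levi-Civita covariant derivative at \<open>p\<close>, in the direction \<open>x\<close> tangent to the source, of a
  field \<open>V\<close> along \<open>f\<close>.  On the manifold itself it is the case \<open>f = id\<close>.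
\<close>

definition cov_deriv ::
    "('a, 'd::euclidean_space) chart set \<Rightarrow> ('m, 'e::euclidean_space) chart set \<Rightarrow>
     ('m, 'e) metric \<Rightarrow> ('a \<Rightarrow> 'm) \<Rightarrow> ('a \<Rightarrow> ('m, 'e) tvec) \<Rightarrow> 'a \<Rightarrow> ('a, 'd) tvec \<Rightarrow>
     ('m, 'e) tvec" where
  "cov_deriv A M g f V p x = (\<lambda>c. if c \<in> M \<and> f p \<in> dom_chart c
     then dir_deriv A (\<lambda>q. V q c) p x
        + christoffel M g c (f p) (differential A M f p x c) (V p c)
     else 0)"

text \<open>\<open>D\<^sub>X D\<^sub>Y Z - D\<^sub>Y D\<^sub>X Z - D\<^bsub>[X,Y]\<^esub> Z\<close> for a connection with \<open>(D\<^sub>X Z)(p) = D Z p (X p)\<close>.\<close>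

definition curvature ::
    "('a, 'd::euclidean_space) chart set \<Rightarrow>
     (('a \<Rightarrow> ('m, 'e::euclidean_space) tvec) \<Rightarrow> 'a \<Rightarrow> ('a, 'd) tvec \<Rightarrow> ('m, 'e) tvec) \<Rightarrow>
     ('a \<Rightarrow> ('a, 'd) tvec) \<Rightarrow> ('a \<Rightarrow> ('a, 'd) tvec) \<Rightarrow> ('a \<Rightarrow> ('m, 'e) tvec) \<Rightarrow>
     'a \<Rightarrow> ('m, 'e) tvec" where
  "curvature A D X Y Z p = (\<lambda>c.
     D (\<lambda>q. D Z q (Y q)) p (X p) c - D (\<lambda>q. D Z q (X q)) p (Y p) c
       - D Z p (lie_bracket A X Y p) c)"

text \<open>
  The curvature tensor at \<open>p\<close> on tangent vectors \<open>x, y, z\<close>: these are extended near \<open>p\<close>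
  by coordinate fields, and the result does not depend on the extension.
\<close>

definition riemann ::
    "('m, 'e::euclidean_space) chart set \<Rightarrow> ('m, 'e) metric \<Rightarrow> 'm \<Rightarrow>
     ('m, 'e) tvec \<Rightarrow> ('m, 'e) tvec \<Rightarrow> ('m, 'e) tvec \<Rightarrow> ('m, 'e) tvec" where
  "riemann M g p x y z = (\<lambda>c. if c \<in> M \<and> p \<in> dom_chart c
     then curvature M (cov_deriv M M g id)
        (coord_field M c (x c)) (coord_field M c (y c)) (coord_field M c (z c)) p c
     else 0)"


subsection \<open>Spacelike submanifolds\<close>

definition spacelike_submanifold ::
    "('s::{t2_space, second_countable_topology}, 'd::euclidean_space) chart set \<Rightarrow>
     ('m::{t2_space, second_countable_topology}, 'e::euclidean_space) chart set \<Rightarrow>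
     ('m, 'e) metric \<Rightarrow> ('s \<Rightarrow> 'm) \<Rightarrow> bool" where
  "spacelike_submanifold S M g \<psi> \<longleftrightarrow>
     smooth_atlas S \<and> connected (UNIV :: 's set) \<and> smooth_map S M \<psi> \<and>
     (\<forall>p. inj_on (differential S M \<psi> p) (tangent_space S p)) \<and>
     (\<forall>p. \<forall>x\<in>tangent_space S p. x \<noteq> (\<lambda>c. 0) \<longrightarrow>
        g (\<psi> p) (differential S M \<psi> p x) (differential S M \<psi> p x) > 0)"

definition normal_space ::
    "('s, 'd::euclidean_space) chart set \<Rightarrow> ('m, 'e::euclidean_space) chart set \<Rightarrow>
     ('m, 'e) metric \<Rightarrow> ('s \<Rightarrow> 'm) \<Rightarrow> 's \<Rightarrow> ('m, 'e) tvec set" where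
  "normal_space S M g \<psi> p = {w \<in> tangent_space M (\<psi> p).
     \<forall>x\<in>tangent_space S p. g (\<psi> p) w (differential S M \<psi> p x) = 0}"

definition normal_proj ::
    "('s, 'd::euclidean_space) chart set \<Rightarrow> ('m, 'e::euclidean_space) chart set \<Rightarrow>
     ('m, 'e) metric \<Rightarrow> ('s \<Rightarrow> 'm) \<Rightarrow> 's \<Rightarrow> ('m, 'e) tvec \<Rightarrow> ('m, 'e) tvec" where
  "normal_proj S M g \<psi> p w = (THE n. n \<in> normal_space S M g \<psi> p \<and>
     (\<exists>x\<in>tangent_space S p. w = (\<lambda>c. differential S M \<psi> p x c + n c)))"

definition normal_fields ::
    "('s, 'd::euclidean_space) chart set \<Rightarrow> ('m, 'e::euclidean_space) chart set \<Rightarrow>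
     ('m, 'e) metric \<Rightarrow> ('s \<Rightarrow> 'm) \<Rightarrow> ('s \<Rightarrow> ('m, 'e) tvec) set" where
  "normal_fields S M g \<psi> =
     {\<zeta>. smooth_field_along S M \<psi> \<zeta> \<and> (\<forall>p. \<zeta> p \<in> normal_space S M g \<psi> p)}"

definition normal_conn ::
    "('s, 'd::euclidean_space) chart set \<Rightarrow> ('m, 'e::euclidean_space) chart set \<Rightarrow>
     ('m, 'e) metric \<Rightarrow> ('s \<Rightarrow> 'm) \<Rightarrow> ('s \<Rightarrow> ('m, 'e) tvec) \<Rightarrow> 's \<Rightarrow> ('s, 'd) tvec \<Rightarrow>
     ('m, 'e) tvec" where
  "normal_conn S M g \<psi> \<zeta> p x = normal_proj S M g \<psi> p (cov_deriv S M g \<psi> \<zeta> p x)"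

definition shape_operator ::
    "('s, 'd::euclidean_space) chart set \<Rightarrow> ('m, 'e::euclidean_space) chart set \<Rightarrow>
     ('m, 'e) metric \<Rightarrow> ('s \<Rightarrow> 'm) \<Rightarrow> ('s \<Rightarrow> ('m, 'e) tvec) \<Rightarrow> 's \<Rightarrow> ('s, 'd) tvec \<Rightarrow>
     ('s, 'd) tvec" where
  "shape_operator S M g \<psi> \<zeta> p x = (THE a. a \<in> tangent_space S p \<and>
     cov_deriv S M g \<psi> \<zeta> p x =
       (\<lambda>c. - differential S M \<psi> p a c + normal_conn S M g \<psi> \<zeta> p x c))"

definition umbilical_lightlike_section ::
    "('s, 'd::euclidean_space) chart set \<Rightarrow> ('m, 'e::euclidean_space) chart set \<Rightarrow>
     ('m, 'e) metric \<Rightarrow> ('s \<Rightarrow> 'm) \<Rightarrow> ('s \<Rightarrow> ('m, 'e) tvec) \<Rightarrow> bool" where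
  "umbilical_lightlike_section S M g \<psi> \<xi> \<longleftrightarrow>
     \<xi> \<in> normal_fields S M g \<psi> \<and> (\<forall>p. lightlike g (\<psi> p) (\<xi> p)) \<and>
     (\<exists>\<rho> :: 's \<Rightarrow> real. \<forall>p. \<forall>x\<in>tangent_space S p.
        shape_operator S M g \<psi> \<xi> p x = (\<lambda>c. \<rho> p *\<^sub>R x c))"

definition parallel_normal ::
    "('s, 'd::euclidean_space) chart set \<Rightarrow> ('m, 'e::euclidean_space) chart set \<Rightarrow>
     ('m, 'e) metric \<Rightarrow> ('s \<Rightarrow> 'm) \<Rightarrow> ('s \<Rightarrow> ('m, 'e) tvec) \<Rightarrow> bool" where
  "parallel_normal S M g \<psi> \<zeta> \<longleftrightarrow>
     (\<forall>p. \<forall>x\<in>tangent_space S p. normal_conn S M g \<psi> \<zeta> p x = (\<lambda>c. 0))"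

definition rescalable_to_parallel ::
    "('s, 'd::euclidean_space) chart set \<Rightarrow> ('m, 'e::euclidean_space) chart set \<Rightarrow>
     ('m, 'e) metric \<Rightarrow> ('s \<Rightarrow> 'm) \<Rightarrow> ('s \<Rightarrow> ('m, 'e) tvec) \<Rightarrow> bool" where
  "rescalable_to_parallel S M g \<psi> \<xi> \<longleftrightarrow>
     (\<exists>h. smooth_fun S h \<and> (\<forall>p. h p \<noteq> 0) \<and> parallel_normal S M g \<psi> (\<lambda>p c. h p *\<^sub>R \<xi> p c))"

definition flat_normal_connection ::
    "('s, 'd::euclidean_space) chart set \<Rightarrow> ('m, 'e::euclidean_space) chart set \<Rightarrow>
     ('m, 'e) metric \<Rightarrow> ('s \<Rightarrow> 'm) \<Rightarrow> bool" where
  "flat_normal_connection S M g \<psi> \<longleftrightarrow>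
     (\<forall>X\<in>vector_fields S. \<forall>Y\<in>vector_fields S. \<forall>\<zeta>\<in>normal_fields S M g \<psi>. \<forall>p.
        curvature S (normal_conn S M g \<psi>) X Y \<zeta> p = (\<lambda>c. 0))"


subsection \<open>Normal holonomy\<close>

definition line_atlas :: "(real, real) chart set" where
  "line_atlas = {(UNIV, id)}"

definition d_dt :: "real \<Rightarrow> (real, real) tvec" where
  "d_dt = coord_field line_atlas (UNIV, id) 1"

definition parallel_along ::
    "('s, 'd::euclidean_space) chart set \<Rightarrow> ('m, 'e::euclidean_space) chart set \<Rightarrow>
     ('m, 'e) metric \<Rightarrow> ('s \<Rightarrow> 'm) \<Rightarrow> (real \<Rightarrow> 's) \<Rightarrow> (real \<Rightarrow> ('m, 'e) tvec) \<Rightarrow> bool" where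
  "parallel_along S M g \<psi> \<gamma> V \<longleftrightarrow>
     smooth_field_along line_atlas M (\<psi> \<circ> \<gamma>) V \<and>
     (\<forall>t. V t \<in> normal_space S M g \<psi> (\<gamma> t)) \<and>
     (\<forall>t. normal_proj S M g \<psi> (\<gamma> t)
        (cov_deriv line_atlas M g (\<psi> \<circ> \<gamma>) V t (d_dt t)) = (\<lambda>c. 0))"

text \<open>
  Graphs of the parallel transport maps from the normal space at \<open>p\<close> along piecewise smooth
  paths starting at \<open>p\<close>, indexed by the end point.  The smooth pieces are parametrised by
  \<open>[0,1]\<close> and, without loss of generality, given as restrictions of smooth curves on the real
  line (a curve that is smooth on a closed interval extends to one).
\<close>

inductive normal_transport ::
    "('s::topological_space, 'd::euclidean_space) chart set \<Rightarrow>
     ('m, 'e::euclidean_space) chart set \<Rightarrow>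
     ('m, 'e) metric \<Rightarrow> ('s \<Rightarrow> 'm) \<Rightarrow> 's \<Rightarrow> 's \<Rightarrow>
     (('m, 'e) tvec \<times> ('m, 'e) tvec) set \<Rightarrow> bool"
  for S M g \<psi> p where
  const: "normal_transport S M g \<psi> p p (Id_on (normal_space S M g \<psi> p))"
| step: "normal_transport S M g \<psi> p (\<gamma> 0) P \<Longrightarrow> smooth_map line_atlas S \<gamma> \<Longrightarrow>
     normal_transport S M g \<psi> p (\<gamma> 1) (P O {(V 0, V 1) | V. parallel_along S M g \<psi> \<gamma> V})"

definition normal_holonomy ::
    "('s::topological_space, 'd::euclidean_space) chart set \<Rightarrow>
     ('m, 'e::euclidean_space) chart set \<Rightarrow>
     ('m, 'e) metric \<Rightarrow> ('s \<Rightarrow> 'm) \<Rightarrow> 's \<Rightarrow> (('m, 'e) tvec \<times> ('m, 'e) tvec) set set" where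
  "normal_holonomy S M g \<psi> p = {P. normal_transport S M g \<psi> p p P}"

definition trivial_normal_holonomy ::
    "('s::topological_space, 'd::euclidean_space) chart set \<Rightarrow>
     ('m, 'e::euclidean_space) chart set \<Rightarrow>
     ('m, 'e) metric \<Rightarrow> ('s \<Rightarrow> 'm) \<Rightarrow> bool" where
  "trivial_normal_holonomy S M g \<psi> \<longleftrightarrow>
     (\<forall>p. normal_holonomy S M g \<psi> p = {Id_on (normal_space S M g \<psi> p)})"

end

(*
  For a null frame (xi, eta) of the normal plane with g(xi, eta) = 1 and tau(X) = g(D_X xi, eta), the
  normal connection is determined by nabla xi = tau xi, nabla eta = - tau eta.  Umbilicity makes the
  tangential parts of D xi drop out of g(R(X, Y) xi, eta), which is therefore d tau(X, Y), and it
  vanishes by hypothesis.  On the simply connected S, tau = df, and exp(-f) xi and exp(f) eta are parallel.  In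
  this global parallel frame the normal connection is the trivial one: the components of a normal
  field are differentiated as functions, and the components of a parallel field along a curve are
  constant.

  The second null direction eta exists globally and is smooth because the normal part of the time
  orientation T is never orthogonal to xi.
*)

theory Submission
  imports Defs
begin

subsection \<open>Smooth functions on open subsets of Euclidean spaces\<close>

text \<open>The hypothesis concerns the ambient curvature at \<open>\<psi> p\<close>, whereas
  \<open>\<xi>\<close> is a field along the immersion only; \<open>curvature_pullback\<close>
  expands both sides in one chart and thereby turns the hypothesis into a statement on iterated
  covariant derivatives over S. The step from closed to exact meets another obstacle: homotopies of
  loops are merely continuous, so a one-form cannot be integrated along them. The primitives are
  therefore continued topologically (\<open>local_primitives\<close>), and analysis is confined to
  the Poincare lemma on a coordinate ball. Objects defined by unique existence, such as the
  Christoffel form and the normal projection, come without a formula from which smoothness could be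
  read off; each is the solution of a nondegenerate linear system with smooth coefficients, and
  \<open>smooth_on_bilinear_system\<close> makes such solutions smooth. Codimension two enters
  through one dimension count: in the normal plane, the vectors orthogonal to the null vector
  \<open>\<xi>\<close> are its multiples.\<close>

lemma frechet_derivative_eqI:
  "(f has_derivative f') (at x) \<Longrightarrow> frechet_derivative f (at x) = f'"
  by (rule frechet_derivative_at[symmetric])

lemma frechetI: "f differentiable at x \<Longrightarrow> (f has_derivative frechet_derivative f (at x)) (at x)"
  by (simp add: frechet_derivative_works)

lemma differentiable_cong_open:
  assumes "f differentiable at x" "open S" "x \<in> S" "\<And>y. y \<in> S \<Longrightarrow> f y = g y"
  shows "g differentiable at x"
  using assms unfolding differentiable_def by (blast intro: has_derivative_transform_within_open)

lemma Ck_on_cong: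
  assumes "open S" "\<And>x. x \<in> S \<Longrightarrow> f x = g x" "Ck_on k S f"
  shows "Ck_on k S g"
  using assms
proof (induction k arbitrary: f g)
  case 0
  then show ?case by (simp cong: continuous_on_cong)
next
  case (Suc k)
  have "Ck_on k S (\<lambda>x. frechet_derivative g (at x) v)" for v
  proof (rule Suc.IH[OF Suc.prems(1)])
    show "Ck_on k S (\<lambda>x. frechet_derivative f (at x) v)" using Suc.prems by simp
    show "frechet_derivative f (at x) v = frechet_derivative g (at x) v" if "x \<in> S" for x
      using frechet_derivative_transform_within_open[of f x S g] Suc.prems that by auto
  qed
  moreover have "g differentiable at x" if "x \<in> S" for x
    using differentiable_cong_open[of f x S g] Suc.prems that by auto
  ultimately show ?case by simp
qed

text \<open>\<open>Ck_on\<close> takes the full derivative \<open>at x\<close>, which does not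
  depend on the set, so restriction works for an arbitrary \<open>U\<close>.\<close>

lemma Ck_on_subset: "Ck_on k S f \<Longrightarrow> U \<subseteq> S \<Longrightarrow> Ck_on k U f"
  by (induction k arbitrary: f) (auto intro: continuous_on_subset)

lemma Ck_on_local:
  assumes "\<And>x. x \<in> S \<Longrightarrow> \<exists>U. open U \<and> x \<in> U \<and> Ck_on k U f"
  shows "Ck_on k S f"
  using assms
proof (induction k arbitrary: f)
  case 0
  then have "isCont f x" if "x \<in> S" for x
    using that by (metis Ck_on.simps(1) continuous_on_eq_continuous_at)
  then show ?case by (simp add: continuous_at_imp_continuous_on)
next
  case (Suc k)
  have "Ck_on k S (\<lambda>x. frechet_derivative f (at x) v)" for v
    by (rule Suc.IH) (use Suc.prems in fastforce)
  moreover have "f differentiable at x" if "x \<in> S" for x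
    using Suc.prems[OF that] by auto
  ultimately show ?case by simp
qed

lemma Ck_on_continuous_on: "Ck_on k S f \<Longrightarrow> continuous_on S f"
  by (cases k) (auto intro!: continuous_at_imp_continuous_on differentiable_imp_continuous_within)

lemma Ck_on_SucD: "Ck_on (Suc k) S f \<Longrightarrow> Ck_on k S f"
proof (induction k arbitrary: f)
  case 0
  then show ?case using Ck_on_continuous_on[of "Suc 0" S f] by simp
next
  case (Suc k)
  have "Ck_on k S (\<lambda>x. frechet_derivative f (at x) v)" for v
    by (rule Suc.IH) (use Suc.prems in auto)
  then show ?case using Suc.prems by auto
qed

lemma Ck_on_const: "Ck_on k S (\<lambda>x. c)"
  by (induction k arbitrary: c) (auto simp: frechet_derivative_const)

lemma Ck_on_bounded_linear: "bounded_linear f \<Longrightarrow> Ck_on k S f"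
proof (cases k)
  case 0
  assume "bounded_linear f" then show ?thesis by (simp add: 0 linear_continuous_on)
next
  case (Suc m)
  assume f: "bounded_linear f"
  then have d: "(f has_derivative f) (at x)" for x by (simp add: bounded_linear_imp_has_derivative)
  then have "frechet_derivative f (at x) = f" for x by (rule frechet_derivative_at[symmetric])
  then show ?thesis using d by (auto simp: Suc differentiable_def Ck_on_const)
qed

lemma Ck_on_compose_bounded_linear:
  assumes L: "bounded_linear L" and S: "open S" and "Ck_on k S f"
  shows "Ck_on k S (\<lambda>x. L (f x))"
  using assms(3)
proof (induction k arbitrary: f)
  case 0
  then show ?case using bounded_linear.continuous_on[OF L] by simp
next
  case (Suc k)
  have d: "((\<lambda>x. L (f x)) has_derivative (\<lambda>v. L (frechet_derivative f (at x) v))) (at x)"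
    if "x \<in> S" for x
    using Suc.prems that by (auto intro!: bounded_linear.has_derivative[OF L] frechetI)
  have "Ck_on k S (\<lambda>x. frechet_derivative (\<lambda>x. L (f x)) (at x) v)" for v
    by (rule Ck_on_cong[OF S _ Suc.IH[of "\<lambda>x. frechet_derivative f (at x) v"]])
      (use Suc.prems frechet_derivative_eqI[OF d] in auto)
  then show ?case using d by (auto simp: differentiable_def)
qed

lemma Ck_on_add:
  assumes S: "open S" and "Ck_on k S f" "Ck_on k S g"
  shows "Ck_on k S (\<lambda>x. f x + g x)"
  using assms(2,3)
proof (induction k arbitrary: f g)
  case 0
  then show ?case by (simp add: continuous_on_add)
next
  case (Suc k)
  have d: "((\<lambda>x. f x + g x) has_derivative
      (\<lambda>v. frechet_derivative f (at x) v + frechet_derivative g (at x) v)) (at x)"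
    if "x \<in> S" for x
    using Suc.prems that by (auto intro!: has_derivative_add frechetI)
  have "Ck_on k S (\<lambda>x. frechet_derivative (\<lambda>x. f x + g x) (at x) v)" for v
    by (rule Ck_on_cong[OF S _ Suc.IH[of "\<lambda>x. frechet_derivative f (at x) v"
            "\<lambda>x. frechet_derivative g (at x) v"]])
      (use Suc.prems frechet_derivative_eqI[OF d] in auto)
  then show ?case using d by (auto simp: differentiable_def)
qed

lemma Ck_on_sum:
  assumes "open S" "\<And>i. i \<in> I \<Longrightarrow> Ck_on k S (f i)"
  shows "Ck_on k S (\<lambda>x. \<Sum>i\<in>I. f i x)"
  using assms by (induction I rule: infinite_finite_induct) (auto intro: Ck_on_add Ck_on_const)

lemma Ck_on_scaleR:
  fixes g :: "'a::euclidean_space \<Rightarrow> 'b::real_normed_vector"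
  assumes S: "open S" and "Ck_on k S f" "Ck_on k S g"
  shows "Ck_on k S (\<lambda>x. f x *\<^sub>R g x)"
  using assms(2,3)
proof (induction k arbitrary: f g)
  case 0
  then show ?case by (simp add: continuous_on_scaleR)
next
  case (Suc k)
  have d: "((\<lambda>x. f x *\<^sub>R g x) has_derivative
      (\<lambda>v. f x *\<^sub>R frechet_derivative g (at x) v + frechet_derivative f (at x) v *\<^sub>R g x)) (at x)"
    if "x \<in> S" for x
    using Suc.prems that by (auto intro!: has_derivative_scaleR frechetI)
  have "Ck_on k S (\<lambda>x. frechet_derivative (\<lambda>x. f x *\<^sub>R g x) (at x) v)" for v
  proof (rule Ck_on_cong[OF S])
    show "Ck_on k S (\<lambda>x. f x *\<^sub>R frechet_derivative g (at x) v + frechet_derivative f (at x) v *\<^sub>R g x)"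
      using Suc.prems Ck_on_SucD[OF Suc.prems(1)] Ck_on_SucD[OF Suc.prems(2)]
      by (intro Ck_on_add S Suc.IH) auto
  qed (use frechet_derivative_eqI[OF d] in auto)
  then show ?case using d by (auto simp: differentiable_def)
qed

lemma linear_expand:
  fixes L :: "'a::euclidean_space \<Rightarrow> 'b::real_normed_vector"
  assumes "linear L"
  shows "L w = (\<Sum>b\<in>Basis. (w \<bullet> b) *\<^sub>R L b)"
proof -
  have "L (\<Sum>b\<in>Basis. (w \<bullet> b) *\<^sub>R b) = (\<Sum>b\<in>Basis. (w \<bullet> b) *\<^sub>R L b)"
    by (simp add: linear_sum[OF assms] linear_scale[OF assms])
  then show ?thesis by (simp add: euclidean_representation)
qed

text \<open>The derivative given by the chain rule is expanded in the basis: scalar components of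
  the derivative of \<open>f\<close> times partial derivatives of \<open>g\<close> composed with
  \<open>f\<close>. The latter are again compositions, of order \<open>k\<close>, hence the
  induction over arbitrary \<open>g\<close>.\<close>

lemma Ck_on_compose:
  fixes f :: "'a::euclidean_space \<Rightarrow> 'b::euclidean_space" and g :: "'b \<Rightarrow> 'c::real_normed_vector"
  assumes S: "open S" and sub: "f ` S \<subseteq> V" and "Ck_on k S f" "Ck_on k V g"
  shows "Ck_on k S (\<lambda>x. g (f x))"
  using assms(3,4)
proof (induction k arbitrary: g)
  case 0
  then show ?case using continuous_on_compose2[OF _ _ sub, of g] by simp
next
  case (Suc k)
  have d: "((\<lambda>x. g (f x)) has_derivative
      (\<lambda>v. frechet_derivative g (at (f x)) (frechet_derivative f (at x) v))) (at x)"
    if "x \<in> S" for x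
    by (rule has_derivative_compose; rule frechetI)
      (use Suc.prems that sub in \<open>auto simp: image_subset_iff\<close>)
  have lin: "linear (frechet_derivative g (at (f x)))" if "x \<in> S" for x
    using Suc.prems that sub by (auto simp: image_subset_iff intro!: linear_frechet_derivative)
  have "Ck_on k S (\<lambda>x. frechet_derivative (\<lambda>x. g (f x)) (at x) v)" for v
  proof (rule Ck_on_cong[OF S])
    show "Ck_on k S (\<lambda>x. \<Sum>b\<in>Basis. (frechet_derivative f (at x) v \<bullet> b) *\<^sub>R
        frechet_derivative g (at (f x)) b)"
      using Suc.prems Ck_on_SucD[OF Suc.prems(1)]
      by (intro Ck_on_sum S Ck_on_scaleR Suc.IH Ck_on_compose_bounded_linear[OF bounded_linear_inner_left])
        auto
    show "(\<Sum>b\<in>Basis. (frechet_derivative f (at x) v \<bullet> b) *\<^sub>R frechet_derivative g (at (f x)) b) =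
      frechet_derivative (\<lambda>x. g (f x)) (at x) v" if "x \<in> S" for x
      using linear_expand[OF lin[OF that], of "frechet_derivative f (at x) v"]
        frechet_derivative_eqI[OF d[OF that]] by simp
  qed
  then show ?case using d by (auto simp: differentiable_def)
qed

lemma smooth_on_cong:
  "smooth_on S f \<Longrightarrow> open S \<Longrightarrow> (\<And>x. x \<in> S \<Longrightarrow> f x = g x) \<Longrightarrow> smooth_on S g"
  unfolding smooth_on_def by (blast intro: Ck_on_cong)

lemma smooth_on_subset: "smooth_on S f \<Longrightarrow> U \<subseteq> S \<Longrightarrow> smooth_on U f"
  unfolding smooth_on_def by (blast intro: Ck_on_subset)

lemma smooth_on_local:
  "(\<And>x. x \<in> S \<Longrightarrow> \<exists>U. open U \<and> x \<in> U \<and> smooth_on U f) \<Longrightarrow> smooth_on S f"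
  unfolding smooth_on_def by (meson Ck_on_local)

text \<open>Read from right to left, it yields smoothness of a merely differentiable function whose
  derivative is known to be smooth; this is how a primitive of a smooth form becomes smooth.\<close>

lemma smooth_on_Suc_iff:
  "smooth_on S f \<longleftrightarrow> (\<forall>x\<in>S. f differentiable at x) \<and>
     (\<forall>v. smooth_on S (\<lambda>x. frechet_derivative f (at x) v))"
  unfolding smooth_on_def by (metis Ck_on.simps(2) Ck_on_SucD)

lemma smooth_on_differentiable: "smooth_on S f \<Longrightarrow> x \<in> S \<Longrightarrow> f differentiable at x"
  using smooth_on_Suc_iff by blast

lemma smooth_on_frechet: "smooth_on S f \<Longrightarrow> smooth_on S (\<lambda>x. frechet_derivative f (at x) v)"
  using smooth_on_Suc_iff by blast

lemma smooth_on_has_derivative: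
  "smooth_on S f \<Longrightarrow> x \<in> S \<Longrightarrow> (f has_derivative frechet_derivative f (at x)) (at x)"
  by (intro frechetI smooth_on_differentiable)

lemma smooth_on_continuous_on: "smooth_on S f \<Longrightarrow> continuous_on S f"
  unfolding smooth_on_def by (meson Ck_on_continuous_on)

lemma smooth_on_const: "smooth_on S (\<lambda>x. c)"
  by (simp add: smooth_on_def Ck_on_const)

lemma smooth_on_bounded_linear: "bounded_linear f \<Longrightarrow> smooth_on S f"
  by (simp add: smooth_on_def Ck_on_bounded_linear)

lemma smooth_on_ident: "smooth_on S (\<lambda>x. x)"
  by (intro smooth_on_bounded_linear bounded_linear_ident)

lemma smooth_on_compose_bounded_linear:
  "bounded_linear L \<Longrightarrow> open S \<Longrightarrow> smooth_on S f \<Longrightarrow> smooth_on S (\<lambda>x. L (f x))"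
  by (simp add: smooth_on_def Ck_on_compose_bounded_linear)

lemma smooth_on_add:
  "open S \<Longrightarrow> smooth_on S f \<Longrightarrow> smooth_on S g \<Longrightarrow> smooth_on S (\<lambda>x. f x + g x)"
  by (simp add: smooth_on_def Ck_on_add)

lemma smooth_on_sum:
  "open S \<Longrightarrow> (\<And>i. i \<in> I \<Longrightarrow> smooth_on S (f i)) \<Longrightarrow> smooth_on S (\<lambda>x. \<Sum>i\<in>I. f i x)"
  by (simp add: smooth_on_def Ck_on_sum)

lemma smooth_on_scaleR:
  "open S \<Longrightarrow> smooth_on S f \<Longrightarrow> smooth_on S g \<Longrightarrow> smooth_on S (\<lambda>x. f x *\<^sub>R g x)"
  by (simp add: smooth_on_def Ck_on_scaleR)

lemma smooth_on_mult:
  fixes f g :: "_ \<Rightarrow> real"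
  shows "open S \<Longrightarrow> smooth_on S f \<Longrightarrow> smooth_on S g \<Longrightarrow> smooth_on S (\<lambda>x. f x * g x)"
  using smooth_on_scaleR[of S f g] by simp

lemma smooth_on_minus:
  "open S \<Longrightarrow> smooth_on S f \<Longrightarrow> smooth_on S (\<lambda>x. - f x)"
  by (rule smooth_on_compose_bounded_linear) (auto intro: bounded_linear_minus bounded_linear_ident)

lemma smooth_on_diff:
  "open S \<Longrightarrow> smooth_on S f \<Longrightarrow> smooth_on S g \<Longrightarrow> smooth_on S (\<lambda>x. f x - g x)"
  using smooth_on_add[of S f "\<lambda>x. - g x"] smooth_on_minus by auto

lemma smooth_on_inner:
  fixes f g :: "_ \<Rightarrow> 'b::euclidean_space"
  assumes "open S" "smooth_on S f" "smooth_on S g"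
  shows "smooth_on S (\<lambda>x. f x \<bullet> g x)"
  by (subst euclidean_inner) (use assms in \<open>intro smooth_on_sum smooth_on_mult smooth_on_compose_bounded_linear[OF bounded_linear_inner_left]\<close>)

lemma smooth_on_compose:
  fixes f :: "'a::euclidean_space \<Rightarrow> 'b::euclidean_space"
  shows "open S \<Longrightarrow> f ` S \<subseteq> V \<Longrightarrow> smooth_on S f \<Longrightarrow> smooth_on V g \<Longrightarrow> smooth_on S (\<lambda>x. g (f x))"
  unfolding smooth_on_def using Ck_on_compose by blast

text \<open>The derivative is a product of copies of \<open>inverse\<close> itself, so the induction
  hypothesis applies to it directly.\<close>

lemma Ck_on_inverse: "Ck_on k (- {0::real}) inverse"
proof (induction k)
  case 0
  then show ?case by (auto intro!: continuous_intros)
next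
  case (Suc k)
  have d: "(inverse has_derivative (\<lambda>v. - (v * (inverse x * inverse x)))) (at x)"
    if "x \<noteq> 0" for x :: real
    using has_derivative_inverse'[of x UNIV] that by (simp add: mult_ac)
  have o: "open (- {0::real})" by auto
  have *: "Ck_on k (- {0::real}) (\<lambda>x. (-v) *\<^sub>R (inverse x *\<^sub>R inverse x))" for v
    by (intro Ck_on_scaleR o Suc.IH Ck_on_const)
  have "Ck_on k (- {0::real}) (\<lambda>x. frechet_derivative inverse (at x) v)" for v
    by (rule Ck_on_cong[OF o _ *[of v]]) (use frechet_derivative_eqI[OF d] in auto)
  then show ?case using d by (auto simp: differentiable_def)
qed

lemma smooth_on_inverse:
  fixes f :: "_ \<Rightarrow> real"
  assumes "open S" "smooth_on S f" "\<And>x. x \<in> S \<Longrightarrow> f x \<noteq> 0"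
  shows "smooth_on S (\<lambda>x. inverse (f x))"
  by (rule smooth_on_compose[where V = "- {0}"]) (use assms Ck_on_inverse in \<open>auto simp: smooth_on_def\<close>)

lemma smooth_on_exp: "smooth_on S (exp :: real \<Rightarrow> real)"
proof -
  have "Ck_on k UNIV (exp :: real \<Rightarrow> real)" for k
  proof (induction k)
    case (Suc k)
    have d: "(exp has_derivative (\<lambda>v. v * exp x)) (at x)" for x :: real
      using DERIV_exp[of x] by (simp add: has_field_derivative_def mult_commute_abs)
    show ?case
      using Ck_on_scaleR[OF open_UNIV Ck_on_const Suc.IH] d frechet_derivative_eqI[OF d]
      by (auto simp: differentiable_def)
  qed (simp add: continuous_on_exp continuous_on_id)
  then show ?thesis using smooth_on_subset[of UNIV exp S] by (auto simp: smooth_on_def)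
qed

section \<open>Families of linear and bilinear maps\<close>

lemma linear_family_has_derivative:
  fixes L :: "'a::euclidean_space \<Rightarrow> 'b::euclidean_space \<Rightarrow> 'c::real_normed_vector"
  assumes S: "open S" "x \<in> S" and lin: "\<And>y. y \<in> S \<Longrightarrow> linear (L y)"
    and dL: "\<And>w. (\<lambda>y. L y w) differentiable at x" and du: "u differentiable at x"
  shows "((\<lambda>y. L y (u y)) has_derivative
     (\<lambda>h. frechet_derivative (\<lambda>y. L y (u x)) (at x) h + L x (frechet_derivative u (at x) h))) (at x)"
proof -
  let ?D = "\<lambda>w. frechet_derivative (\<lambda>y. L y w) (at x)"
  have D: "((\<lambda>y. L y w) has_derivative ?D w) (at x)" for w
    by (intro frechetI dL)
  have U: "(u has_derivative frechet_derivative u (at x)) (at x)"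
    by (intro frechetI du)
  \<comment> \<open>Expanding \<open>z\<close> in the basis leaves sums of a scalar function times
    \<open>L y b\<close>. Thus only the differentiability of \<open>L\<close> on each fixed vector
    enters, and no norm on the space of linear maps.\<close>
  have *: "((\<lambda>y. L y (z y)) has_derivative
     (\<lambda>h. \<Sum>b\<in>Basis. (z x \<bullet> b) *\<^sub>R ?D b h + (z' h \<bullet> b) *\<^sub>R L x b)) (at x)"
    if z: "(z has_derivative z') (at x)" for z z'
  proof (rule has_derivative_transform_within_open[OF _ S])
    show "((\<lambda>y. \<Sum>b\<in>Basis. (z y \<bullet> b) *\<^sub>R L y b) has_derivative
     (\<lambda>h. \<Sum>b\<in>Basis. (z x \<bullet> b) *\<^sub>R ?D b h + (z' h \<bullet> b) *\<^sub>R L x b)) (at x)"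
      by (intro has_derivative_sum has_derivative_scaleR has_derivative_inner_left z D)
  qed (use linear_expand[OF lin] in metis)
  have 1: "?D (u x) h = (\<Sum>b\<in>Basis. (u x \<bullet> b) *\<^sub>R ?D b h)" for h
    using frechet_derivative_eqI[OF *[OF has_derivative_const[of "u x"]]] by simp
  have 2: "L x (frechet_derivative u (at x) h) =
      (\<Sum>b\<in>Basis. (frechet_derivative u (at x) h \<bullet> b) *\<^sub>R L x b)" for h
    by (rule linear_expand[OF lin[OF S(2)]])
  show ?thesis using *[OF U] unfolding 1 2 sum.distrib .
qed

text \<open>The differentiated family is again a linear family. This allows
  \<open>Ck_on_linear_family\<close> to be applied to it in the induction of
  \<open>Ck_on_linear_system\<close>.\<close>

lemma linear_frechet_family:
  fixes L :: "'a::euclidean_space \<Rightarrow> 'b::euclidean_space \<Rightarrow> 'c::real_normed_vector"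
  assumes S: "open S" "x \<in> S" and lin: "\<And>y. y \<in> S \<Longrightarrow> linear (L y)"
    and dL: "\<And>w. (\<lambda>y. L y w) differentiable at x"
  shows "linear (\<lambda>w. frechet_derivative (\<lambda>y. L y w) (at x) h)"
proof (rule linearI)
  fix v w :: 'b and r :: real
  have "((\<lambda>y. L y (v + w)) has_derivative
      (\<lambda>h. frechet_derivative (\<lambda>y. L y v) (at x) h + frechet_derivative (\<lambda>y. L y w) (at x) h)) (at x)"
    by (rule has_derivative_transform_within_open[OF has_derivative_add[OF frechetI[OF dL] frechetI[OF dL]] S])
      (simp add: linear_add[OF lin])
  from frechet_derivative_eqI[OF this]
  show "frechet_derivative (\<lambda>y. L y (v + w)) (at x) h =
     frechet_derivative (\<lambda>y. L y v) (at x) h + frechet_derivative (\<lambda>y. L y w) (at x) h" by simp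
  have "((\<lambda>y. L y (r *\<^sub>R v)) has_derivative (\<lambda>h. r *\<^sub>R frechet_derivative (\<lambda>y. L y v) (at x) h)) (at x)"
    by (rule has_derivative_transform_within_open[OF has_derivative_scaleR_right[OF frechetI[OF dL]] S])
      (simp add: linear_scale[OF lin])
  from frechet_derivative_eqI[OF this]
  show "frechet_derivative (\<lambda>y. L y (r *\<^sub>R v)) (at x) h = r *\<^sub>R frechet_derivative (\<lambda>y. L y v) (at x) h"
    by simp
qed

lemma Ck_on_linear_family:
  fixes L :: "'a::euclidean_space \<Rightarrow> 'b::euclidean_space \<Rightarrow> 'c::real_normed_vector"
  assumes S: "open S" and lin: "\<And>y. y \<in> S \<Longrightarrow> linear (L y)"
    and "\<And>w. Ck_on k S (\<lambda>y. L y w)" "Ck_on k S u"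
  shows "Ck_on k S (\<lambda>y. L y (u y))"
proof (rule Ck_on_cong[OF S])
  show "Ck_on k S (\<lambda>y. \<Sum>b\<in>Basis. (u y \<bullet> b) *\<^sub>R L y b)"
    by (intro Ck_on_sum Ck_on_scaleR S assms Ck_on_compose_bounded_linear[OF bounded_linear_inner_left])
qed (use linear_expand[OF lin] in metis)

lemma smooth_on_linear_family:
  fixes L :: "'a::euclidean_space \<Rightarrow> 'b::euclidean_space \<Rightarrow> 'c::real_normed_vector"
  shows "open S \<Longrightarrow> (\<And>y. y \<in> S \<Longrightarrow> linear (L y)) \<Longrightarrow> (\<And>w. smooth_on S (\<lambda>y. L y w)) \<Longrightarrow>
    smooth_on S u \<Longrightarrow> smooth_on S (\<lambda>y. L y (u y))"
  unfolding smooth_on_def using Ck_on_linear_family by blast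

lemma bilinear_linear: "bilinear B \<Longrightarrow> linear (B x)" "bilinear B \<Longrightarrow> linear (\<lambda>x. B x y)"
  by (auto simp: bilinear_def)

lemma bilinear_family_has_derivative:
  fixes B :: "'a::euclidean_space \<Rightarrow> 'b::euclidean_space \<Rightarrow> 'd::euclidean_space \<Rightarrow> 'c::real_normed_vector"
  assumes S: "open S" "x \<in> S" and bil: "\<And>y. y \<in> S \<Longrightarrow> bilinear (B y)"
    and dB: "\<And>w z. (\<lambda>y. B y w z) differentiable at x"
    and du: "u differentiable at x" and dv: "v differentiable at x"
  shows "((\<lambda>y. B y (u y) (v y)) has_derivative
     (\<lambda>h. frechet_derivative (\<lambda>y. B y (u x) (v x)) (at x) h + B x (frechet_derivative u (at x) h) (v x)
        + B x (u x) (frechet_derivative v (at x) h))) (at x)"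
proof -
  have 1: "((\<lambda>y. B y (u y) z) has_derivative
     (\<lambda>h. frechet_derivative (\<lambda>y. B y (u x) z) (at x) h + B x (frechet_derivative u (at x) h) z)) (at x)"
    for z
    by (rule linear_family_has_derivative[OF S _ dB du]) (use bil bilinear_linear in blast)
  have 2: "((\<lambda>y. B y (u y) (v y)) has_derivative
     (\<lambda>h. frechet_derivative (\<lambda>y. B y (u y) (v x)) (at x) h + B x (u x) (frechet_derivative v (at x) h))) (at x)"
    by (rule linear_family_has_derivative[OF S _ _ dv, where L = "\<lambda>y. B y (u y)"])
      (use bil bilinear_linear 1 differentiable_def in blast)+
  show ?thesis using 2 unfolding frechet_derivative_eqI[OF 1] by simp
qed

lemma smooth_on_bilinear_family:
  fixes B :: "'a::euclidean_space \<Rightarrow> 'b::euclidean_space \<Rightarrow> 'd::euclidean_space \<Rightarrow> 'c::real_normed_vector"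
  assumes S: "open S" and bil: "\<And>y. y \<in> S \<Longrightarrow> bilinear (B y)"
    and "\<And>w z. smooth_on S (\<lambda>y. B y w z)" "smooth_on S u" "smooth_on S v"
  shows "smooth_on S (\<lambda>y. B y (u y) (v y))"
  by (rule smooth_on_linear_family[OF S, where L = "\<lambda>y. B y (u y)"],
      use bil bilinear_linear in blast,
      rule smooth_on_linear_family[OF S, where L = "\<lambda>y w. B y w z" for z])
    (use assms bilinear_linear in blast)+

section \<open>Symmetry of second derivatives\<close>

lemma has_real_derivative_along_curve:
  fixes g :: "'a::real_normed_vector \<Rightarrow> real"
  assumes c: "(c has_derivative (\<lambda>k. k *\<^sub>R u)) (at s)" and g: "g differentiable at (c s)"
  shows "((\<lambda>s. g (c s)) has_real_derivative frechet_derivative g (at (c s)) u) (at s)"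
proof -
  have "((\<lambda>s. g (c s)) has_derivative (\<lambda>k. frechet_derivative g (at (c s)) (k *\<^sub>R u))) (at s)"
    by (rule has_derivative_compose[OF c frechetI[OF g]])
  then show ?thesis
    unfolding has_field_derivative_def
    by (rule has_derivative_eq_rhs) (simp add: fun_eq_iff linear_scale[OF linear_frechet_derivative[OF g]])
qed

text \<open>Two applications of the mean value theorem, first in direction \<open>u\<close>, then in
  direction \<open>v\<close>. The second difference on the left is symmetric in \<open>u\<close> and
  \<open>v\<close>, the mixed derivative on the right is not visibly so; this tension proves the
  symmetry.\<close>

lemma second_difference_mvt:
  fixes f :: "'a::euclidean_space \<Rightarrow> real"
  assumes f: "Ck_on 2 S f" and S: "open S" "ball x r \<subseteq> S" and h: "h > 0" "h * (norm u + norm v) < r"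
  shows "\<exists>y. dist x y < r \<and> f (x + h *\<^sub>R u + h *\<^sub>R v) - f (x + h *\<^sub>R u) - f (x + h *\<^sub>R v) + f x =
     h * h * frechet_derivative (\<lambda>z. frechet_derivative f (at z) u) (at y) v"
proof -
  let ?F = "\<lambda>z. frechet_derivative f (at z) u"
  have df: "f differentiable at z" "?F differentiable at z" if "z \<in> S" for z
    using f that by (auto simp: numeral_2_eq_2)
  have inS: "x + s *\<^sub>R u + t *\<^sub>R v \<in> ball x r" if "0 \<le> s" "s \<le> h" "0 \<le> t" "t \<le> h" for s t
  proof -
    have "norm (s *\<^sub>R u + t *\<^sub>R v) \<le> s * norm u + t * norm v"
      using norm_triangle_ineq[of "s *\<^sub>R u" "t *\<^sub>R v"] that by simp
    also have "\<dots> \<le> h * norm u + h * norm v"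
      using that by (intro add_mono mult_right_mono) auto
    also have "\<dots> < r" using h by (simp add: distrib_left)
    finally have "dist (x + (s *\<^sub>R u + t *\<^sub>R v)) x < r" unfolding dist_norm by simp
    then show ?thesis by (simp add: dist_commute add.assoc)
  qed
  have 1: "((\<lambda>s. f (x + s *\<^sub>R u + t *\<^sub>R v)) has_real_derivative ?F (x + s *\<^sub>R u + t *\<^sub>R v)) (at s)"
    if "0 \<le> s" "s \<le> h" "0 \<le> t" "t \<le> h" for s t
    by (rule has_real_derivative_along_curve)
      (use inS[OF that] S df(1) in \<open>auto intro!: derivative_eq_intros\<close>)
  have 2: "((\<lambda>t. ?F (x + s *\<^sub>R u + t *\<^sub>R v)) has_real_derivative
     frechet_derivative ?F (at (x + s *\<^sub>R u + t *\<^sub>R v)) v) (at t)"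
    if "0 \<le> s" "s \<le> h" "0 \<le> t" "t \<le> h" for s t
    by (rule has_real_derivative_along_curve)
      (use inS[OF that] S df(2) in \<open>auto intro!: derivative_eq_intros\<close>)
  let ?k = "\<lambda>s. f (x + s *\<^sub>R u + h *\<^sub>R v) - f (x + s *\<^sub>R u + 0 *\<^sub>R v)"
  obtain s where s: "0 < s" "s < h"
    and ks: "?k h - ?k 0 = (h - 0) * (?F (x + s *\<^sub>R u + h *\<^sub>R v) - ?F (x + s *\<^sub>R u + 0 *\<^sub>R v))"
    using MVT2[of 0 h ?k "\<lambda>s. ?F (x + s *\<^sub>R u + h *\<^sub>R v) - ?F (x + s *\<^sub>R u + 0 *\<^sub>R v)"]
      DERIV_diff[OF 1[of _ h] 1[of _ 0]] h by auto
  obtain t where t: "0 < t" "t < h"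
    and kt: "?F (x + s *\<^sub>R u + h *\<^sub>R v) - ?F (x + s *\<^sub>R u + 0 *\<^sub>R v) =
      (h - 0) * frechet_derivative ?F (at (x + s *\<^sub>R u + t *\<^sub>R v)) v"
    using MVT2[of 0 h "\<lambda>t. ?F (x + s *\<^sub>R u + t *\<^sub>R v)"
        "\<lambda>t. frechet_derivative ?F (at (x + s *\<^sub>R u + t *\<^sub>R v)) v"] 2[of s] s h by auto
  have "dist x (x + s *\<^sub>R u + t *\<^sub>R v) < r" using inS[of s t] s t by auto
  moreover have "f (x + h *\<^sub>R u + h *\<^sub>R v) - f (x + h *\<^sub>R u) - f (x + h *\<^sub>R v) + f x = ?k h - ?k 0"
    by simp
  ultimately show ?thesis using ks kt by auto
qed

text \<open>Evaluating the same second difference in both orders shows that the two mixed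
  derivatives take a common value at two points close to \<open>x\<close>; their continuity at
  \<open>x\<close> then brings them within any \<open>e\<close> of each other.\<close>

lemma second_derivative_symmetric_real:
  fixes f :: "'a::euclidean_space \<Rightarrow> real"
  assumes f: "Ck_on 2 S f" and S: "open S" "x \<in> S"
  shows "frechet_derivative (\<lambda>z. frechet_derivative f (at z) u) (at x) v =
     frechet_derivative (\<lambda>z. frechet_derivative f (at z) v) (at x) u"
proof -
  let ?G = "\<lambda>u v y. frechet_derivative (\<lambda>z. frechet_derivative f (at z) u) (at y) v"
  have cont: "continuous_on S (?G u v)" for u v
    using f by (auto simp: numeral_2_eq_2)
  have "\<bar>?G u v x - ?G v u x\<bar> \<le> e" if e: "e > 0" for e
  proof -
    have *: "\<exists>d>0. \<forall>y. dist x y < d \<longrightarrow> \<bar>?G u v y - ?G u v x\<bar> < e / 2" for u v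
    proof -
      have "isCont (?G u v) x" using cont S by (simp add: continuous_on_eq_continuous_at)
      then obtain d where "d > 0" "\<forall>y. dist y x < d \<longrightarrow> dist (?G u v y) (?G u v x) < e / 2"
        using half_gt_zero[OF e] unfolding continuous_at_eps_delta by blast
      then show ?thesis
        by (intro exI[of _ d]) (simp add: dist_real_def dist_commute)
    qed
    obtain d1 where d1: "d1 > 0" "\<And>y. dist x y < d1 \<Longrightarrow> \<bar>?G u v y - ?G u v x\<bar> < e / 2"
      using *[of u v] by blast
    obtain d2 where d2: "d2 > 0" "\<And>y. dist x y < d2 \<Longrightarrow> \<bar>?G v u y - ?G v u x\<bar> < e / 2"
      using *[of v u] by blast
    obtain r0 where r0: "r0 > 0" "ball x r0 \<subseteq> S" using S open_contains_ball by blast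
    define r where "r = min r0 (min d1 d2)"
    have r: "r > 0" "ball x r \<subseteq> S" using r0 d1 d2 by (auto simp: r_def)
    \<comment> \<open>The step keeps the whole parallelogram inside the ball of radius
      \<open>r\<close>; the summand 1 keeps the denominator positive when \<open>u\<close> and
      \<open>v\<close> are both zero.\<close>
    define h where "h = r / (2 * (norm u + norm v + 1))"
    have "norm u + norm v + 1 > 0" by (simp add: add_nonneg_pos)
    then have h: "h > 0" using r by (simp add: h_def)
    have "h * (norm u + norm v + 1) = r / 2"
      using \<open>norm u + norm v + 1 > 0\<close> by (simp add: h_def field_simps)
    then have hr: "h * (norm u + norm v) < r" "h * (norm v + norm u) < r"
      using h r by (auto simp: algebra_simps)
    obtain y where y: "dist x y < r"
      "f (x + h *\<^sub>R u + h *\<^sub>R v) - f (x + h *\<^sub>R u) - f (x + h *\<^sub>R v) + f x = h * h * ?G u v y"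
      using second_difference_mvt[OF f S(1) r(2) h hr(1)] by auto
    obtain y' where y': "dist x y' < r"
      "f (x + h *\<^sub>R v + h *\<^sub>R u) - f (x + h *\<^sub>R v) - f (x + h *\<^sub>R u) + f x = h * h * ?G v u y'"
      using second_difference_mvt[OF f S(1) r(2) h hr(2)] by auto
    have eq: "x + h *\<^sub>R v + h *\<^sub>R u = x + h *\<^sub>R u + h *\<^sub>R v" by simp
    have "h * h * ?G v u y' = h * h * ?G u v y" using y(2) y'(2) unfolding eq by linarith
    then have "?G v u y' = ?G u v y" using h by simp
    moreover have "dist x y < d1" "dist x y' < d2" using y(1) y'(1) by (auto simp: r_def)
    ultimately show ?thesis using d1(2)[of y] d2(2)[of y'] by linarith
  qed
  then have "\<bar>?G u v x - ?G v u x\<bar> \<le> 0" by (rule field_le_epsilon) simp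
  then show ?thesis by simp
qed

lemma second_derivative_symmetric:
  fixes f :: "'a::euclidean_space \<Rightarrow> 'b::euclidean_space"
  assumes f: "smooth_on S f" and S: "open S" "x \<in> S"
  shows "frechet_derivative (\<lambda>z. frechet_derivative f (at z) u) (at x) v =
     frechet_derivative (\<lambda>z. frechet_derivative f (at z) v) (at x) u"
proof (rule euclidean_eqI)
  fix b :: 'b assume "b \<in> Basis"
  have sb: "smooth_on S (\<lambda>z. f z \<bullet> b)"
    by (rule smooth_on_compose_bounded_linear[OF bounded_linear_inner_left S(1) f])
  have *: "frechet_derivative (\<lambda>z. g z \<bullet> b) (at y) w = frechet_derivative g (at y) w \<bullet> b"
    if "smooth_on S g" "y \<in> S" for g :: "'a \<Rightarrow> 'b" and y w
    using frechet_derivative_eqI[OF has_derivative_inner_left[OF smooth_on_has_derivative[OF that]]]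
    by simp
  have **: "frechet_derivative (\<lambda>z. frechet_derivative f (at z) w) (at x) w' \<bullet> b =
    frechet_derivative (\<lambda>z. frechet_derivative (\<lambda>z. f z \<bullet> b) (at z) w) (at x) w'" for w w'
  proof -
    have "frechet_derivative (\<lambda>z. frechet_derivative f (at z) w \<bullet> b) (at x) w' =
      frechet_derivative (\<lambda>z. frechet_derivative (\<lambda>z. f z \<bullet> b) (at z) w) (at x) w'"
      by (rule fun_cong[OF frechet_derivative_transform_within_open[OF _ S]])
        (use *[OF f] differentiableI[OF has_derivative_inner_left[OF
            smooth_on_has_derivative[OF smooth_on_frechet[OF f] S(2)]]] in auto)
    then show ?thesis using *[OF smooth_on_frechet[OF f] S(2)] by simp
  qed
  have "Ck_on 2 S (\<lambda>z. f z \<bullet> b)" using sb by (simp add: smooth_on_def)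
  then show "frechet_derivative (\<lambda>z. frechet_derivative f (at z) u) (at x) v \<bullet> b =
     frechet_derivative (\<lambda>z. frechet_derivative f (at z) v) (at x) u \<bullet> b"
    unfolding ** by (rule second_derivative_symmetric_real[OF _ S])
qed

section \<open>Regularity of the solutions of linear systems\<close>

lemma has_derivative_scaleR_vanishing:
  fixes g :: "'a::real_normed_vector \<Rightarrow> 'b::real_normed_vector" and q :: "'a \<Rightarrow> real"
  assumes g: "(g has_derivative g') (at x)" "g x = 0" and q: "isCont q x"
  shows "((\<lambda>y. q y *\<^sub>R g y) has_derivative (\<lambda>h. q x *\<^sub>R g' h)) (at x)"
proof -
  have 1: "((\<lambda>y. q x *\<^sub>R g y) has_derivative (\<lambda>h. q x *\<^sub>R g' h)) (at x)"
    by (intro has_derivative_scaleR_right g)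
  \<comment> \<open>This is where continuity of \<open>q\<close> is enough: since
    \<open>g x = 0\<close>, the quotient \<open>norm (g y) / norm (y - x)\<close> stays bounded, and
    it is multiplied by \<open>q y - q x\<close>, which tends to 0.\<close>
  have 2: "((\<lambda>y. (q y - q x) *\<^sub>R g y) has_derivative (\<lambda>h. 0)) (at x)"
    unfolding has_derivative_iff_norm
  proof (intro conjI bounded_linear_zero)
    have bl: "bounded_linear g'" using g(1) has_derivative_bounded_linear by blast
    obtain K where K: "K > 0" "\<And>h. norm (g' h) \<le> norm h * K"
      using bounded_linear.pos_bounded[OF bl] by blast
    have lim: "((\<lambda>y. norm (g y - g x - g' (y - x)) / norm (y - x)) \<longlongrightarrow> 0) (at x)"
      using g(1)[unfolded has_derivative_iff_norm] by simp
    have "((\<lambda>y. \<bar>q y - q x\<bar> * (norm (g y - g x - g' (y - x)) / norm (y - x) + K)) \<longlongrightarrow> 0 * (0 + K)) (at x)"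
      using q by (intro tendsto_mult tendsto_add lim tendsto_const tendsto_rabs_zero LIM_zero)
        (simp add: isCont_def)
    then have l0: "((\<lambda>y. \<bar>q y - q x\<bar> * (norm (g y - g x - g' (y - x)) / norm (y - x) + K)) \<longlongrightarrow> 0) (at x)" by simp
    show "((\<lambda>y. norm ((q y - q x) *\<^sub>R g y - (q x - q x) *\<^sub>R g x - 0) / norm (y - x)) \<longlongrightarrow> 0) (at x)"
    proof (rule Lim_null_comparison[OF _ l0])
      show "\<forall>\<^sub>F y in at x. norm (norm ((q y - q x) *\<^sub>R g y - (q x - q x) *\<^sub>R g x - 0) / norm (y - x))
         \<le> \<bar>q y - q x\<bar> * (norm (g y - g x - g' (y - x)) / norm (y - x) + K)"
        unfolding eventually_at_filter
      proof (rule always_eventually, intro allI impI)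
        fix y assume "y \<noteq> x"
        then have p: "norm (y - x) > 0" by simp
        have "norm (g y) \<le> norm (g y - g x - g' (y - x)) + norm (g' (y - x))"
          using norm_triangle_ineq[of "g y - g x - g' (y - x)" "g' (y - x)"] g(2) by simp
        also have "\<dots> \<le> norm (g y - g x - g' (y - x)) + norm (y - x) * K" using K by simp
        finally have "norm (g y) / norm (y - x) \<le> norm (g y - g x - g' (y - x)) / norm (y - x) + K"
          using p by (simp add: field_simps)
        from mult_left_mono[OF this, of "\<bar>q y - q x\<bar>"]
        show "norm (norm ((q y - q x) *\<^sub>R g y - (q x - q x) *\<^sub>R g x - 0) / norm (y - x))
         \<le> \<bar>q y - q x\<bar> * (norm (g y - g x - g' (y - x)) / norm (y - x) + K)"
          by simp
      qed
    qed
  qed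
  show ?thesis using has_derivative_add[OF 1 2] by (simp add: algebra_simps)
qed


text \<open>The injective map \<open>L x\<close> is bounded below by some \<open>c\<close>. Near
  \<open>x\<close> the map \<open>L y\<close> differs from it by less than \<open>c / 2\<close>
  relative to the norm, so half of the lower bound survives and controls \<open>z y - z x\<close> by
  quantities tending to 0.\<close>

lemma linear_system_isCont:
  fixes L :: "'a::euclidean_space \<Rightarrow> 'b::euclidean_space \<Rightarrow> 'b" and z a :: "'a \<Rightarrow> 'b"
  assumes S: "open S" "x \<in> S"
    and L: "\<And>y. y \<in> S \<Longrightarrow> linear (L y)" "inj (L x)"
    and cL: "\<And>w. isCont (\<lambda>y. L y w) x" and ca: "isCont a x"
    and z: "\<And>y. y \<in> S \<Longrightarrow> L y (z y) = a y"
  shows "isCont z x"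
proof -
  obtain c where c: "c > 0" "\<And>w. c * norm w \<le> norm (L x w)"
    using linear_inj_bounded_below_pos[OF L(1)[OF S(2)] L(2)] by auto
  define \<epsilon> where "\<epsilon> y = (\<Sum>b\<in>Basis. norm (L y b - L x b))" for y
  have \<epsilon>: "norm (L y w - L x w) \<le> \<epsilon> y * norm w" if "y \<in> S" for y w
  proof -
    have "L y w - L x w = (\<Sum>b\<in>Basis. (w \<bullet> b) *\<^sub>R (L y b - L x b))"
      using linear_expand[OF L(1)[OF that], of w] linear_expand[OF L(1)[OF S(2)], of w]
      by (simp add: scaleR_right_diff_distrib sum_subtractf)
    also have "norm \<dots> \<le> (\<Sum>b\<in>Basis. norm w * norm (L y b - L x b))"
      by (rule sum_norm_le) (simp add: Basis_le_norm mult_right_mono)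
    finally show ?thesis by (simp add: \<epsilon>_def sum_distrib_left mult.commute)
  qed
  have ev: "\<forall>\<^sub>F y in at x. y \<in> S" using S eventually_at_topological by blast
  have l\<epsilon>: "(\<epsilon> \<longlongrightarrow> 0) (at x)"
  proof -
    have "isCont \<epsilon> x" unfolding \<epsilon>_def by (intro continuous_intros cL)
    then show ?thesis by (simp add: isCont_def \<epsilon>_def)
  qed
  then have ev\<epsilon>: "\<forall>\<^sub>F y in at x. \<epsilon> y < c / 2" using c by (intro order_tendstoD) auto
  have "((\<lambda>y. z y - z x) \<longlongrightarrow> 0) (at x)"
  proof (rule Lim_null_comparison)
    show "\<forall>\<^sub>F y in at x. norm (z y - z x) \<le> (2 / c) * (norm (a y - a x) + \<epsilon> y * norm (z x))"
      using ev ev\<epsilon>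
    proof eventually_elim
      case (elim y)
      have "L x (z y - z x) = (a y - a x) - (L y (z y) - L x (z y))"
        using z[OF elim(1)] z[OF S(2)] linear_diff[OF L(1)[OF S(2)]] by simp
      then have "c * norm (z y - z x) \<le> norm (a y - a x) + norm (L y (z y) - L x (z y))"
        using c(2)[of "z y - z x"] norm_triangle_ineq4[of "a y - a x" "L y (z y) - L x (z y)"] by simp
      also have "norm (L y (z y) - L x (z y)) \<le> \<epsilon> y * norm (z y)" by (rule \<epsilon>[OF elim(1)])
      \<comment> \<open>No bound on \<open>z y\<close> is known yet, so it is split. The part with
        \<open>z y - z x\<close> is absorbed by the left-hand side because
        \<open>\<epsilon> y < c / 2\<close>.\<close>
      also have "\<epsilon> y * norm (z y) \<le> \<epsilon> y * (norm (z y - z x) + norm (z x))"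
        using norm_triangle_sub[of "z y" "z x"]
        by (intro mult_left_mono) (auto simp: \<epsilon>_def sum_nonneg)
      also have "\<dots> \<le> c / 2 * norm (z y - z x) + \<epsilon> y * norm (z x)"
        using elim(2) mult_right_mono[of "\<epsilon> y" "c / 2" "norm (z y - z x)"] by (simp add: distrib_left)
      finally have "c / 2 * norm (z y - z x) \<le> norm (a y - a x) + \<epsilon> y * norm (z x)" by simp
      then show ?case using c(1) by (simp add: field_simps)
    qed
    have "((\<lambda>y. (2 / c) * (norm (a y - a x) + \<epsilon> y * norm (z x))) \<longlongrightarrow> (2 / c) * (0 + 0 * norm (z x))) (at x)"
      by (intro tendsto_intros l\<epsilon> tendsto_norm_zero LIM_zero) (use ca in \<open>simp add: isCont_def\<close>)
    then show "((\<lambda>y. (2 / c) * (norm (a y - a x) + \<epsilon> y * norm (z x))) \<longlongrightarrow> 0) (at x)" by simp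
  qed
  then show "isCont z x" using LIM_zero_cancel unfolding isCont_def by blast
qed

text \<open>The system can be rewritten as \<open>L x (z y - z x) = r y\<close>. In \<open>r\<close>
  the unknown \<open>z y\<close> only multiplies the differences \<open>L y b - L x b\<close>, which
  vanish at \<open>x\<close>; for such products the continuity of \<open>z\<close> suffices. A left
  inverse of \<open>L x\<close> then recovers \<open>z\<close>.\<close>

lemma linear_system_differentiable:
  fixes L :: "'a::euclidean_space \<Rightarrow> 'b::euclidean_space \<Rightarrow> 'b" and z a :: "'a \<Rightarrow> 'b"
  assumes S: "open S" "x \<in> S"
    and L: "\<And>y. y \<in> S \<Longrightarrow> linear (L y)" "inj (L x)"
    and dL: "\<And>w. (\<lambda>y. L y w) differentiable at x" and da: "a differentiable at x"
    and z: "\<And>y. y \<in> S \<Longrightarrow> L y (z y) = a y"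
  shows "z differentiable at x"
proof -
  have cz: "isCont z x"
    by (rule linear_system_isCont[where a = a and L = L, OF S L])
      (auto intro: differentiable_imp_continuous_within dL da z)
  obtain m where m: "linear m" "m \<circ> L x = id"
    using linear_injective_left_inverse[OF L(1)[OF S(2)] L(2)] by auto
  define r where "r y = a y - a x - (\<Sum>b\<in>Basis. (z y \<bullet> b) *\<^sub>R (L y b - L x b))" for y
  have "\<exists>D. (r has_derivative D) (at x)"
  proof -
    have dLb: "((\<lambda>y. L y b - L x b) has_derivative frechet_derivative (\<lambda>y. L y b) (at x)) (at x)" for b
      using has_derivative_diff[OF frechetI[OF dL] has_derivative_const, of b "L x b"] by simp
    have "((\<lambda>y. (z y \<bullet> b) *\<^sub>R (L y b - L x b)) has_derivative
       (\<lambda>h. (z x \<bullet> b) *\<^sub>R frechet_derivative (\<lambda>y. L y b) (at x) h)) (at x)" for b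
      by (rule has_derivative_scaleR_vanishing[OF dLb]) (auto intro!: continuous_intros cz)
    then have "((\<lambda>y. a y - a x - (\<Sum>b\<in>Basis. (z y \<bullet> b) *\<^sub>R (L y b - L x b))) has_derivative
       (\<lambda>h. frechet_derivative a (at x) h - 0 -
          (\<Sum>b\<in>Basis. (z x \<bullet> b) *\<^sub>R frechet_derivative (\<lambda>y. L y b) (at x) h))) (at x)"
      by (intro has_derivative_diff has_derivative_sum has_derivative_const frechetI[OF da])
    then show ?thesis unfolding r_def by blast
  qed
  then obtain D where "(r has_derivative D) (at x)" by blast
  then have "((\<lambda>y. z x + m (r y)) has_derivative (\<lambda>h. 0 + m (D h))) (at x)"
    by (intro has_derivative_add has_derivative_const
        bounded_linear.has_derivative[OF linear_conv_bounded_linear[THEN iffD1, OF m(1)]])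
  then have dm: "(\<lambda>y. z x + m (r y)) differentiable at x" by (rule differentiableI)
  show ?thesis
  proof (rule differentiable_cong_open[OF dm S])
    fix y assume y: "y \<in> S"
    have e: "(\<Sum>b\<in>Basis. (z y \<bullet> b) *\<^sub>R (L y b - L x b)) = L y (z y) - L x (z y)"
      using linear_expand[OF L(1)[OF y], of "z y"] linear_expand[OF L(1)[OF S(2)], of "z y"]
      by (simp add: scaleR_right_diff_distrib sum_subtractf)
    have "r y = L x (z y - z x)"
      unfolding r_def e using z[OF y] z[OF S(2)] linear_diff[OF L(1)[OF S(2)], of "z y" "z x"] by simp
    then have "m (r y) = z y - z x" using fun_cong[OF m(2), of "z y - z x"] by simp
    then show "z x + m (r y) = z y" by simp
  qed
qed

text \<open>Differentiating \<open>L y (z y) = a y\<close> shows that the derivative of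
  \<open>z\<close> solves a system with the same \<open>L\<close> and a new right-hand side
  containing \<open>z\<close> itself. Hence the induction runs over all \<open>a\<close> and
  \<open>z\<close>.\<close>

lemma Ck_on_linear_system:
  fixes L :: "'a::euclidean_space \<Rightarrow> 'b::euclidean_space \<Rightarrow> 'b"
  assumes S: "open S"
    and L: "\<And>y. y \<in> S \<Longrightarrow> linear (L y)" "\<And>y. y \<in> S \<Longrightarrow> inj (L y)"
    and sL: "\<And>w. smooth_on S (\<lambda>y. L y w)"
    and "Ck_on k S a" "\<And>y. y \<in> S \<Longrightarrow> L y (z y) = a y"
  shows "Ck_on k S z"
  using assms(5,6)
proof (induction k arbitrary: a z)
  case 0
  have "isCont z x" if "x \<in> S" for x
    by (rule linear_system_isCont[where a = a and L = L, OF S that L(1) L(2)[OF that]])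
      (use 0 that S smooth_on_continuous_on[OF sL] in \<open>auto simp: continuous_on_eq_continuous_at\<close>)
  then show ?case by (simp add: continuous_at_imp_continuous_on)
next
  case (Suc k)
  have da: "a differentiable at x" if "x \<in> S" for x using Suc.prems that by simp
  have dL: "(\<lambda>y. L y w) differentiable at x" if "x \<in> S" for x w
    using smooth_on_differentiable[OF sL that] .
  have dz: "z differentiable at x" if "x \<in> S" for x
    by (rule linear_system_differentiable[where a = a and L = L, OF S that L(1) L(2)[OF that] dL[OF that] da[OF that]])
      (use Suc.prems in auto)
  have zk: "Ck_on k S z" by (rule Suc.IH[OF Ck_on_SucD[OF Suc.prems(1)]]) (use Suc.prems in auto)
  have "Ck_on k S (\<lambda>x. frechet_derivative z (at x) u)" for u
  proof (rule Suc.IH)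
    let ?a = "\<lambda>x. frechet_derivative a (at x) u - frechet_derivative (\<lambda>y. L y (z x)) (at x) u"
    have "Ck_on k S (\<lambda>x. frechet_derivative (\<lambda>y. L y (z x)) (at x) u)"
      by (rule Ck_on_linear_family[OF S _ _ zk, where L = "\<lambda>x w. frechet_derivative (\<lambda>y. L y w) (at x) u"])
        (use linear_frechet_family[OF S _ L(1) dL] smooth_on_frechet[OF sL]
          in \<open>auto simp: smooth_on_def\<close>)
    then have "Ck_on k S (\<lambda>x. - frechet_derivative (\<lambda>y. L y (z x)) (at x) u)"
      by (rule Ck_on_compose_bounded_linear[OF bounded_linear_minus[OF bounded_linear_ident] S])
    then show "Ck_on k S ?a"
      using Ck_on_add[OF S, of k "\<lambda>x. frechet_derivative a (at x) u"] Suc.prems(1) by force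
    fix x assume x: "x \<in> S"
    have "(a has_derivative (\<lambda>h. frechet_derivative (\<lambda>y. L y (z x)) (at x) h + L x (frechet_derivative z (at x) h))) (at x)"
      by (rule has_derivative_transform_within_open[OF
            linear_family_has_derivative[OF S x L(1) dL[OF x] dz[OF x]] S x]) (use Suc.prems(2) in auto)
    from frechet_derivative_eqI[OF this] show "L x (frechet_derivative z (at x) u) = ?a x" by simp
  qed
  then show ?case using dz by simp
qed

lemma smooth_on_linear_system:
  fixes L :: "'a::euclidean_space \<Rightarrow> 'b::euclidean_space \<Rightarrow> 'b"
  assumes "open S" "\<And>y. y \<in> S \<Longrightarrow> linear (L y)" "\<And>y. y \<in> S \<Longrightarrow> inj (L y)"
    "\<And>w. smooth_on S (\<lambda>y. L y w)" "smooth_on S a" "\<And>y. y \<in> S \<Longrightarrow> L y (z y) = a y"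
  shows "smooth_on S z"
  using assms Ck_on_linear_system[of S L _ a z] by (simp add: smooth_on_def)

text \<open>Testing against basis vectors turns a nondegenerate form into an injective linear map
  (its Gram matrix). In this shape the lemma gives smoothness both of the Christoffel form and of
  the tangential components of a field along the immersion.\<close>

lemma smooth_on_bilinear_system:
  fixes B :: "'a::euclidean_space \<Rightarrow> 'b::euclidean_space \<Rightarrow> 'b \<Rightarrow> real"
  assumes S: "open S" and B: "\<And>y. y \<in> S \<Longrightarrow> bilinear (B y)"
    and nd: "\<And>y u. y \<in> S \<Longrightarrow> (\<And>v. B y u v = 0) \<Longrightarrow> u = 0"
    and sB: "\<And>u v. smooth_on S (\<lambda>y. B y u v)"
    and sa: "\<And>v. smooth_on S (\<lambda>y. \<alpha> y v)" and z: "\<And>y v. y \<in> S \<Longrightarrow> B y (z y) v = \<alpha> y v"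
  shows "smooth_on S z"
proof (rule smooth_on_linear_system[OF S])
  let ?L = "\<lambda>y u. \<Sum>b\<in>Basis. B y u b *\<^sub>R b"
  show lin: "linear (?L y)" if "y \<in> S" for y
    by (rule linearI)
      (auto simp: linear_add[OF bilinear_linear(2)[OF B[OF that]]] linear_scale[OF bilinear_linear(2)[OF B[OF that]]]
        scaleR_add_left sum.distrib scaleR_sum_right)
  show "inj (?L y)" if y: "y \<in> S" for y
  proof (subst linear_injective_0[OF lin[OF y]], intro allI impI)
    fix u assume 0: "?L y u = 0"
    have "B y u b = 0" if "b \<in> Basis" for b
      using arg_cong[OF 0, of "\<lambda>w. w \<bullet> b"] that by (simp add: inner_sum_left inner_Basis sum.delta if_distrib cong: if_cong)
    then have "B y u v = 0" for v
      using linear_expand[OF bilinear_linear(1)[OF B[OF y]], of u v] by simp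
    then show "u = 0" by (rule nd[OF y])
  qed
  show "smooth_on S (\<lambda>y. ?L y w)" for w by (intro smooth_on_sum smooth_on_scaleR S sB smooth_on_const)
  show "smooth_on S (\<lambda>y. \<Sum>b\<in>Basis. \<alpha> y b *\<^sub>R b)"
    by (intro smooth_on_sum smooth_on_scaleR S sa smooth_on_const)
  show "?L y (z y) = (\<Sum>b\<in>Basis. \<alpha> y b *\<^sub>R b)" if "y \<in> S" for y using z[OF that] by simp
qed

subsection \<open>Bump functions\<close>

text \<open>
  All derivatives of \<open>exp (-1/x)\<close> are combinations of the functions \<open>x\<^sup>-\<^sup>n exp (-1/x)\<close>, which vanish
  to infinite order at \<open>0\<close>.
\<close>

definition exp_bump :: "nat \<Rightarrow> real \<Rightarrow> real" where
  "exp_bump n x = (if x > 0 then inverse x ^ n * exp (- inverse x) else 0)"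

lemma exp_bump_tendsto: "((\<lambda>x. inverse x ^ n * exp (- inverse x)) \<longlongrightarrow> 0) (at_right (0::real))"
proof -
  have "((\<lambda>x::real. x ^ n / exp x) \<longlongrightarrow> 0) at_top" by (rule tendsto_power_div_exp_0)
  from filterlim_compose[OF this filterlim_inverse_at_top_right]
  show ?thesis by (simp add: exp_minus divide_inverse)
qed

lemma exp_bump_deriv:
  "(exp_bump n has_real_derivative exp_bump (n + 2) x - real n * exp_bump (n + 1) x) (at x)"
proof -
  consider "x > 0" | "x < 0" | "x = 0" by linarith
  then show ?thesis
  proof cases
    case 1
    have "((\<lambda>u. u ^ n * exp (- u)) has_real_derivative
        real n * u ^ (n - 1) * exp (- u) - u ^ n * exp (- u)) (at u)" for u :: real
      by (auto intro!: derivative_eq_intros)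
    from DERIV_chain2[OF this DERIV_inverse[of x UNIV]] 1
    have "((\<lambda>x. inverse x ^ n * exp (- inverse x)) has_real_derivative
        (real n * inverse x ^ (n - 1) * exp (- inverse x) - inverse x ^ n * exp (- inverse x)) *
          - (inverse x ^ Suc (Suc 0))) (at x)" by simp
    moreover have "(real n * inverse x ^ (n - 1) * exp (- inverse x) - inverse x ^ n * exp (- inverse x)) *
          - (inverse x ^ Suc (Suc 0)) = exp_bump (n + 2) x - real n * exp_bump (n + 1) x"
      using 1 by (cases n) (simp_all add: exp_bump_def algebra_simps)
    ultimately have "((\<lambda>x. inverse x ^ n * exp (- inverse x)) has_real_derivative
       exp_bump (n + 2) x - real n * exp_bump (n + 1) x) (at x)" by simp
    then show ?thesis
      by (rule has_field_derivative_transform_within_open[where S = "{0<..}"]) (use 1 in \<open>auto simp: exp_bump_def\<close>)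
  next
    case 2
    have "((\<lambda>x. 0) has_real_derivative exp_bump (n + 2) x - real n * exp_bump (n + 1) x) (at x)"
      using 2 by (simp add: exp_bump_def)
    then show ?thesis
      by (rule has_field_derivative_transform_within_open[where S = "{..<0}"]) (use 2 in \<open>auto simp: exp_bump_def\<close>)
  next
    case 3
    have "((\<lambda>h. exp_bump n h / h) \<longlongrightarrow> 0) (at 0)"
      unfolding filterlim_at_split
    proof
      show "((\<lambda>h. exp_bump n h / h) \<longlongrightarrow> 0) (at_left 0)"
        by (rule tendsto_eventually) (auto simp: eventually_at_filter exp_bump_def)
      \<comment> \<open>Division by \<open>h\<close> raises the exponent by one, hence the instance
        \<open>Suc n\<close> of the limit.\<close>
      show "((\<lambda>h. exp_bump n h / h) \<longlongrightarrow> 0) (at_right 0)"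
        by (rule Lim_transform_eventually[OF exp_bump_tendsto[of "Suc n"]])
          (auto simp: eventually_at_filter exp_bump_def divide_inverse)
    qed
    then show ?thesis using 3 by (simp add: DERIV_def exp_bump_def)
  qed
qed

lemma smooth_on_exp_bump: "smooth_on UNIV (exp_bump n)"
proof -
  have "Ck_on k UNIV (exp_bump n)" for k
  proof (induction k arbitrary: n)
    case 0
    show ?case using DERIV_isCont[OF exp_bump_deriv] by (simp add: continuous_at_imp_continuous_on)
  next
    case (Suc k)
    have d: "(exp_bump n has_derivative (\<lambda>v. v *\<^sub>R (exp_bump (n + 2) x + (- real n) *\<^sub>R exp_bump (n + 1) x))) (at x)" for x
      using exp_bump_deriv[of n x] by (simp add: has_field_derivative_def mult_commute_abs)
    have "Ck_on k UNIV (\<lambda>x. v *\<^sub>R (exp_bump (n + 2) x + (- real n) *\<^sub>R exp_bump (n + 1) x))" for v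
      by (intro Ck_on_scaleR Ck_on_add Ck_on_const Suc.IH open_UNIV)
    then show ?case using d by (auto simp: frechet_derivative_eqI[OF d] differentiable_def)
  qed
  then show ?thesis by (simp add: smooth_on_def)
qed

lemma smooth_bump_exists:
  fixes x0 :: "'a::euclidean_space"
  assumes r: "r > 0"
  shows "\<exists>f :: 'a \<Rightarrow> real. smooth_on UNIV f \<and> (\<forall>x\<in>ball x0 r. f x = 1) \<and> (\<forall>x. x \<notin> ball x0 (2 * r) \<longrightarrow> f x = 0)"
proof -
  let ?s = "\<lambda>x. (x - x0) \<bullet> (x - x0)"
  \<comment> \<open>With \<open>?s\<close> the squared distance from the centre, \<open>?p\<close>
    lives inside the radius \<open>2 * r\<close> and \<open>?q\<close> outside the radius
    \<open>r\<close>. At every point one of them is positive, so the quotient of \<open>?p\<close>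
    by \<open>?p + ?q\<close> is smooth; it is 1 where \<open>?q\<close> vanishes and 0 where
    \<open>?p\<close> does.\<close>
  let ?p = "\<lambda>x. exp_bump 0 (4 * r\<^sup>2 - ?s x)" and ?q = "\<lambda>x. exp_bump 0 (?s x - r\<^sup>2)"
  have s: "smooth_on UNIV ?s"
    by (intro smooth_on_inner smooth_on_diff smooth_on_ident smooth_on_const open_UNIV)
  have p: "smooth_on UNIV ?p"
    by (rule smooth_on_compose[OF open_UNIV _ _ smooth_on_exp_bump, where f = "\<lambda>x. 4 * r\<^sup>2 - ?s x"])
      (simp, intro smooth_on_diff smooth_on_const s open_UNIV)
  have q: "smooth_on UNIV ?q"
    by (rule smooth_on_compose[OF open_UNIV _ _ smooth_on_exp_bump, where f = "\<lambda>x. ?s x - r\<^sup>2"])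
      (simp, intro smooth_on_diff smooth_on_const s open_UNIV)
  have nn: "exp_bump 0 t \<ge> 0" and pos: "t > 0 \<Longrightarrow> exp_bump 0 t > 0" and zero: "t \<le> 0 \<Longrightarrow> exp_bump 0 t = 0" for t
    by (auto simp: exp_bump_def)
  have "?p x + ?q x > 0" for x
  proof (cases "4 * r\<^sup>2 - ?s x > 0")
    case True then show ?thesis using pos[OF True] nn[of "?s x - r\<^sup>2"] by linarith
  next
    case False
    then have "?s x - r\<^sup>2 > 0" using zero_less_power[OF r, of 2] by linarith
    then show ?thesis using pos nn[of "4 * r\<^sup>2 - ?s x"] by (meson add_nonneg_pos)
  qed
  then have ne: "?p x + ?q x \<noteq> 0" for x by (metis less_irrefl)
  have "smooth_on UNIV (\<lambda>x. ?p x * inverse (?p x + ?q x))"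
    by (intro smooth_on_mult smooth_on_inverse smooth_on_add p q open_UNIV ne)
  moreover have "?p x * inverse (?p x + ?q x) = 1" if "x \<in> ball x0 r" for x
  proof -
    have "norm (x - x0) \<le> r" using that by (simp add: dist_norm norm_minus_commute)
    then have "?s x \<le> r\<^sup>2" unfolding power2_norm_eq_inner[symmetric] by (intro power_mono) auto
    then have "?q x = 0" by (intro zero) simp
    then show ?thesis using ne[of x] by simp
  qed
  moreover have "?p x * inverse (?p x + ?q x) = 0" if "x \<notin> ball x0 (2 * r)" for x
  proof -
    have "2 * r \<le> norm (x - x0)" using that by (simp add: dist_norm norm_minus_commute)
    then have "(2 * r)\<^sup>2 \<le> ?s x" unfolding power2_norm_eq_inner[symmetric] using r by (intro power_mono) auto
    then have "?p x = 0" by (intro zero) (simp add: power_mult_distrib)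
    then show ?thesis by simp
  qed
  ultimately show ?thesis by (intro exI[of _ "\<lambda>x. ?p x * inverse (?p x + ?q x)"]) auto
qed

subsection \<open>Closed one-forms on simply connected spaces\<close>

text \<open>The one-form is represented by the vector field \<open>a\<close> through the inner
  product. Its primitive is the integral of the form along the segment from the centre
  \<open>x0\<close>, differentiated under the integral sign.\<close>

lemma poincare_lemma:
  fixes a :: "'a::euclidean_space \<Rightarrow> 'a"
  assumes a: "smooth_on (ball x0 r) a"
    and closed: "\<And>x u w. x \<in> ball x0 r \<Longrightarrow>
      frechet_derivative a (at x) u \<bullet> w = frechet_derivative a (at x) w \<bullet> u"
  shows "\<exists>f. \<forall>x\<in>ball x0 r. (f has_derivative (\<lambda>u. a x \<bullet> u)) (at x)"
proof -
  let ?B = "ball x0 r" and ?D = "\<lambda>x. frechet_derivative a (at x)"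
  let ?z = "\<lambda>x t. x0 + t *\<^sub>R (x - x0)"
  have zB: "?z x t \<in> ?B" if "x \<in> ?B" "t \<in> {0..1}" for x t
  proof -
    have "norm (t *\<^sub>R (x - x0)) \<le> 1 * norm (x - x0)"
      unfolding norm_scaleR using that by (intro mult_right_mono) auto
    also have "\<dots> < r" using that by (simp add: dist_norm norm_minus_commute)
    finally show ?thesis by (simp add: dist_norm)
  qed
  have da: "(a has_derivative ?D x) (at x)" if "x \<in> ?B" for x
    using smooth_on_has_derivative[OF a that] .
  have lin: "linear (?D x)" if "x \<in> ?B" for x
    using da[OF that] has_derivative_linear by blast
  \<comment> \<open>This expression has two roles: it is the derivative in \<open>t\<close> of
    \<open>t *\<^sub>R a (?z x t)\<close>, which integrates to \<open>a x\<close>, and by closedness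
    it is the gradient in \<open>x\<close> of the integrand of \<open>f\<close>.\<close>
  let ?\<phi> = "\<lambda>x t. t *\<^sub>R ?D (?z x t) (x - x0) + a (?z x t)"
  have cz: "continuous_on (?B \<times> {0..1}) (\<lambda>(x, t). ?z x t)"
    by (auto simp: split_beta intro!: continuous_intros)
  have ca: "continuous_on (?B \<times> {0..1}) (\<lambda>(x, t). a (?z x t))"
    using continuous_on_compose2[OF smooth_on_continuous_on[OF a] cz] zB by (force simp: split_beta)
  have cD: "continuous_on (?B \<times> {0..1}) (\<lambda>(x, t). ?D (?z x t) (x - x0))"
  proof (rule continuous_on_eq)
    have "continuous_on (?B \<times> {0..1}) (\<lambda>(x, t). ?D (?z x t) b)" for b
      using continuous_on_compose2[OF smooth_on_continuous_on[OF smooth_on_frechet[OF a]] cz] zB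
      by (force simp: split_beta)
    then show "continuous_on (?B \<times> {0..1}) (\<lambda>y. \<Sum>b\<in>Basis. ((fst y - x0) \<bullet> b) *\<^sub>R ?D (?z (fst y) (snd y)) b)"
      by (intro continuous_intros) (simp add: split_beta)
    show "(\<Sum>b\<in>Basis. ((fst y - x0) \<bullet> b) *\<^sub>R ?D (?z (fst y) (snd y)) b) =
        (case y of (x, t) \<Rightarrow> ?D (?z x t) (x - x0))" if "y \<in> ?B \<times> {0..1}" for y
      using linear_expand[OF lin[OF zB[of "fst y" "snd y"]], of "fst y - x0"] that by (auto simp: split_beta)
  qed
  have c\<phi>: "continuous_on (?B \<times> {0..1}) (\<lambda>(x, t). ?\<phi> x t)"
    using ca cD by (auto simp: split_beta intro!: continuous_intros)
  define f where "f x = integral (cbox 0 1) (\<lambda>t. a (?z x t) \<bullet> (x - x0))" for x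
  have der: "((\<lambda>x. a (?z x t) \<bullet> (x - x0)) has_derivative blinfun_apply (blinfun_inner_right (?\<phi> x t))) (at x within ?B)"
    if x: "x \<in> ?B" and t: "t \<in> cbox 0 1" for x t
  proof -
    have t': "t \<in> {0..1}" using t by simp
    have z': "((\<lambda>x. ?z x t) has_derivative (\<lambda>u. t *\<^sub>R u)) (at x)" by (auto intro!: derivative_eq_intros)
    have "((\<lambda>x. a (?z x t)) has_derivative (\<lambda>u. ?D (?z x t) (t *\<^sub>R u))) (at x)"
      by (rule has_derivative_compose[OF z' da[OF zB[OF x t']]])
    from has_derivative_inner[OF this has_derivative_diff[OF has_derivative_ident has_derivative_const]]
    have "((\<lambda>x. a (?z x t) \<bullet> (x - x0)) has_derivative
       (\<lambda>u. a (?z x t) \<bullet> (u - 0) + ?D (?z x t) (t *\<^sub>R u) \<bullet> (x - x0))) (at x)" .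
    \<comment> \<open>Closedness exchanges \<open>u\<close> and \<open>x - x0\<close> inside the
      derivative of \<open>a\<close>.\<close>
    moreover have "(\<lambda>u. a (?z x t) \<bullet> (u - 0) + ?D (?z x t) (t *\<^sub>R u) \<bullet> (x - x0)) =
        blinfun_apply (blinfun_inner_right (?\<phi> x t))"
      using closed[OF zB[OF x t']] linear_scale[OF lin[OF zB[OF x t']]]
      by (simp add: fun_eq_iff inner_add_left)
    ultimately show ?thesis by (simp add: has_derivative_at_withinI)
  qed
  have int\<phi>: "(?\<phi> x has_integral a x) (cbox 0 1)" if x: "x \<in> ?B" for x
  proof -
    have "((\<lambda>t. t *\<^sub>R a (?z x t)) has_vector_derivative ?\<phi> x t) (at t within {0..1})" if t: "t \<in> {0..1}" for t
    proof -
      have z': "((\<lambda>t. ?z x t) has_derivative (\<lambda>k. k *\<^sub>R (x - x0))) (at t)" by (auto intro!: derivative_eq_intros)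
      have "((\<lambda>t. a (?z x t)) has_derivative (\<lambda>k. ?D (?z x t) (k *\<^sub>R (x - x0)))) (at t)"
        by (rule has_derivative_compose[OF z' da[OF zB[OF x t]]])
      from has_derivative_scaleR[OF has_derivative_ident this]
      show ?thesis unfolding has_vector_derivative_def
        by (rule has_derivative_at_withinI[OF has_derivative_eq_rhs])
          (simp add: fun_eq_iff linear_scale[OF lin[OF zB[OF x t]]] scaleR_add_right mult.commute)
    qed
    from fundamental_theorem_of_calculus[OF _ this] show ?thesis by simp
  qed
  have "(f has_derivative (\<lambda>u. a x \<bullet> u)) (at x)" if x: "x \<in> ?B" for x
  proof -
    have "(f has_derivative blinfun_apply (integral (cbox 0 1) (\<lambda>t. blinfun_inner_right (?\<phi> x t)))) (at x within ?B)"
      unfolding f_def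
    proof (rule leibniz_rule[OF der])
      show "(\<lambda>t. a (?z x t) \<bullet> (x - x0)) integrable_on cbox 0 1" if "x \<in> ?B" for x
      proof (rule integrable_continuous)
        have "continuous_on (cbox 0 1) (\<lambda>t. a (?z x t))"
          by (rule continuous_on_compose2[OF smooth_on_continuous_on[OF a]])
            (use zB[OF that] in \<open>auto intro!: continuous_intros image_subsetI simp del: mem_ball\<close>)
        then show "continuous_on (cbox 0 1) (\<lambda>t. a (?z x t) \<bullet> (x - x0))" by (intro continuous_intros)
      qed
      show "continuous_on (?B \<times> cbox 0 1) (\<lambda>(x, t). blinfun_inner_right (?\<phi> x t))"
        using c\<phi> by (auto simp: split_beta intro!: continuous_intros)
    qed (use x in auto)
    moreover have "integral (cbox 0 1) (\<lambda>t. blinfun_inner_right (?\<phi> x t)) = blinfun_inner_right (a x)"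
      using has_integral_linear[OF int\<phi>[OF x] bounded_linear_blinfun_inner_right] by (simp add: o_def integral_unique)
    ultimately show ?thesis using at_within_open[OF x] by simp
  qed
  then show ?thesis by blast
qed

text \<open>
  A family of pairs \<open>(U, f)\<close> whose functions differ by locally constant functions on the overlaps
  plays the role of the local primitives of a closed one-form.
\<close>

locale local_primitives =
  fixes \<F> :: "('s::topological_space set \<times> ('s \<Rightarrow> real)) set"
  assumes open_dom: "(U, f) \<in> \<F> \<Longrightarrow> open U"
    and covering: "\<exists>U f. (U, f) \<in> \<F> \<and> p \<in> U"
    and compat: "(U, f) \<in> \<F> \<Longrightarrow> (V, g) \<in> \<F> \<Longrightarrow> p \<in> U \<Longrightarrow> p \<in> V \<Longrightarrow>
      \<forall>\<^sub>F q in nhds p. f q - f p = g q - g p"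
begin

text \<open>Continuation of the local primitives along a merely continuous map:
  \<open>\<Phi>\<close> has to vary near each point like a local primitive composed with
  \<open>H\<close>. The free domain type lets the notion serve both paths and squares of a
  homotopy.\<close>

definition primitive_along :: "('z::topological_space \<Rightarrow> 's) \<Rightarrow> 'z set \<Rightarrow> ('z \<Rightarrow> real) \<Rightarrow> bool" where
  "primitive_along H A \<Phi> \<longleftrightarrow> (\<forall>z\<in>A. \<forall>U f. (U, f) \<in> \<F> \<longrightarrow> H z \<in> U \<longrightarrow>
     (\<forall>\<^sub>F w in at z within A. \<Phi> w - \<Phi> z = f (H w) - f (H z)))"

text \<open>The filter \<open>at (k z)\<close> ignores the point \<open>k z\<close>, but
  \<open>k\<close> may return to this value arbitrarily close to \<open>z\<close>; the separate
  assumption \<open>P (k z)\<close> covers these returns.\<close>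

lemma eventually_pullback:
  assumes k: "continuous_on B k" "z \<in> B" "k ` B \<subseteq> A" and P: "\<forall>\<^sub>F w in at (k z) within A. P w" "P (k z)"
  shows "\<forall>\<^sub>F w in at z within B. P (k w)"
proof -
  from P(1) obtain W where W: "open W" "k z \<in> W" "\<forall>w\<in>W. w \<noteq> k z \<longrightarrow> w \<in> A \<longrightarrow> P w"
    unfolding eventually_at_topological by auto
  obtain V where V: "open V" "V \<inter> B = k -` W \<inter> B"
    using k(1)[unfolded continuous_on_open_invariant, rule_format, OF W(1)] by auto
  have zV: "z \<in> V" using W(2) k(2) V(2) by auto
  have "P (k w)" if w: "w \<in> V" "w \<in> B" for w
  proof (cases "k w = k z")
    case True then show ?thesis using P(2) by simp
  next
    case False
    have "k w \<in> W" using V(2) w by auto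
    moreover have "k w \<in> A" using k(3) w by auto
    ultimately show ?thesis using W(3) False by auto
  qed
  then show ?thesis
    unfolding eventually_at_topological using V(1) zV by auto
qed

text \<open>Two local primitives at the same point have the same increments near it by
  \<open>compat\<close>, so a single pair per point is enough.\<close>

lemma primitive_alongI:
  assumes H: "continuous_on A H"
    and "\<And>z. z \<in> A \<Longrightarrow> \<exists>U f. (U, f) \<in> \<F> \<and> H z \<in> U \<and> (\<forall>\<^sub>F w in at z within A. \<Phi> w - \<Phi> z = f (H w) - f (H z))"
  shows "primitive_along H A \<Phi>"
  unfolding primitive_along_def
proof (intro ballI allI impI)
  fix z V g assume z: "z \<in> A" and g: "(V, g) \<in> \<F>" "H z \<in> V"
  obtain U f where f: "(U, f) \<in> \<F>" "H z \<in> U" and ev: "\<forall>\<^sub>F w in at z within A. \<Phi> w - \<Phi> z = f (H w) - f (H z)"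
    using assms(2)[OF z] by blast
  have "\<forall>\<^sub>F q in at (H z) within UNIV. f q - f (H z) = g q - g (H z)"
    using compat[OF f(1) g(1) f(2) g(2)] eventually_nhds_conv_at by blast
  from eventually_pullback[OF H z _ this]
  have "\<forall>\<^sub>F w in at z within A. f (H w) - f (H z) = g (H w) - g (H z)" by simp
  with ev show "\<forall>\<^sub>F w in at z within A. \<Phi> w - \<Phi> z = g (H w) - g (H z)" by eventually_elim simp
qed

lemma primitive_along_local:
  assumes H: "continuous_on A H" and f: "(U, f) \<in> \<F>" and "H ` A \<subseteq> U"
  shows "primitive_along H A (\<lambda>z. f (H z))"
proof (rule primitive_alongI[OF H])
  fix z assume "z \<in> A"
  then have "H z \<in> U" using assms(3) by auto
  with f show "\<exists>V g. (V, g) \<in> \<F> \<and> H z \<in> V \<and> (\<forall>\<^sub>F w in at z within A. f (H w) - f (H z) = g (H w) - g (H z))"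
    by (intro exI[of _ U] exI[of _ f]) simp
qed

lemma primitive_along_subset: "primitive_along H A \<Phi> \<Longrightarrow> B \<subseteq> A \<Longrightarrow> primitive_along H B \<Phi>"
  unfolding primitive_along_def
proof (intro ballI allI impI)
  fix z U f
  assume P: "\<forall>z\<in>A. \<forall>U f. (U, f) \<in> \<F> \<longrightarrow> H z \<in> U \<longrightarrow> (\<forall>\<^sub>F w in at z within A. \<Phi> w - \<Phi> z = f (H w) - f (H z))"
    and B: "B \<subseteq> A" "z \<in> B" and f: "(U, f) \<in> \<F>" "H z \<in> U"
  have "\<forall>\<^sub>F w in at z within A. \<Phi> w - \<Phi> z = f (H w) - f (H z)" using P B f by auto
  then show "\<forall>\<^sub>F w in at z within B. \<Phi> w - \<Phi> z = f (H w) - f (H z)"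
    by (rule filter_leD[OF at_le[OF B(1)]])
qed

lemma primitive_along_compose:
  assumes P: "primitive_along H A \<Phi>" and k: "continuous_on B k" "k ` B \<subseteq> A"
  shows "primitive_along (\<lambda>z. H (k z)) B (\<lambda>z. \<Phi> (k z))"
  unfolding primitive_along_def
proof (intro ballI allI impI)
  fix z U f assume z: "z \<in> B" and f: "(U, f) \<in> \<F>" "H (k z) \<in> U"
  have "\<forall>\<^sub>F w in at (k z) within A. \<Phi> w - \<Phi> (k z) = f (H w) - f (H (k z))"
    using P f z k unfolding primitive_along_def by (auto simp: image_subset_iff)
  from eventually_pullback[OF k(1) z k(2) this]
  show "\<forall>\<^sub>F w in at z within B. \<Phi> (k w) - \<Phi> (k z) = f (H (k w)) - f (H (k z))" by simp
qed

lemma primitive_along_cong: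
  assumes "primitive_along H A \<Phi>" "\<And>z. z \<in> A \<Longrightarrow> H z = H' z"
  shows "primitive_along H' A \<Phi>"
  unfolding primitive_along_def
proof (intro ballI allI impI)
  fix z U f
  assume z: "z \<in> A" and f: "(U, f) \<in> \<F>" "H' z \<in> U"
  have "\<forall>\<^sub>F w in at z within A. \<Phi> w - \<Phi> z = f (H w) - f (H z)"
    using assms(1) assms(2)[OF z] z f unfolding primitive_along_def by auto
  moreover have "\<forall>\<^sub>F w in at z within A. w \<in> A" by (simp add: eventually_at_filter)
  ultimately show "\<forall>\<^sub>F w in at z within A. \<Phi> w - \<Phi> z = f (H' w) - f (H' z)"
    by eventually_elim (use assms(2) z in simp)
qed

lemma primitive_along_shift: "primitive_along H A \<Phi> \<Longrightarrow> primitive_along H A (\<lambda>z. \<Phi> z + c)"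
  unfolding primitive_along_def by simp

text \<open>Both functions vary locally like the same \<open>f\<close> composed with
  \<open>H\<close>, so their difference is locally constant on a connected set.\<close>

lemma primitive_along_unique:
  assumes P: "primitive_along H A \<Phi>" "primitive_along H A \<Psi>" and A: "connected A" "x \<in> A" "y \<in> A"
  shows "\<Phi> x - \<Psi> x = \<Phi> y - \<Psi> y"
proof (rule connected_local_const[OF A], intro ballI)
  fix z assume z: "z \<in> A"
  obtain U f where f: "(U, f) \<in> \<F>" "H z \<in> U" using covering by blast
  have "\<forall>\<^sub>F w in at z within A. \<Phi> w - \<Phi> z = f (H w) - f (H z)"
    "\<forall>\<^sub>F w in at z within A. \<Psi> w - \<Psi> z = f (H w) - f (H z)"
    using P z f unfolding primitive_along_def by blast+
  then show "\<forall>\<^sub>F w in at z within A. \<Phi> z - \<Psi> z = \<Phi> w - \<Psi> w" by eventually_elim linarith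
qed

text \<open>After a shift the two functions agree at \<open>x\<close>, and by connectedness on all
  of \<open>A \<inter> B\<close>. Closedness ensures that near a point outside one of the sets only
  the other set matters.\<close>

lemma primitive_along_glue:
  assumes P: "primitive_along H A \<Phi>" "primitive_along H B \<Psi>" and cl: "closed A" "closed B"
    and AB: "connected (A \<inter> B)" "x \<in> A \<inter> B"
  shows "\<exists>\<Theta>. primitive_along H (A \<union> B) \<Theta>"
proof -
  define \<Psi>' where "\<Psi>' z = \<Psi> z + (\<Phi> x - \<Psi> x)" for z
  have P': "primitive_along H B \<Psi>'" unfolding \<Psi>'_def by (rule primitive_along_shift[OF P(2)])
  have eq: "\<Phi> z = \<Psi>' z" if "z \<in> A \<inter> B" for z
    using primitive_along_unique[OF primitive_along_subset[OF P(1)] primitive_along_subset[OF P'] AB(1) that AB(2)]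
    by (simp add: \<Psi>'_def)
  let ?\<Theta> = "\<lambda>z. if z \<in> A then \<Phi> z else \<Psi>' z"
  have main: "\<forall>\<^sub>F w in at z within A \<union> B. ?\<Theta> w - ?\<Theta> z = f (H w) - f (H z)"
    if z: "z \<in> A \<union> B" and f: "(U, f) \<in> \<F>" "H z \<in> U" for z U f
  proof -
    have 1: "\<forall>\<^sub>F w in at z within A. ?\<Theta> w - ?\<Theta> z = f (H w) - f (H z)"
    proof (cases "z \<in> A")
      case True
      then have "\<forall>\<^sub>F w in at z within A. \<Phi> w - \<Phi> z = f (H w) - f (H z)"
        using P(1) f unfolding primitive_along_def by blast
      moreover have "\<forall>\<^sub>F w in at z within A. w \<in> A" by (simp add: eventually_at_filter)
      ultimately show ?thesis by eventually_elim (use True in simp)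
    next
      case False
      then have "\<forall>\<^sub>F w in nhds z. w \<in> - A" using cl by (intro eventually_nhds_in_open) auto
      then show ?thesis unfolding eventually_at_filter by eventually_elim simp
    qed
    have 2: "\<forall>\<^sub>F w in at z within B. ?\<Theta> w - ?\<Theta> z = f (H w) - f (H z)"
    proof (cases "z \<in> B")
      case True
      then have "\<forall>\<^sub>F w in at z within B. \<Psi>' w - \<Psi>' z = f (H w) - f (H z)"
        using P' f unfolding primitive_along_def by blast
      moreover have "\<forall>\<^sub>F w in at z within B. w \<in> B" by (simp add: eventually_at_filter)
      ultimately show ?thesis by eventually_elim (use True eq in auto)
    next
      case False
      then have "\<forall>\<^sub>F w in nhds z. w \<in> - B" using cl by (intro eventually_nhds_in_open) auto
      then show ?thesis unfolding eventually_at_filter by eventually_elim simp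
    qed
    show ?thesis unfolding at_within_union eventually_sup using 1 2 by blast
  qed
  have "primitive_along H (A \<union> B) ?\<Theta>"
    unfolding primitive_along_def by (intro ballI allI impI, rule main)
  then show ?thesis by (intro exI[of _ ?\<Theta>])
qed

text \<open>Bisection one coordinate at a time takes the place of a subdivision into small squares:
  first along a vertical line, giving a thin strip, then across the strips. The pieces to be glued
  meet in a segment or thin rectangle with one degenerate side, which is connected.\<close>

lemma primitive_along_square:
  fixes H :: "real \<times> real \<Rightarrow> 's"
  assumes H: "continuous_on UNIV H"
  shows "\<exists>\<Phi>. primitive_along H ({0..1} \<times> {0..1}) \<Phi>"
proof -
  have strip: "\<exists>\<epsilon>>0. \<exists>\<Phi>. primitive_along H ({x - \<epsilon>..x + \<epsilon>} \<times> {0..1}) \<Phi>" for x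
  proof (rule Bolzano[of 0 1 "\<lambda>c d. \<exists>\<epsilon>>0. \<exists>\<Phi>. primitive_along H ({x - \<epsilon>..x + \<epsilon>} \<times> {c..d}) \<Phi>"])
    show "0 \<le> (1::real)" by simp
  next
    fix a b c :: real
    assume ab: "a \<le> b" "b \<le> c" and "\<exists>\<epsilon>>0. \<exists>\<Phi>. primitive_along H ({x - \<epsilon>..x + \<epsilon>} \<times> {a..b}) \<Phi>"
      "\<exists>\<epsilon>>0. \<exists>\<Phi>. primitive_along H ({x - \<epsilon>..x + \<epsilon>} \<times> {b..c}) \<Phi>"
    then obtain \<epsilon>1 \<Phi> \<epsilon>2 \<Psi> where *: "\<epsilon>1 > 0" "primitive_along H ({x - \<epsilon>1..x + \<epsilon>1} \<times> {a..b}) \<Phi>"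
      "\<epsilon>2 > 0" "primitive_along H ({x - \<epsilon>2..x + \<epsilon>2} \<times> {b..c}) \<Psi>" by blast
    \<comment> \<open>The two pieces may come with strips of different widths; gluing takes place
      over the narrower one.\<close>
    let ?\<epsilon> = "min \<epsilon>1 \<epsilon>2"
    let ?A = "{x - ?\<epsilon>..x + ?\<epsilon>} \<times> {a..b}" and ?B = "{x - ?\<epsilon>..x + ?\<epsilon>} \<times> {b..c}"
    have "?A \<inter> ?B = {x - ?\<epsilon>..x + ?\<epsilon>} \<times> {b}" using ab by auto
    moreover have "connected ({x - ?\<epsilon>..x + ?\<epsilon>} \<times> {b})" by (intro connected_Times) auto
    moreover have "?A \<union> ?B = {x - ?\<epsilon>..x + ?\<epsilon>} \<times> {a..c}" using ab by auto
    moreover have "\<exists>\<Theta>. primitive_along H (?A \<union> ?B) \<Theta>"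
    proof (rule primitive_along_glue)
      show "primitive_along H ?A \<Phi>" by (rule primitive_along_subset[OF *(2)]) auto
      show "primitive_along H ?B \<Psi>" by (rule primitive_along_subset[OF *(4)]) auto
      show "(x, b) \<in> ?A \<inter> ?B" using ab *(1,3) by auto
    qed (use calculation in \<open>auto intro!: closed_Times\<close>)
    ultimately show "\<exists>\<epsilon>>0. \<exists>\<Phi>. primitive_along H ({x - \<epsilon>..x + \<epsilon>} \<times> {a..c}) \<Phi>" using *(1,3) by (intro exI[of _ ?\<epsilon>]) auto
  next
    fix y :: real
    obtain U f where f: "(U, f) \<in> \<F>" "H (x, y) \<in> U" using covering by blast
    have "open (H -` U)" using H open_dom[OF f(1)] by (simp add: continuous_on_open_vimage)
    moreover have "(x, y) \<in> H -` U" using f(2) by simp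
    ultimately obtain d where d: "d > 0" "ball (x, y) d \<subseteq> H -` U" by (rule openE)
    \<comment> \<open>Both coordinate distances from \<open>(x, y)\<close> are at most
      \<open>d/3\<close>, so their sum stays below \<open>d\<close> and the rectangle lies in the
      ball.\<close>
    have "primitive_along H ({x - d/3..x + d/3} \<times> {a..b}) (\<lambda>z. f (H z))"
      if ab: "a \<le> y" "y \<le> b" "b - a < d/3" for a b
    proof (rule primitive_along_local[OF continuous_on_subset[OF H] f(1)])
      have "dist (x, y) (s, t) < d" if "s \<in> {x - d/3..x + d/3}" "t \<in> {a..b}" for s t
      proof -
        have "dist (x, y) (s, t) \<le> dist x s + dist y t"
          unfolding dist_Pair_Pair using sqrt_sum_squares_le_sum[of "dist x s" "dist y t"] by simp
        also have "\<dots> < d" using that ab d(1) by (auto simp: dist_real_def)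
        finally show ?thesis .
      qed
      then show "H ` ({x - d/3..x + d/3} \<times> {a..b}) \<subseteq> U" using d(2) by (auto simp: subset_iff)
    qed auto
    then show "\<exists>d>0. \<forall>a b. a \<le> y \<and> y \<le> b \<and> b - a < d \<longrightarrow>
        (\<exists>\<epsilon>>0. \<exists>\<Phi>. primitive_along H ({x - \<epsilon>..x + \<epsilon>} \<times> {a..b}) \<Phi>)" using d(1) by (intro exI[of _ "d/3"]) (auto intro!: exI[of _ "d/3"])
  qed
  show ?thesis
  proof (rule Bolzano[of 0 1 "\<lambda>c d. \<exists>\<Phi>. primitive_along H ({c..d} \<times> {0..1}) \<Phi>"])
    show "0 \<le> (1::real)" by simp
  next
    fix a b c :: real
    assume ab: "a \<le> b" "b \<le> c" and "\<exists>\<Phi>. primitive_along H ({a..b} \<times> {0..1}) \<Phi>"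
      "\<exists>\<Phi>. primitive_along H ({b..c} \<times> {0..1}) \<Phi>"
    then obtain \<Phi> \<Psi> where *: "primitive_along H ({a..b} \<times> {0..1}) \<Phi>" "primitive_along H ({b..c} \<times> {0..1}) \<Psi>" by blast
    have 1: "({a..b} \<times> {0..1}) \<inter> ({b..c} \<times> {0..1}) = {b} \<times> {0..1::real}" using ab by auto
    have "connected ({b} \<times> {0..1::real})" by (intro connected_Times) auto
    then have "\<exists>\<Theta>. primitive_along H (({a..b} \<times> {0..1}) \<union> ({b..c} \<times> {0..1})) \<Theta>"
      by (intro primitive_along_glue[OF *, where x = "(b, 0)"]) (use ab in \<open>auto simp: 1 intro!: closed_Times\<close>)
    moreover have "({a..b} \<times> {0..1}) \<union> ({b..c} \<times> {0..1}) = {a..c} \<times> {0..1::real}" using ab by auto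
    ultimately show "\<exists>\<Phi>. primitive_along H ({a..c} \<times> {0..1}) \<Phi>" by simp
  next
    fix x :: real
    obtain \<epsilon> \<Phi> where \<epsilon>: "\<epsilon> > 0" "primitive_along H ({x - \<epsilon>..x + \<epsilon>} \<times> {0..1}) \<Phi>" using strip by blast
    have "primitive_along H ({a..b} \<times> {0..1}) \<Phi>" if "a \<le> x" "x \<le> b" "b - a < \<epsilon>" for a b
      by (rule primitive_along_subset[OF \<epsilon>(2)]) (use that in auto)
    then show "\<exists>d>0. \<forall>a b. a \<le> x \<and> x \<le> b \<and> b - a < d \<longrightarrow>
        (\<exists>\<Phi>. primitive_along H ({a..b} \<times> {0..1}) \<Phi>)" using \<epsilon>(1) by blast
  qed
qed

lemma primitive_along_path:
  assumes "continuous_on {0..1} \<gamma>"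
  shows "\<exists>\<Phi>. primitive_along \<gamma> {0..1::real} \<Phi>"
proof -
  \<comment> \<open>Clamping the parameter to the unit interval makes the path continuous on the
    whole line, and the second coordinate of the square is a dummy.\<close>
  let ?k = "\<lambda>s. max 0 (min 1 s) :: real"
  have "continuous_on UNIV (\<lambda>z::real \<times> real. \<gamma> (?k (fst z)))"
    by (rule continuous_on_compose2[OF assms]) (auto intro!: continuous_intros)
  from primitive_along_square[OF this]
  obtain \<Phi> where "primitive_along (\<lambda>z::real \<times> real. \<gamma> (?k (fst z))) ({0..1} \<times> {0..1}) \<Phi>" ..
  then have "primitive_along (\<lambda>s. \<gamma> (?k (fst (s, 0::real)))) {0..1} (\<lambda>s. \<Phi> (s, 0))"
    by (rule primitive_along_compose) (auto intro!: continuous_intros)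
  then have "primitive_along \<gamma> {0..1} (\<lambda>s. \<Phi> (s, 0))"
    by (rule primitive_along_cong) auto
  then show ?thesis by (rule exI[of _ "\<lambda>s. \<Phi> (s, 0)"])
qed

section \<open>Increments along paths and their homotopy invariance\<close>

definition increment :: "(real \<Rightarrow> 's) \<Rightarrow> real" where
  "increment \<gamma> = (let \<Phi> = (SOME \<Phi>. primitive_along \<gamma> {0..1} \<Phi>) in \<Phi> 1 - \<Phi> 0)"

text \<open>Uniqueness on the connected interval makes the choice in \<open>increment\<close>
  irrelevant. The increment is the substitute for the line integral of the closed form along a
  continuous path.\<close>

lemma incrementI: "primitive_along \<gamma> {0..1} \<Phi> \<Longrightarrow> increment \<gamma> = \<Phi> 1 - \<Phi> 0"
  using primitive_along_unique[of \<gamma> "{0..1}" "SOME \<Phi>. primitive_along \<gamma> {0..1} \<Phi>" \<Phi> 1 0]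
    someI[of "primitive_along \<gamma> {0..1}" \<Phi>]
  by (simp add: increment_def Let_def)

lemma increment_reversepath: "path \<gamma> \<Longrightarrow> increment (reversepath \<gamma>) = - increment \<gamma>"
proof -
  assume "path \<gamma>"
  from primitive_along_path[OF this[unfolded path_def]]
  obtain \<Phi> where \<Phi>: "primitive_along \<gamma> {0..1} \<Phi>" ..
  have "primitive_along (\<lambda>t. \<gamma> (1 - t)) {0..1} (\<lambda>t. \<Phi> (1 - t))"
    by (rule primitive_along_compose[OF \<Phi>]) (auto intro!: continuous_intros)
  from incrementI[OF this] show ?thesis using incrementI[OF \<Phi>] by (simp add: reversepath_def)
qed

text \<open>One primitive along the joined path, restricted to either half, serves both pieces, and
  the increments telescope.\<close>

lemma increment_joinpaths:
  assumes "path \<gamma>" "path \<delta>" "pathfinish \<gamma> = pathstart \<delta>"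
  shows "increment (\<gamma> +++ \<delta>) = increment \<gamma> + increment \<delta>"
proof -
  have "path (\<gamma> +++ \<delta>)" using assms by simp
  from primitive_along_path[OF this[unfolded path_def]]
  obtain \<Phi> where \<Phi>: "primitive_along (\<gamma> +++ \<delta>) {0..1} \<Phi>" ..
  have "primitive_along (\<lambda>t. (\<gamma> +++ \<delta>) (t / 2)) {0..1} (\<lambda>t. \<Phi> (t / 2))"
    by (rule primitive_along_compose[OF \<Phi>]) (auto intro!: continuous_intros)
  then have 1: "primitive_along \<gamma> {0..1} (\<lambda>t. \<Phi> (t / 2))"
    by (rule primitive_along_cong) (auto simp: joinpaths_def)
  have "primitive_along (\<lambda>t. (\<gamma> +++ \<delta>) (t / 2 + 1 / 2)) {0..1} (\<lambda>t. \<Phi> (t / 2 + 1 / 2))"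
    by (rule primitive_along_compose[OF \<Phi>]) (auto intro!: continuous_intros)
  then have 2: "primitive_along \<delta> {0..1} (\<lambda>t. \<Phi> (t / 2 + 1 / 2))"
    by (rule primitive_along_cong)
      (use assms(3) in \<open>auto simp: joinpaths_def pathfinish_def pathstart_def\<close>)
  show ?thesis using incrementI[OF 1] incrementI[OF 2] incrementI[OF \<Phi>] by simp
qed

text \<open>On the square of the homotopy the two loops are opposite edges. The other two edges
  trace one and the same curve, because every intermediate path is closed, so the primitive changes
  equally along them.\<close>

lemma increment_homotopic_loops:
  assumes "homotopic_loops UNIV p q"
  shows "increment p = increment q"
proof -
  obtain h where h: "continuous_on ({0..1} \<times> {0..1}) h" "\<forall>x\<in>{0..1}. h (0, x) = p x" "\<forall>x\<in>{0..1}. h (1, x) = q x"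
    "\<forall>t\<in>{0..1::real}. pathfinish (h \<circ> Pair t) = pathstart (h \<circ> Pair t)"
    using assms unfolding homotopic_loops by blast
  let ?k = "\<lambda>s. max 0 (min 1 s) :: real"
  let ?H = "\<lambda>z. h (?k (fst z), ?k (snd z))"
  have "continuous_on UNIV ?H"
    by (rule continuous_on_compose2[OF h(1)]) (auto intro!: continuous_intros)
  from primitive_along_square[OF this]
  obtain \<Phi> where \<Phi>: "primitive_along ?H ({0..1} \<times> {0..1}) \<Phi>" ..
  have "primitive_along (\<lambda>t. ?H (s, t)) {0..1} (\<lambda>t. \<Phi> (s, t))" if "s \<in> {0..1}" for s
    by (rule primitive_along_compose[OF \<Phi>]) (use that in \<open>auto intro!: continuous_intros\<close>)
  from primitive_along_cong[OF this[of 0], of p] primitive_along_cong[OF this[of 1], of q]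
  have pq: "primitive_along p {0..1} (\<lambda>t. \<Phi> (0, t))" "primitive_along q {0..1} (\<lambda>t. \<Phi> (1, t))"
    using h(2,3) by auto
  have v: "primitive_along (\<lambda>s. ?H (s, t)) {0..1} (\<lambda>s. \<Phi> (s, t))" if "t \<in> {0..1}" for t
    by (rule primitive_along_compose[OF \<Phi>]) (use that in \<open>auto intro!: continuous_intros\<close>)
  \<comment> \<open>A primitive along the edge \<open>t = 0\<close> is also one along the edge
    \<open>t = 1\<close>; uniqueness then compares the two edges.\<close>
  have "primitive_along (\<lambda>s. ?H (s, 1)) {0..1} (\<lambda>s. \<Phi> (s, 0))"
    by (rule primitive_along_cong[OF v[of 0]]) (use h(4) in \<open>auto simp: pathfinish_def pathstart_def\<close>)
  from primitive_along_unique[OF v[of 1] this, of 0 1]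
  show ?thesis using incrementI[OF pq(1)] incrementI[OF pq(2)] by simp
qed

text \<open>The primitive at \<open>q\<close> is the increment along a chosen path from a base point
  to \<open>q\<close>. Loops have increment 0, so the choice has no effect, and nearby points are
  compared along a path that stays inside one \<open>U\<close>, where the increment is a difference
  of values of \<open>f\<close>.\<close>

lemma global_primitive_exists:
  assumes sc: "simply_connected (UNIV :: 's set)"
    and lpc: "\<And>U f p. (U, f) \<in> \<F> \<Longrightarrow> p \<in> U \<Longrightarrow> \<exists>V. open V \<and> p \<in> V \<and> V \<subseteq> U \<and> path_connected V"
  shows "\<exists>F. \<forall>U f p. (U, f) \<in> \<F> \<longrightarrow> p \<in> U \<longrightarrow> (\<forall>\<^sub>F q in nhds p. F q - F p = f q - f p)"
proof -
  \<comment> \<open>Any base point will do; \<open>undefined\<close> names one.\<close>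
  define p0 :: 's where "p0 = undefined"
  have hom: "homotopic_loops UNIV p q"
    if "path p" "pathfinish p = pathstart p" "path q" "pathfinish q = pathstart q" for p q :: "real \<Rightarrow> 's"
    using sc that unfolding simply_connected_def by blast
  have const: "path (\<lambda>t::real. c)" for c :: 's by (simp add: path_def)
  have loop: "increment p = 0" if p: "path p" "pathfinish p = pathstart p" for p
  proof -
    obtain U f where f: "(U, f) \<in> \<F>" "p0 \<in> U" using covering by blast
    have "primitive_along (\<lambda>t::real. p0) {0..1} (\<lambda>t. f p0)"
      by (rule primitive_along_local[OF _ f(1)]) (use f in auto)
    from incrementI[OF this] show ?thesis
      using increment_homotopic_loops[OF hom[OF p const[of p0]]] by (simp add: pathfinish_def pathstart_def)
  qed
  have ex: "\<exists>\<gamma>. path \<gamma> \<and> pathstart \<gamma> = p0 \<and> pathfinish \<gamma> = q" for q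
  proof -
    \<comment> \<open>\<open>simply_connected\<close> says that any two loops are freely homotopic.
      For constant loops the homotopy itself contains a path between the two points.\<close>
    have "homotopic_loops UNIV (\<lambda>t. p0) (\<lambda>t. q)"
      by (rule hom) (auto simp: const pathfinish_def pathstart_def)
    then obtain h where h: "continuous_on ({0..1::real} \<times> {0..1::real}) h"
      "\<forall>x\<in>{0..1}. h (0, x) = p0" "\<forall>x\<in>{0..1}. h (1, x) = q"
      unfolding homotopic_loops by blast
    have "path (\<lambda>s. h (s, 0))"
      unfolding path_def by (rule continuous_on_compose2[OF h(1)]) (auto intro!: continuous_intros)
    then show ?thesis using h(2,3) by (intro exI[of _ "\<lambda>s. h (s, 0)"]) (auto simp: pathstart_def pathfinish_def)
  qed
  define \<gamma> where "\<gamma> q = (SOME \<gamma>. path \<gamma> \<and> pathstart \<gamma> = p0 \<and> pathfinish \<gamma> = q)" for q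
  have \<gamma>: "path (\<gamma> q)" "pathstart (\<gamma> q) = p0" "pathfinish (\<gamma> q) = q" for q
    using someI_ex[OF ex[of q]] unfolding \<gamma>_def by blast+
  define F where "F q = increment (\<gamma> q)" for q
  have "\<forall>\<^sub>F q in nhds p. F q - F p = f q - f p" if f: "(U, f) \<in> \<F>" "p \<in> U" for U f p
  proof -
    obtain V where V: "open V" "p \<in> V" "V \<subseteq> U" "path_connected V" using lpc[OF f] by blast
    have "F q - F p = f q - f p" if q: "q \<in> V" for q
    proof -
      obtain \<sigma> where \<sigma>: "path \<sigma>" "path_image \<sigma> \<subseteq> V" "pathstart \<sigma> = p" "pathfinish \<sigma> = q"
        using V(4) V(2) q unfolding path_connected_def by blast
      have "primitive_along \<sigma> {0..1} (\<lambda>t. f (\<sigma> t))"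
        by (rule primitive_along_local[OF _ f(1)]) (use \<sigma>(1,2) V(3) in \<open>auto simp: path_def path_image_def\<close>)
      from incrementI[OF this] have i\<sigma>: "increment \<sigma> = f q - f p"
        using \<sigma>(3,4) by (simp add: pathstart_def pathfinish_def)
      \<comment> \<open>The loop goes from the base point to \<open>p\<close>, across to
        \<open>q\<close> inside \<open>V\<close>, and back along the chosen path of
        \<open>q\<close>.\<close>
      have "increment (\<gamma> p +++ (\<sigma> +++ reversepath (\<gamma> q))) = 0"
        by (rule loop) (use \<gamma> \<sigma> in auto)
      moreover have "increment (\<gamma> p +++ (\<sigma> +++ reversepath (\<gamma> q))) = F p + (f q - f p) - F q"
        using \<gamma> \<sigma> by (simp add: increment_joinpaths increment_reversepath i\<sigma> F_def)
      ultimately show ?thesis by simp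
    qed
    then show ?thesis using V(1,2) by (auto simp: eventually_nhds)
  qed
  then show ?thesis by blast
qed

end

subsection \<open>Calculus on manifolds\<close>

definition smooth_in ::
    "('a::topological_space, 'e::euclidean_space) chart set \<Rightarrow> 'a set \<Rightarrow> ('a \<Rightarrow> 'b::real_normed_vector) \<Rightarrow> bool" where
  "smooth_in A U F \<longleftrightarrow> (\<forall>c\<in>A. smooth_on (coord c ` (dom_chart c \<inter> U)) (\<lambda>x. F (chart_inv c x)))"

locale smooth_manifold =
  fixes A :: "('a::{t2_space, second_countable_topology}, 'e::euclidean_space) chart set"
  assumes atlas: "smooth_atlas A"
begin

lemma chart_homeomorphism:
  assumes "c \<in> A"
  shows "open (dom_chart c)" "open (coord c ` dom_chart c)" "continuous_on (dom_chart c) (coord c)"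
    "continuous_on (coord c ` dom_chart c) (chart_inv c)"
    "p \<in> dom_chart c \<Longrightarrow> chart_inv c (coord c p) = p"
    "x \<in> coord c ` dom_chart c \<Longrightarrow> chart_inv c x \<in> dom_chart c"
    "x \<in> coord c ` dom_chart c \<Longrightarrow> coord c (chart_inv c x) = x"
  using atlas assms unfolding smooth_atlas_def is_chart_def homeomorphism_def
  by (auto simp: inv_into_into f_inv_into_f)

lemma transition_smooth:
  "c \<in> A \<Longrightarrow> d \<in> A \<Longrightarrow> smooth_on (coord c ` (dom_chart c \<inter> dom_chart d)) (\<lambda>x. coord d (chart_inv c x))"
  using atlas by (simp add: smooth_atlas_def o_def)

lemma chart_at: "chart_at A p \<in> A" "p \<in> dom_chart (chart_at A p)"
proof -
  have "\<exists>c. c \<in> A \<and> p \<in> dom_chart c" using atlas unfolding smooth_atlas_def by blast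
  then have "chart_at A p \<in> A \<and> p \<in> dom_chart (chart_at A p)" unfolding chart_at_def by (rule someI_ex)
  then show "chart_at A p \<in> A" "p \<in> dom_chart (chart_at A p)" by auto
qed

lemma open_coord_image:
  assumes "c \<in> A" "open U"
  shows "open (coord c ` (dom_chart c \<inter> U))"
proof -
  have "coord c ` (dom_chart c \<inter> U) = coord c ` dom_chart c \<inter> chart_inv c -` U"
    using chart_homeomorphism[OF assms(1)] by (auto intro!: rev_image_eqI)
  then show ?thesis
    using continuous_open_preimage[OF chart_homeomorphism(4,2)[OF assms(1)] assms(2)] by simp
qed

lemma in_coord_imageD:
  assumes "c \<in> A" "x \<in> coord c ` (dom_chart c \<inter> U)"
  shows "chart_inv c x \<in> dom_chart c" "chart_inv c x \<in> U" "coord c (chart_inv c x) = x"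
  using assms chart_homeomorphism(5)[OF assms(1)] by auto

lemma smooth_inD: "smooth_in A U F \<Longrightarrow> c \<in> A \<Longrightarrow> smooth_on (coord c ` (dom_chart c \<inter> U)) (\<lambda>x. F (chart_inv c x))"
  by (simp add: smooth_in_def)

lemma smooth_in_subset: "smooth_in A U F \<Longrightarrow> V \<subseteq> U \<Longrightarrow> smooth_in A V F"
  unfolding smooth_in_def by (meson Int_mono image_mono order_refl smooth_on_subset)

lemma smooth_in_cong:
  assumes "smooth_in A U F" "open U" "\<And>q. q \<in> U \<Longrightarrow> F q = G q"
  shows "smooth_in A U G"
  unfolding smooth_in_def
proof
  fix c assume c: "c \<in> A"
  show "smooth_on (coord c ` (dom_chart c \<inter> U)) (\<lambda>x. G (chart_inv c x))"
    by (rule smooth_on_cong[OF smooth_inD[OF assms(1) c] open_coord_image[OF c assms(2)]])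
      (use assms(3) in_coord_imageD[OF c] in auto)
qed

lemma smooth_in_local:
  assumes "\<And>p. p \<in> U \<Longrightarrow> \<exists>V. open V \<and> p \<in> V \<and> smooth_in A V F"
  shows "smooth_in A U F"
  unfolding smooth_in_def
proof
  fix c assume c: "c \<in> A"
  show "smooth_on (coord c ` (dom_chart c \<inter> U)) (\<lambda>x. F (chart_inv c x))"
  proof (rule smooth_on_local)
    fix x assume "x \<in> coord c ` (dom_chart c \<inter> U)"
    then obtain p where p: "p \<in> dom_chart c" "p \<in> U" "x = coord c p" by auto
    obtain V where V: "open V" "p \<in> V" "smooth_in A V F" using assms[OF p(2)] by auto
    show "\<exists>W. open W \<and> x \<in> W \<and> smooth_on W (\<lambda>x. F (chart_inv c x))"
      by (rule exI[of _ "coord c ` (dom_chart c \<inter> V)"])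
        (use p V open_coord_image[OF c V(1)] smooth_inD[OF V(3) c] in auto)
  qed
qed

lemma smooth_in_compose:
  fixes F :: "'a \<Rightarrow> 'b::euclidean_space"
  assumes U: "open U" and "smooth_in A U F" "F ` U \<subseteq> V" "smooth_on V G"
  shows "smooth_in A U (\<lambda>q. G (F q))"
  unfolding smooth_in_def
proof
  fix c assume c: "c \<in> A"
  show "smooth_on (coord c ` (dom_chart c \<inter> U)) (\<lambda>x. G (F (chart_inv c x)))"
    by (rule smooth_on_compose[OF open_coord_image[OF c U] _ smooth_inD[OF assms(2) c] assms(4)])
      (use assms(3) in_coord_imageD[OF c] in auto)
qed

lemma smooth_in_coord: "d \<in> A \<Longrightarrow> smooth_in A (dom_chart d) (coord d)"
  unfolding smooth_in_def using transition_smooth by blast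

text \<open>One chart suffices: on \<open>U\<close> the function is its coordinate expression
  composed with the smooth map \<open>coord d\<close>.\<close>

lemma smooth_in_chartI:
  assumes d: "d \<in> A" and U: "open U" "U \<subseteq> dom_chart d" and F: "smooth_on (coord d ` U) (\<lambda>x. F (chart_inv d x))"
  shows "smooth_in A U F"
proof (rule smooth_in_cong[OF smooth_in_compose[OF U(1) smooth_in_subset[OF smooth_in_coord[OF d] U(2)] order_refl F] U(1)])
  show "F (chart_inv d (coord d q)) = F q" if "q \<in> U" for q
    using chart_homeomorphism(5)[OF d, of q] U(2) that by auto
qed

lemma smooth_in_const: "smooth_in A U (\<lambda>q. k)"
  by (simp add: smooth_in_def smooth_on_const)

lemma smooth_in_add: "open U \<Longrightarrow> smooth_in A U F \<Longrightarrow> smooth_in A U G \<Longrightarrow> smooth_in A U (\<lambda>q. F q + G q)"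
  by (simp add: smooth_in_def smooth_on_add open_coord_image)

lemma smooth_in_diff: "open U \<Longrightarrow> smooth_in A U F \<Longrightarrow> smooth_in A U G \<Longrightarrow> smooth_in A U (\<lambda>q. F q - G q)"
  by (simp add: smooth_in_def smooth_on_diff open_coord_image)

lemma smooth_in_minus: "open U \<Longrightarrow> smooth_in A U F \<Longrightarrow> smooth_in A U (\<lambda>q. - F q)"
  by (simp add: smooth_in_def smooth_on_minus open_coord_image)

lemma smooth_in_scaleR: "open U \<Longrightarrow> smooth_in A U F \<Longrightarrow> smooth_in A U G \<Longrightarrow> smooth_in A U (\<lambda>q. F q *\<^sub>R G q)"
  by (simp add: smooth_in_def smooth_on_scaleR open_coord_image)

lemma smooth_in_mult:
  fixes F G :: "'a \<Rightarrow> real"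
  shows "open U \<Longrightarrow> smooth_in A U F \<Longrightarrow> smooth_in A U G \<Longrightarrow> smooth_in A U (\<lambda>q. F q * G q)"
  by (simp add: smooth_in_def smooth_on_mult open_coord_image)

lemma smooth_in_inverse:
  fixes F :: "'a \<Rightarrow> real"
  assumes "open U" "smooth_in A U F" "\<And>q. q \<in> U \<Longrightarrow> F q \<noteq> 0"
  shows "smooth_in A U (\<lambda>q. inverse (F q))"
  using assms in_coord_imageD(2) unfolding smooth_in_def
  by (auto intro!: smooth_on_inverse open_coord_image)

lemma smooth_in_linear_family:
  fixes L :: "'a \<Rightarrow> 'b::euclidean_space \<Rightarrow> 'c::real_normed_vector"
  assumes "open U" "\<And>q. q \<in> U \<Longrightarrow> linear (L q)" "\<And>w. smooth_in A U (\<lambda>q. L q w)" "smooth_in A U u"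
  shows "smooth_in A U (\<lambda>q. L q (u q))"
  unfolding smooth_in_def
proof
  fix c assume c: "c \<in> A"
  show "smooth_on (coord c ` (dom_chart c \<inter> U)) (\<lambda>x. L (chart_inv c x) (u (chart_inv c x)))"
    by (rule smooth_on_linear_family[OF open_coord_image[OF c assms(1)], where L = "\<lambda>x. L (chart_inv c x)"])
      (use assms c in_coord_imageD(2)[OF c] in \<open>auto simp: smooth_in_def\<close>)
qed

lemma smooth_in_bilinear_family:
  fixes B :: "'a \<Rightarrow> 'b::euclidean_space \<Rightarrow> 'd::euclidean_space \<Rightarrow> 'c::real_normed_vector"
  assumes "open U" "\<And>q. q \<in> U \<Longrightarrow> bilinear (B q)" "\<And>w z. smooth_in A U (\<lambda>q. B q w z)"
    "smooth_in A U u" "smooth_in A U v"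
  shows "smooth_in A U (\<lambda>q. B q (u q) (v q))"
  unfolding smooth_in_def
proof
  fix c assume c: "c \<in> A"
  show "smooth_on (coord c ` (dom_chart c \<inter> U)) (\<lambda>x. B (chart_inv c x) (u (chart_inv c x)) (v (chart_inv c x)))"
    by (rule smooth_on_bilinear_family[OF open_coord_image[OF c assms(1)], where B = "\<lambda>x. B (chart_inv c x)"])
      (use assms c in_coord_imageD(2)[OF c] in \<open>auto simp: smooth_in_def\<close>)
qed

lemma smooth_in_differentiable:
  assumes "smooth_in A U F" "c \<in> A" "p \<in> dom_chart c" "p \<in> U"
  shows "(\<lambda>x. F (chart_inv c x)) differentiable at (coord c p)"
  by (rule smooth_on_differentiable[OF smooth_inD[OF assms(1,2)]]) (use assms in auto)

section \<open>Tangent vectors and directional derivatives\<close>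

lemma tangent_spaceD:
  assumes "v \<in> tangent_space A p"
  shows "c \<in> A \<Longrightarrow> d \<in> A \<Longrightarrow> p \<in> dom_chart c \<Longrightarrow> p \<in> dom_chart d \<Longrightarrow>
      v d = frechet_derivative (\<lambda>x. coord d (chart_inv c x)) (at (coord c p)) (v c)"
    "c \<notin> A \<or> p \<notin> dom_chart c \<Longrightarrow> v c = 0"
  using assms unfolding tangent_space_def o_def by blast+

text \<open>\<open>dir_deriv\<close> is computed in the arbitrarily chosen
  \<open>chart_at A p\<close>. The chain rule brings in the Jacobian of the chart change, which the
  transformation law of the components of \<open>v\<close> absorbs.\<close>

lemma dir_deriv_chart:
  assumes F: "smooth_in A U F" "open U" "p \<in> U" and c: "c \<in> A" "p \<in> dom_chart c" and v: "v \<in> tangent_space A p"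
  shows "dir_deriv A F p v = frechet_derivative (\<lambda>x. F (chart_inv c x)) (at (coord c p)) (v c)"
proof -
  let ?d = "chart_at A p"
  let ?W = "coord ?d ` (dom_chart ?d \<inter> (dom_chart c \<inter> U))"
  have d: "?d \<in> A" "p \<in> dom_chart ?d" by (rule chart_at)+
  have op: "open ?W" by (rule open_coord_image[OF d(1)]) (use F(2) chart_homeomorphism(1)[OF c(1)] in auto)
  have pW: "coord ?d p \<in> ?W" using c d F by auto
  have t: "((\<lambda>x. coord c (chart_inv ?d x)) has_derivative
      frechet_derivative (\<lambda>x. coord c (chart_inv ?d x)) (at (coord ?d p))) (at (coord ?d p))"
    by (rule smooth_on_has_derivative[OF transition_smooth[OF d(1) c(1)]]) (use c d in auto)
  have e: "chart_inv ?d (coord ?d p) = p" using chart_homeomorphism(5)[OF d(1)] d(2) by simp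
  have f: "((\<lambda>x. F (chart_inv c x)) has_derivative
      frechet_derivative (\<lambda>x. F (chart_inv c x)) (at (coord c p))) (at (coord c (chart_inv ?d (coord ?d p))))"
    unfolding e by (rule frechetI[OF smooth_in_differentiable[OF F(1) c F(3)]])
  have "((\<lambda>x. F (chart_inv ?d x)) has_derivative
      (\<lambda>h. frechet_derivative (\<lambda>x. F (chart_inv c x)) (at (coord c p))
        (frechet_derivative (\<lambda>x. coord c (chart_inv ?d x)) (at (coord ?d p)) h))) (at (coord ?d p))"
    by (rule has_derivative_transform_within_open[OF has_derivative_compose[OF t f] op pW])
      (use chart_homeomorphism(5)[OF c(1)] in_coord_imageD[OF d(1)] in auto)
  from frechet_derivative_eqI[OF this] tangent_spaceD(1)[OF v d(1) c(1) d(2) c(2)]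
  show ?thesis by (simp add: dir_deriv_def Let_def o_def)
qed

lemma dir_deriv_chart_at:
  "dir_deriv A F p v = frechet_derivative (\<lambda>x. F (chart_inv (chart_at A p) x)) (at (coord (chart_at A p) p)) (v (chart_at A p))"
  by (simp add: dir_deriv_def Let_def o_def)

lemma dir_deriv_const: "dir_deriv A (\<lambda>q. k) p v = 0"
  by (simp add: dir_deriv_chart_at)

lemma frechet_chart_at:
  assumes "smooth_in A U F" "p \<in> U"
  shows "((\<lambda>x. F (chart_inv (chart_at A p) x)) has_derivative
    frechet_derivative (\<lambda>x. F (chart_inv (chart_at A p) x)) (at (coord (chart_at A p) p))) (at (coord (chart_at A p) p))"
  by (rule frechetI[OF smooth_in_differentiable[OF assms(1) chart_at assms(2)]])

lemma chart_at_inv [simp]: "chart_inv (chart_at A p) (coord (chart_at A p) p) = p"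
  by (rule chart_homeomorphism(5)[OF chart_at])

lemma dir_deriv_linear:
  assumes "smooth_in A U F" "p \<in> U"
  shows "dir_deriv A F p (\<lambda>c. a *\<^sub>R v c + b *\<^sub>R w c) = a *\<^sub>R dir_deriv A F p v + b *\<^sub>R dir_deriv A F p w"
  using has_derivative_linear[OF frechet_chart_at[OF assms]]
  by (simp add: dir_deriv_chart_at linear_add linear_scale)

lemma dir_deriv_add:
  assumes "smooth_in A U F" "smooth_in A U G" "p \<in> U"
  shows "dir_deriv A (\<lambda>q. F q + G q) p v = dir_deriv A F p v + dir_deriv A G p v"
  using frechet_derivative_eqI[OF has_derivative_add[OF frechet_chart_at[OF assms(1,3)] frechet_chart_at[OF assms(2,3)]]]
  by (simp add: dir_deriv_chart_at)

lemma dir_deriv_diff: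
  assumes "smooth_in A U F" "smooth_in A U G" "p \<in> U"
  shows "dir_deriv A (\<lambda>q. F q - G q) p v = dir_deriv A F p v - dir_deriv A G p v"
  using frechet_derivative_eqI[OF has_derivative_diff[OF frechet_chart_at[OF assms(1,3)] frechet_chart_at[OF assms(2,3)]]]
  by (simp add: dir_deriv_chart_at)

lemma dir_deriv_scaleR:
  assumes "smooth_in A U F" "smooth_in A U G" "p \<in> U"
  shows "dir_deriv A (\<lambda>q. F q *\<^sub>R G q) p v = dir_deriv A F p v *\<^sub>R G p + F p *\<^sub>R dir_deriv A G p v"
  using frechet_derivative_eqI[OF has_derivative_scaleR[OF frechet_chart_at[OF assms(1,3)] frechet_chart_at[OF assms(2,3)]]]
  by (simp add: dir_deriv_chart_at)

lemma dir_deriv_compose: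
  fixes F :: "'a \<Rightarrow> 'b::euclidean_space"
  assumes "smooth_in A U F" "p \<in> U" "G differentiable at (F p)"
  shows "dir_deriv A (\<lambda>q. G (F q)) p v = frechet_derivative G (at (F p)) (dir_deriv A F p v)"
proof -
  have "(G has_derivative frechet_derivative G (at (F p)))
     (at (F (chart_inv (chart_at A p) (coord (chart_at A p) p))))"
    using frechetI[OF assms(3)] by simp
  from frechet_derivative_eqI[OF has_derivative_compose[OF frechet_chart_at[OF assms(1,2)] this]]
  show ?thesis by (simp add: dir_deriv_chart_at)
qed

lemma dir_deriv_cong:
  assumes "smooth_in A U F" "open U" "p \<in> U" "\<And>q. q \<in> U \<Longrightarrow> F q = G q"
  shows "dir_deriv A F p v = dir_deriv A G p v"
proof -
  let ?c = "chart_at A p"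
  let ?W = "coord ?c ` (dom_chart ?c \<inter> U)"
  have "((\<lambda>x. G (chart_inv ?c x)) has_derivative
     frechet_derivative (\<lambda>x. F (chart_inv ?c x)) (at (coord ?c p))) (at (coord ?c p))"
    by (rule has_derivative_transform_within_open[OF frechet_chart_at[OF assms(1,3)]
          open_coord_image[OF chart_at(1) assms(2)]])
      (use assms(3,4) chart_at(2) in_coord_imageD[OF chart_at(1)] in auto)
  from frechet_derivative_eqI[OF this] show ?thesis by (simp add: dir_deriv_chart_at)
qed

lemma dir_deriv_linear_family:
  fixes L :: "'a \<Rightarrow> 'b::euclidean_space \<Rightarrow> 'c::real_normed_vector"
  assumes "open U" "p \<in> U" "\<And>q. q \<in> U \<Longrightarrow> linear (L q)" "\<And>w. smooth_in A U (\<lambda>q. L q w)" "smooth_in A U u"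
  shows "dir_deriv A (\<lambda>q. L q (u q)) p x = dir_deriv A (\<lambda>q. L q (u p)) p x + L p (dir_deriv A u p x)"
proof -
  let ?c = "chart_at A p"
  have "((\<lambda>x. L (chart_inv ?c x) (u (chart_inv ?c x))) has_derivative
    (\<lambda>h. frechet_derivative (\<lambda>x. L (chart_inv ?c x) (u (chart_inv ?c (coord ?c p)))) (at (coord ?c p)) h +
      L (chart_inv ?c (coord ?c p)) (frechet_derivative (\<lambda>x. u (chart_inv ?c x)) (at (coord ?c p)) h)))
    (at (coord ?c p))"
    by (rule linear_family_has_derivative[OF open_coord_image[OF chart_at(1) assms(1)], where L = "\<lambda>x. L (chart_inv ?c x)"])
      (use assms chart_at in_coord_imageD(2)[OF chart_at(1)] smooth_in_differentiable[OF assms(4) chart_at assms(2)]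
        smooth_in_differentiable[OF assms(5) chart_at assms(2)] in auto)
  from frechet_derivative_eqI[OF this] show ?thesis by (simp add: dir_deriv_chart_at)
qed

lemma dir_deriv_bilinear_family:
  fixes B :: "'a \<Rightarrow> 'b::euclidean_space \<Rightarrow> 'd::euclidean_space \<Rightarrow> 'c::real_normed_vector"
  assumes "open U" "p \<in> U" "\<And>q. q \<in> U \<Longrightarrow> bilinear (B q)" "\<And>w z. smooth_in A U (\<lambda>q. B q w z)"
    "smooth_in A U u" "smooth_in A U v"
  shows "dir_deriv A (\<lambda>q. B q (u q) (v q)) p x = dir_deriv A (\<lambda>q. B q (u p) (v p)) p x
     + B p (dir_deriv A u p x) (v p) + B p (u p) (dir_deriv A v p x)"
proof -
  let ?c = "chart_at A p"
  have "((\<lambda>x. B (chart_inv ?c x) (u (chart_inv ?c x)) (v (chart_inv ?c x))) has_derivative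
    (\<lambda>h. frechet_derivative (\<lambda>x. B (chart_inv ?c x) (u (chart_inv ?c (coord ?c p))) (v (chart_inv ?c (coord ?c p)))) (at (coord ?c p)) h +
      B (chart_inv ?c (coord ?c p)) (frechet_derivative (\<lambda>x. u (chart_inv ?c x)) (at (coord ?c p)) h) (v (chart_inv ?c (coord ?c p)))
      + B (chart_inv ?c (coord ?c p)) (u (chart_inv ?c (coord ?c p))) (frechet_derivative (\<lambda>x. v (chart_inv ?c x)) (at (coord ?c p)) h)))
    (at (coord ?c p))"
    by (rule bilinear_family_has_derivative[OF open_coord_image[OF chart_at(1) assms(1)], where B = "\<lambda>x. B (chart_inv ?c x)"])
      (use assms chart_at in_coord_imageD(2)[OF chart_at(1)] smooth_in_differentiable[OF assms(4) chart_at assms(2)]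
        smooth_in_differentiable[OF assms(5) chart_at assms(2)] smooth_in_differentiable[OF assms(6) chart_at assms(2)]
        in auto)
  from frechet_derivative_eqI[OF this] show ?thesis by (simp add: dir_deriv_chart_at)
qed

lemma tangent_coord:
  assumes "v \<in> tangent_space A p" "d \<in> A" "p \<in> dom_chart d"
  shows "dir_deriv A (coord d) p v = v d"
  using tangent_spaceD(1)[OF assms(1) chart_at(1) assms(2) chart_at(2) assms(3)] by (simp add: dir_deriv_chart_at)

lemma coord_field_component:
  "d \<in> A \<Longrightarrow> p \<in> dom_chart d \<Longrightarrow>
     coord_field A c u p d = frechet_derivative (\<lambda>x. coord d (chart_inv c x)) (at (coord c p)) u"
  by (simp add: coord_field_def o_def)

lemma coord_field_self: "c \<in> A \<Longrightarrow> p \<in> dom_chart c \<Longrightarrow> coord_field A c u p c = u"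
proof -
  assume c: "c \<in> A" "p \<in> dom_chart c"
  have "((\<lambda>x. coord c (chart_inv c x)) has_derivative (\<lambda>h. h)) (at (coord c p))"
    by (rule has_derivative_transform_within_open[OF has_derivative_ident chart_homeomorphism(2)[OF c(1)]])
      (use c chart_homeomorphism(7)[OF c(1)] in auto)
  from frechet_derivative_eqI[OF this] show ?thesis using c by (simp add: coord_field_component)
qed

lemma coord_field_tangent:
  assumes c: "c \<in> A" "p \<in> dom_chart c"
  shows "coord_field A c u p \<in> tangent_space A p"
  unfolding tangent_space_def
proof (intro CollectI conjI ballI impI allI)
  fix d e assume d: "d \<in> A" "e \<in> A" "p \<in> dom_chart d \<inter> dom_chart e"
  let ?W = "coord c ` (dom_chart c \<inter> (dom_chart d \<inter> dom_chart e))"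
  have op: "open ?W"
    by (rule open_coord_image[OF c(1) open_Int[OF chart_homeomorphism(1)[OF d(1)] chart_homeomorphism(1)[OF d(2)]]])
  have 1: "((\<lambda>x. coord d (chart_inv c x)) has_derivative
      frechet_derivative (\<lambda>x. coord d (chart_inv c x)) (at (coord c p))) (at (coord c p))"
    by (rule smooth_on_has_derivative[OF transition_smooth[OF c(1) d(1)]]) (use c d in auto)
  have e: "chart_inv c (coord c p) = p" using chart_homeomorphism(5)[OF c(1)] c(2) by simp
  have 2: "((\<lambda>x. coord e (chart_inv d x)) has_derivative
      frechet_derivative (\<lambda>x. coord e (chart_inv d x)) (at (coord d p))) (at (coord d (chart_inv c (coord c p))))"
    unfolding e by (rule smooth_on_has_derivative[OF transition_smooth[OF d(1) d(2)]]) (use c d in auto)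
  have "((\<lambda>x. coord e (chart_inv c x)) has_derivative
      (\<lambda>h. frechet_derivative (\<lambda>x. coord e (chart_inv d x)) (at (coord d p))
        (frechet_derivative (\<lambda>x. coord d (chart_inv c x)) (at (coord c p)) h))) (at (coord c p))"
    by (rule has_derivative_transform_within_open[OF has_derivative_compose[OF 1 2] op])
      (use c d chart_homeomorphism(5)[OF d(1)] in_coord_imageD[OF c(1)] in auto)
  from frechet_derivative_eqI[OF this]
  show "coord_field A c u p e = frechet_derivative (coord e \<circ> chart_inv d) (at (coord d p)) (coord_field A c u p d)"
    using d by (simp add: coord_field_component o_def)
qed (auto simp: coord_field_def)

lemma tangent_eqI:
  assumes "v \<in> tangent_space A p" "w \<in> tangent_space A p" "c \<in> A" "p \<in> dom_chart c" "v c = w c"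
  shows "v = w"
proof
  fix d
  show "v d = w d"
  proof (cases "d \<in> A \<and> p \<in> dom_chart d")
    case True
    then show ?thesis
      using tangent_spaceD(1)[OF assms(1,3), of d] tangent_spaceD(1)[OF assms(2,3), of d] assms(4,5) by simp
  next
    case False
    then show ?thesis using tangent_spaceD(2)[OF assms(1)] tangent_spaceD(2)[OF assms(2)] by auto
  qed
qed

lemma coord_field_eq:
  "v \<in> tangent_space A p \<Longrightarrow> c \<in> A \<Longrightarrow> p \<in> dom_chart c \<Longrightarrow> coord_field A c (v c) p = v"
  by (rule tangent_eqI[OF coord_field_tangent]) (auto simp: coord_field_self)

text \<open>Compatibility with one chart implies compatibility between all pairs, because the vector
  then coincides with a coordinate field, for which the chain rule has been checked.\<close>

lemma tangentI:
  assumes c: "c \<in> A" "p \<in> dom_chart c"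
    and "\<And>d. d \<in> A \<Longrightarrow> p \<in> dom_chart d \<Longrightarrow>
       v d = frechet_derivative (\<lambda>x. coord d (chart_inv c x)) (at (coord c p)) (v c)"
    and "\<And>d. d \<notin> A \<or> p \<notin> dom_chart d \<Longrightarrow> v d = 0"
  shows "v \<in> tangent_space A p"
proof -
  have "coord_field A c (v c) p = v"
  proof
    fix d show "coord_field A c (v c) p d = v d"
      using assms(3,4)[of d] by (cases "d \<in> A \<and> p \<in> dom_chart d") (auto simp: coord_field_def o_def)
  qed
  then show ?thesis using coord_field_tangent[OF c, of "v c"] by simp
qed

lemma tangent_lincomb:
  assumes "v \<in> tangent_space A p" "w \<in> tangent_space A p"
  shows "(\<lambda>c. a *\<^sub>R v c + b *\<^sub>R w c) \<in> tangent_space A p"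
proof (rule tangentI[OF chart_at])
  fix d assume d: "d \<in> A" "p \<in> dom_chart d"
  have "linear (frechet_derivative (\<lambda>x. coord d (chart_inv (chart_at A p) x)) (at (coord (chart_at A p) p)))"
    by (rule has_derivative_linear[OF frechet_chart_at[OF smooth_in_coord[OF d(1)] d(2)]])
  then show "a *\<^sub>R v d + b *\<^sub>R w d = frechet_derivative (\<lambda>x. coord d (chart_inv (chart_at A p) x))
     (at (coord (chart_at A p) p)) (a *\<^sub>R v (chart_at A p) + b *\<^sub>R w (chart_at A p))"
    using tangent_spaceD(1)[OF assms(1) chart_at(1) d(1) chart_at(2) d(2)]
      tangent_spaceD(1)[OF assms(2) chart_at(1) d(1) chart_at(2) d(2)]
    by (simp add: linear_add linear_scale)
next
  fix d assume "d \<notin> A \<or> p \<notin> dom_chart d"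
  then show "a *\<^sub>R v d + b *\<^sub>R w d = 0" using tangent_spaceD(2)[OF assms(1)] tangent_spaceD(2)[OF assms(2)] by simp
qed

lemma tangent_zero: "(\<lambda>c. 0) \<in> tangent_space A p"
  using tangent_lincomb[of "coord_field A (chart_at A p) 0 p" p "coord_field A (chart_at A p) 0 p" 0 0]
    coord_field_tangent[OF chart_at] by simp

lemma tangent_scaleR: "v \<in> tangent_space A p \<Longrightarrow> (\<lambda>c. a *\<^sub>R v c) \<in> tangent_space A p"
  using tangent_lincomb[of v p v a 0] by simp

lemma tangent_add: "v \<in> tangent_space A p \<Longrightarrow> w \<in> tangent_space A p \<Longrightarrow> (\<lambda>c. v c + w c) \<in> tangent_space A p"
  using tangent_lincomb[of v p w 1 1] by simp

lemma tangent_diff: "v \<in> tangent_space A p \<Longrightarrow> w \<in> tangent_space A p \<Longrightarrow> (\<lambda>c. v c - w c) \<in> tangent_space A p"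
  using tangent_lincomb[of v p w 1 "-1"] by simp

section \<open>Vector fields and the Lie bracket\<close>

lemma vector_field_iff:
  "X \<in> vector_fields A \<longleftrightarrow> (\<forall>p. X p \<in> tangent_space A p) \<and> (\<forall>d\<in>A. smooth_in A (dom_chart d) (\<lambda>q. X q d))"
  by (auto simp: vector_fields_def smooth_field_along_def smooth_in_def)

lemma vector_field_tangent: "X \<in> vector_fields A \<Longrightarrow> X p \<in> tangent_space A p"
  by (simp add: vector_field_iff)

lemma smooth_in_dir_deriv:
  assumes X: "X \<in> vector_fields A" and F: "smooth_in A U F" and U: "open U"
  shows "smooth_in A U (\<lambda>q. dir_deriv A F q (X q))"
  unfolding smooth_in_def
proof
  fix c assume c: "c \<in> A"
  let ?W = "coord c ` (dom_chart c \<inter> U)"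
  have op: "open ?W" by (rule open_coord_image[OF c U])
  have F': "smooth_on ?W (\<lambda>x. F (chart_inv c x))" by (rule smooth_inD[OF F c])
  show "smooth_on ?W (\<lambda>x. dir_deriv A F (chart_inv c x) (X (chart_inv c x)))"
  proof (rule smooth_on_cong[OF _ op])
    show "smooth_on ?W (\<lambda>x. frechet_derivative (\<lambda>x. F (chart_inv c x)) (at x) (X (chart_inv c x) c))"
    proof (rule smooth_on_linear_family[OF op])
      show "linear (frechet_derivative (\<lambda>x. F (chart_inv c x)) (at y))" if "y \<in> ?W" for y
        by (rule has_derivative_linear[OF smooth_on_has_derivative[OF F' that]])
      show "smooth_on ?W (\<lambda>x. X (chart_inv c x) c)"
        by (rule smooth_on_subset[OF smooth_inD[of "dom_chart c"]]) (use X c in \<open>auto simp: vector_field_iff\<close>)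
    qed (rule smooth_on_frechet[OF F'])
    fix x assume "x \<in> ?W"
    from dir_deriv_chart[OF F U in_coord_imageD(2)[OF c this] c in_coord_imageD(1)[OF c this] vector_field_tangent[OF X]]
      in_coord_imageD(3)[OF c this]
    show "frechet_derivative (\<lambda>x. F (chart_inv c x)) (at x) (X (chart_inv c x) c) =
       dir_deriv A F (chart_inv c x) (X (chart_inv c x))" by simp
  qed
qed

text \<open>The product rule separates the Hessian of the coordinate expression from the derivative
  of the components of \<open>X\<close>. In a commutator the Hessian terms cancel by symmetry and
  the rest is the Lie bracket.\<close>

lemma dir_deriv_dir_deriv:
  assumes X: "X \<in> vector_fields A" and F: "smooth_in A U F" and U: "open U" "p \<in> U"
  defines "c \<equiv> chart_at A p"
  shows "dir_deriv A (\<lambda>q. dir_deriv A F q (X q)) p v =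
     frechet_derivative (\<lambda>x. frechet_derivative (\<lambda>x. F (chart_inv c x)) (at x) (X p c)) (at (coord c p)) (v c)
     + frechet_derivative (\<lambda>x. F (chart_inv c x)) (at (coord c p)) (dir_deriv A (\<lambda>q. X q c) p v)"
proof -
  have c: "c \<in> A" "p \<in> dom_chart c" unfolding c_def by (rule chart_at)+
  let ?W = "coord c ` (dom_chart c \<inter> U)"
  have op: "open ?W" by (rule open_coord_image[OF c(1) U(1)])
  have pW: "coord c p \<in> ?W" using c U by auto
  have F': "smooth_on ?W (\<lambda>x. F (chart_inv c x))" by (rule smooth_inD[OF F c(1)])
  have X': "smooth_on ?W (\<lambda>x. X (chart_inv c x) c)"
    by (rule smooth_on_subset[OF smooth_inD[of "dom_chart c"]]) (use X c in \<open>auto simp: vector_field_iff\<close>)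
  let ?L = "\<lambda>x. frechet_derivative (\<lambda>x. F (chart_inv c x)) (at x)"
  have e: "chart_inv c (coord c p) = p" unfolding c_def by simp
  have "((\<lambda>x. ?L x (X (chart_inv c x) c)) has_derivative
    (\<lambda>h. frechet_derivative (\<lambda>x. ?L x (X (chart_inv c (coord c p)) c)) (at (coord c p)) h +
       ?L (coord c p) (frechet_derivative (\<lambda>x. X (chart_inv c x) c) (at (coord c p)) h))) (at (coord c p))"
    by (rule linear_family_has_derivative[OF op pW])
      (use has_derivative_linear[OF smooth_on_has_derivative[OF F']]
        smooth_on_differentiable[OF smooth_on_frechet[OF F'] pW] smooth_on_differentiable[OF X' pW] in auto)
  then have "((\<lambda>x. dir_deriv A F (chart_inv c x) (X (chart_inv c x))) has_derivative
    (\<lambda>h. frechet_derivative (\<lambda>x. ?L x (X (chart_inv c (coord c p)) c)) (at (coord c p)) h +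
       ?L (coord c p) (frechet_derivative (\<lambda>x. X (chart_inv c x) c) (at (coord c p)) h))) (at (coord c p))"
  proof (rule has_derivative_transform_within_open[OF _ op pW])
    fix x assume "x \<in> ?W"
    from dir_deriv_chart[OF F U(1) in_coord_imageD(2)[OF c(1) this] c(1) in_coord_imageD(1)[OF c(1) this] vector_field_tangent[OF X]]
      in_coord_imageD(3)[OF c(1) this]
    show "?L x (X (chart_inv c x) c) = dir_deriv A F (chart_inv c x) (X (chart_inv c x))" by simp
  qed
  from frechet_derivative_eqI[OF this] show ?thesis
    by (simp add: dir_deriv_chart_at[of _ p, folded c_def] e)
qed

lemma dir_deriv_lie_bracket:
  fixes F :: "'a \<Rightarrow> 'b::euclidean_space"
  assumes X: "X \<in> vector_fields A" and Y: "Y \<in> vector_fields A" and F: "smooth_in A U F" and U: "open U" "p \<in> U"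
  shows "dir_deriv A F p (lie_bracket A X Y p) =
    dir_deriv A (\<lambda>q. dir_deriv A F q (Y q)) p (X p) - dir_deriv A (\<lambda>q. dir_deriv A F q (X q)) p (Y p)"
proof -
  let ?c = "chart_at A p"
  let ?W = "coord ?c ` (dom_chart ?c \<inter> U)"
  have op: "open ?W" by (rule open_coord_image[OF chart_at(1) U(1)])
  have pW: "coord ?c p \<in> ?W" using chart_at(2) U by auto
  have F': "smooth_on ?W (\<lambda>x. F (chart_inv ?c x))" by (rule smooth_inD[OF F chart_at(1)])
  have lin: "linear (frechet_derivative (\<lambda>x. F (chart_inv ?c x)) (at (coord ?c p)))"
    by (rule has_derivative_linear[OF smooth_on_has_derivative[OF F' pW]])
  show ?thesis
    unfolding dir_deriv_dir_deriv[OF X F U] dir_deriv_dir_deriv[OF Y F U]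
    using second_derivative_symmetric[OF F' op pW, of "Y p ?c" "X p ?c"] chart_at[of p]
    by (simp add: dir_deriv_chart_at[of F p] lie_bracket_def linear_diff[OF lin])
qed

text \<open>The component of the bracket in a chart \<open>d\<close> is the derivative of the
  function \<open>coord d\<close> along the bracket, and derivatives of functions obey the
  transformation law.\<close>

lemma lie_bracket_tangent:
  assumes X: "X \<in> vector_fields A" and Y: "Y \<in> vector_fields A"
  shows "lie_bracket A X Y p \<in> tangent_space A p"
proof (rule tangentI[OF chart_at])
  fix d assume d: "d \<in> A" "p \<in> dom_chart d"
  have o: "open (dom_chart d)" using chart_homeomorphism(1)[OF d(1)] .
  have *: "dir_deriv A (\<lambda>q. dir_deriv A (coord d) q (Z q)) p v = dir_deriv A (\<lambda>q. Z q d) p v"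
    if Z: "Z \<in> vector_fields A" for Z v
    by (rule dir_deriv_cong[OF smooth_in_dir_deriv[OF Z smooth_in_coord[OF d(1)] o] o d(2)])
      (rule tangent_coord[OF vector_field_tangent[OF Z] d(1)])
  have "lie_bracket A X Y p d = dir_deriv A (coord d) p (lie_bracket A X Y p)"
    unfolding dir_deriv_lie_bracket[OF X Y smooth_in_coord[OF d(1)] o d(2)] *[OF X] *[OF Y]
    using d by (simp add: lie_bracket_def)
  then show "lie_bracket A X Y p d = frechet_derivative (\<lambda>x. coord d (chart_inv (chart_at A p) x))
     (at (coord (chart_at A p) p)) (lie_bracket A X Y p (chart_at A p))"
    by (simp add: dir_deriv_chart_at)
qed (auto simp: lie_bracket_def)

end

section \<open>Extension of coordinate fields and local structure\<close>

context smooth_manifold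
begin

lemma open_chart_preimage:
  assumes "c \<in> A" "open V"
  shows "open {q \<in> dom_chart c. coord c q \<in> V}"
proof -
  have "{q \<in> dom_chart c. coord c q \<in> V} = dom_chart c \<inter> coord c -` V" by auto
  then show ?thesis
    using continuous_open_preimage[OF chart_homeomorphism(3,1)[OF assms(1)] assms(2)] by simp
qed

text \<open>Smoothness and closedness of one-forms are tested on global vector fields, whereas local
  computations use coordinate fields; a bump function joins the two.\<close>

lemma extend_coord_field:
  assumes c: "c \<in> A" "p \<in> dom_chart c"
  shows "\<exists>X\<in>vector_fields A. \<exists>W. open W \<and> p \<in> W \<and> W \<subseteq> dom_chart c \<and> (\<forall>q\<in>W. X q = coord_field A c u q)"
proof -
  note ch = chart_homeomorphism[OF c(1)]
  let ?x = "coord c p"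
  obtain s where s: "s > 0" "cball ?x s \<subseteq> coord c ` dom_chart c"
    using open_contains_cball[of "coord c ` dom_chart c"] ch(2) c(2) by blast
  define r where "r = s / 2"
  have r: "r > 0" "cball ?x (2 * r) \<subseteq> coord c ` dom_chart c" using s by (auto simp: r_def)
  obtain f :: "'e \<Rightarrow> real" where f: "smooth_on UNIV f" "\<And>x. x \<in> ball ?x r \<Longrightarrow> f x = 1"
    "\<And>x. x \<notin> ball ?x (2 * r) \<Longrightarrow> f x = 0"
    using smooth_bump_exists[OF r(1), of ?x] by blast
  define K where "K = chart_inv c ` cball ?x (2 * r)"
  have "compact K"
    unfolding K_def by (rule compact_continuous_image[OF continuous_on_subset[OF ch(4) r(2)] compact_cball])
  \<comment> \<open>The Hausdorff property enters here: it makes the compact support closed in the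
    whole manifold, not just in the chart, so extension by zero is smooth.\<close>
  then have K: "closed K" by (rule compact_imp_closed)
  have KD: "K \<subseteq> dom_chart c" using r(2) ch(6) by (auto simp: K_def)
  define X where "X q = (if q \<in> dom_chart c then (\<lambda>d. f (coord c q) *\<^sub>R coord_field A c u q d) else (\<lambda>d. 0))" for q
  have "X q \<in> tangent_space A q" for q
    using tangent_scaleR[OF coord_field_tangent[OF c(1)]] tangent_zero by (simp add: X_def)
  moreover have "smooth_in A (dom_chart d) (\<lambda>q. X q d)" if d: "d \<in> A" for d
  proof (rule smooth_in_local)
    fix q assume q: "q \<in> dom_chart d"
    show "\<exists>V. open V \<and> q \<in> V \<and> smooth_in A V (\<lambda>q. X q d)"
    proof (cases "q \<in> dom_chart c")
      case True
      let ?V = "dom_chart c \<inter> dom_chart d"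
      have oV: "open ?V" using ch(1) chart_homeomorphism(1)[OF d] by (rule open_Int)
      let ?F = "\<lambda>x. f x *\<^sub>R frechet_derivative (\<lambda>x. coord d (chart_inv c x)) (at x) u"
      have "smooth_on (coord c ` ?V) ?F"
        using open_coord_image[OF c(1) chart_homeomorphism(1)[OF d]]
        by (intro smooth_on_scaleR smooth_on_subset[OF f(1)] smooth_on_frechet transition_smooth[OF c(1) d]) auto
      then have "smooth_in A ?V (\<lambda>q. ?F (coord c q))"
        by (intro smooth_in_compose[OF oV smooth_in_subset[OF smooth_in_coord[OF c(1)]]]) auto
      then have "smooth_in A ?V (\<lambda>q. X q d)"
        by (rule smooth_in_cong[OF _ oV]) (use d in \<open>auto simp: X_def coord_field_component\<close>)
      then show ?thesis using oV True q by blast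
    next
      case False
      \<comment> \<open>A point outside the chart may be a boundary point of it; off the closed set
        \<open>K\<close> the field vanishes inside the chart as well as outside.\<close>
      let ?V = "- K"
      have "X q' d = 0" if "q' \<in> ?V" for q'
      proof (cases "q' \<in> dom_chart c")
        case True
        have "coord c q' \<notin> cball ?x (2 * r)"
        proof
          assume "coord c q' \<in> cball ?x (2 * r)"
          then have "chart_inv c (coord c q') \<in> K" unfolding K_def by (rule imageI)
          then show False using ch(5)[OF True] that by simp
        qed
        then have "f (coord c q') = 0" by (intro f(3)) auto
        then show ?thesis by (simp add: X_def)
      qed (simp add: X_def)
      then have "smooth_in A ?V (\<lambda>q. X q d)"
        by (intro smooth_in_cong[OF smooth_in_const[of ?V 0]]) (use K in auto)
      then show ?thesis using K KD False by (intro exI[of _ ?V]) auto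
    qed
  qed
  ultimately have "X \<in> vector_fields A" by (simp add: vector_field_iff)
  moreover have "open {q \<in> dom_chart c. coord c q \<in> ball ?x r}" by (rule open_chart_preimage[OF c(1) open_ball])
  ultimately show ?thesis
    using c(2) r(1) f(2) by (intro bexI[of _ X] exI[of _ "{q \<in> dom_chart c. coord c q \<in> ball ?x r}"]) (auto simp: X_def)
qed

lemma chart_ball:
  assumes c: "c \<in> A" "p \<in> dom_chart c" and U: "open U" "p \<in> U"
  obtains r where "r > 0" "ball (coord c p) r \<subseteq> coord c ` (dom_chart c \<inter> U)"
proof -
  have "coord c p \<in> coord c ` (dom_chart c \<inter> U)" using assms by blast
  then show ?thesis using open_coord_image[OF c(1) U(1)] that by (meson openE)
qed

lemma locally_path_connected:
  fixes U :: "'a set"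
  assumes U: "open U" "p \<in> U"
  shows "\<exists>V. open V \<and> p \<in> V \<and> V \<subseteq> U \<and> path_connected V"
proof -
  let ?c = "chart_at A p"
  note ch = chart_homeomorphism[OF chart_at(1)[of p]]
  obtain r where r: "r > 0" "ball (coord ?c p) r \<subseteq> coord ?c ` (dom_chart ?c \<inter> U)"
    using chart_ball[OF chart_at U] .
  let ?V = "{q \<in> dom_chart ?c. coord ?c q \<in> ball (coord ?c p) r}"
  have sub: "ball (coord ?c p) r \<subseteq> coord ?c ` dom_chart ?c" using r(2) by blast
  have V: "?V = chart_inv ?c ` ball (coord ?c p) r"
  proof
    show "?V \<subseteq> chart_inv ?c ` ball (coord ?c p) r" using ch(5) by (auto intro!: rev_image_eqI)
    show "chart_inv ?c ` ball (coord ?c p) r \<subseteq> ?V" using ch(6,7) sub by auto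
  qed
  have "path_connected ?V"
    unfolding V by (rule path_connected_continuous_image[OF continuous_on_subset[OF ch(4) sub]])
      (simp add: convex_imp_path_connected)
  moreover have "?V \<subseteq> U" unfolding V using in_coord_imageD(2)[OF chart_at(1)] r(2) by blast
  ultimately show ?thesis
    using open_chart_preimage[OF chart_at(1) open_ball] chart_at(2) r(1) by (intro exI[of _ ?V]) auto
qed

lemma dir_deriv_zero_locally_constant:
  fixes F :: "'a \<Rightarrow> 'b::euclidean_space"
  assumes F: "smooth_in A U F" and U: "open U" "p \<in> U"
    and zero: "\<And>q v. q \<in> U \<Longrightarrow> v \<in> tangent_space A q \<Longrightarrow> dir_deriv A F q v = 0"
  shows "\<forall>\<^sub>F q in nhds p. F q = F p"
proof -
  let ?c = "chart_at A p"
  note ch = chart_homeomorphism[OF chart_at(1)[of p]]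
  obtain r where r: "r > 0" "ball (coord ?c p) r \<subseteq> coord ?c ` (dom_chart ?c \<inter> U)"
    using chart_ball[OF chart_at U] .
  let ?V = "{q \<in> dom_chart ?c. coord ?c q \<in> ball (coord ?c p) r}"
  let ?F = "\<lambda>x. F (chart_inv ?c x)"
  have "(?F has_derivative (\<lambda>h. 0)) (at x within ball (coord ?c p) r)" if x: "x \<in> ball (coord ?c p) r" for x
  proof -
    have xU: "x \<in> coord ?c ` (dom_chart ?c \<inter> U)" using x r(2) by blast
    note q = in_coord_imageD[OF chart_at(1) xU]
    have "frechet_derivative ?F (at x) h = 0" for h
      using dir_deriv_chart[OF F U(1) q(2) chart_at(1) q(1) coord_field_tangent[OF chart_at(1) q(1)], of h]
        zero[OF q(2) coord_field_tangent[OF chart_at(1) q(1)], of h]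
      by (simp add: q(3) coord_field_self[OF chart_at(1) q(1)])
    then have "frechet_derivative ?F (at x) = (\<lambda>h. 0)" by blast
    then show ?thesis
      using smooth_on_has_derivative[OF smooth_inD[OF F chart_at(1)] xU] by (simp add: has_derivative_at_withinI)
  qed
  then obtain k where k: "\<And>x. x \<in> ball (coord ?c p) r \<Longrightarrow> ?F x = k"
    using has_derivative_zero_constant[of "ball (coord ?c p) r" ?F] by auto
  have "F q = k" if "q \<in> ?V" for q using k[of "coord ?c q"] ch(5)[of q] that by auto
  moreover have "p \<in> ?V" using chart_at(2) r(1) by auto
  ultimately have "\<forall>q\<in>?V. F q = F p" by metis
  then show ?thesis
    using open_chart_preimage[OF chart_at(1) open_ball] \<open>p \<in> ?V\<close> unfolding eventually_nhds by blast
qed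

lemma smooth_fun_iff: "smooth_fun A h \<longleftrightarrow> smooth_in A UNIV h"
  by (simp add: smooth_fun_def smooth_in_def o_def)

end

section \<open>Smooth maps, differentials and fields along a map\<close>

locale smooth_manifold_map = src: smooth_manifold A + tgt: smooth_manifold B
  for A :: "('a::{t2_space, second_countable_topology}, 'd::euclidean_space) chart set"
    and B :: "('b::{t2_space, second_countable_topology}, 'e::euclidean_space) chart set" +
  fixes f :: "'a \<Rightarrow> 'b"
  assumes smooth: "smooth_map A B f"
begin

lemma open_preimage: "open U \<Longrightarrow> open (f -` U)"
  using smooth unfolding smooth_map_def by (simp add: open_vimage)

lemma open_dom_preimage: "d \<in> B \<Longrightarrow> open (f -` dom_chart d)"
  by (intro open_preimage tgt.chart_homeomorphism(1))

lemma smooth_in_coord_map: "d \<in> B \<Longrightarrow> smooth_in A (f -` dom_chart d) (\<lambda>q. coord d (f q))"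
  using smooth unfolding smooth_map_def smooth_in_def by (simp add: o_def)

lemma smooth_in_pullback_chart:
  assumes d: "d \<in> B" and G: "smooth_in B U G" "open U"
  shows "smooth_in A (f -` (U \<inter> dom_chart d)) (\<lambda>q. G (chart_inv d (coord d (f q))))"
proof (rule src.smooth_in_compose[OF _ _ _ tgt.smooth_inD[OF G(1) d], where F = "\<lambda>q. coord d (f q)"])
  show "open (f -` (U \<inter> dom_chart d))" using G(2) tgt.chart_homeomorphism(1)[OF d] by (intro open_preimage open_Int)
  show "smooth_in A (f -` (U \<inter> dom_chart d)) (\<lambda>q. coord d (f q))"
    by (rule src.smooth_in_subset[OF smooth_in_coord_map[OF d]]) auto
qed auto

lemma smooth_in_pullback:
  assumes G: "smooth_in B U G" "open U"
  shows "smooth_in A (f -` U) (\<lambda>q. G (f q))"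
proof (rule src.smooth_in_local)
  fix p assume p: "p \<in> f -` U"
  let ?d = "chart_at B (f p)" and ?V = "f -` (U \<inter> dom_chart (chart_at B (f p)))"
  have o: "open ?V"
    using G(2) tgt.chart_homeomorphism(1)[OF tgt.chart_at(1)] by (intro open_preimage open_Int)
  have "smooth_in A ?V (\<lambda>q. G (f q))"
    by (rule src.smooth_in_cong[OF smooth_in_pullback_chart[OF tgt.chart_at(1) G] o])
      (use tgt.chart_homeomorphism(5)[OF tgt.chart_at(1)] in auto)
  then show "\<exists>V. open V \<and> p \<in> V \<and> smooth_in A V (\<lambda>q. G (f q))" using o p tgt.chart_at(2) by blast
qed

lemma differential_component:
  "d \<in> B \<Longrightarrow> f p \<in> dom_chart d \<Longrightarrow> differential A B f p v d = dir_deriv A (\<lambda>q. coord d (f q)) p v"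
  by (simp add: differential_def o_def)

lemma dir_deriv_pullback:
  assumes G: "smooth_in B U G" "open U" and p: "f p \<in> U"
  shows "dir_deriv A (\<lambda>q. G (f q)) p v = dir_deriv B G (f p) (differential A B f p v)"
proof -
  let ?d = "chart_at B (f p)" and ?V = "f -` (U \<inter> dom_chart (chart_at B (f p)))"
  have o: "open ?V"
    using G(2) tgt.chart_homeomorphism(1)[OF tgt.chart_at(1)] by (intro open_preimage open_Int)
  have pV: "p \<in> ?V" using p tgt.chart_at(2) by blast
  have "dir_deriv A (\<lambda>q. G (f q)) p v = dir_deriv A (\<lambda>q. G (chart_inv ?d (coord ?d (f q)))) p v"
    by (rule src.dir_deriv_cong[OF smooth_in_pullback_chart[OF tgt.chart_at(1) G] o pV, symmetric])
      (use tgt.chart_homeomorphism(5)[OF tgt.chart_at(1)] in auto)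
  also have "\<dots> = frechet_derivative (\<lambda>x. G (chart_inv ?d x)) (at (coord ?d (f p)))
      (dir_deriv A (\<lambda>q. coord ?d (f q)) p v)"
    by (rule src.dir_deriv_compose[OF smooth_in_coord_map[OF tgt.chart_at(1)]])
      (use tgt.chart_at tgt.smooth_in_differentiable[OF G(1) tgt.chart_at p] in auto)
  finally show ?thesis by (simp add: tgt.dir_deriv_chart_at differential_component tgt.chart_at)
qed

lemma differential_tangent: "differential A B f p v \<in> tangent_space B (f p)"
proof (rule tgt.tangentI[OF tgt.chart_at])
  fix d assume d: "d \<in> B" "f p \<in> dom_chart d"
  show "differential A B f p v d = frechet_derivative (\<lambda>x. coord d (chart_inv (chart_at B (f p)) x))
     (at (coord (chart_at B (f p)) (f p))) (differential A B f p v (chart_at B (f p)))"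
    using dir_deriv_pullback[OF tgt.smooth_in_coord[OF d(1)] tgt.chart_homeomorphism(1)[OF d(1)] d(2)]
    by (simp add: differential_component[OF d] tgt.dir_deriv_chart_at)
qed (auto simp: differential_def)

lemma differential_lincomb:
  "differential A B f p (\<lambda>c. a *\<^sub>R v c + b *\<^sub>R w c) = (\<lambda>c. a *\<^sub>R differential A B f p v c + b *\<^sub>R differential A B f p w c)"
proof
  fix d show "differential A B f p (\<lambda>c. a *\<^sub>R v c + b *\<^sub>R w c) d = a *\<^sub>R differential A B f p v d + b *\<^sub>R differential A B f p w d"
  proof (cases "d \<in> B \<and> f p \<in> dom_chart d")
    case True
    then show ?thesis using src.dir_deriv_linear[OF smooth_in_coord_map, of d p a v b w] by (simp add: differential_component)
  qed (auto simp: differential_def)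
qed

lemma field_along_iff:
  "smooth_field_along A B f V \<longleftrightarrow>
     (\<forall>p. V p \<in> tangent_space B (f p)) \<and> (\<forall>d\<in>B. smooth_in A (f -` dom_chart d) (\<lambda>q. V q d))"
  by (auto simp: smooth_field_along_def smooth_in_def)

lemma differential_field:
  assumes X: "X \<in> vector_fields A"
  shows "smooth_field_along A B f (\<lambda>q. differential A B f q (X q))"
  unfolding field_along_iff
proof (intro conjI allI ballI differential_tangent)
  fix d assume d: "d \<in> B"
  show "smooth_in A (f -` dom_chart d) (\<lambda>q. differential A B f q (X q) d)"
    by (rule src.smooth_in_cong[OF src.smooth_in_dir_deriv[OF X smooth_in_coord_map[OF d] open_dom_preimage[OF d]]
          open_dom_preimage[OF d]]) (use d in \<open>auto simp: differential_component\<close>)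
qed

lemma vector_field_pullback:
  assumes X: "X \<in> vector_fields B"
  shows "smooth_field_along A B f (\<lambda>q. X (f q))"
  unfolding field_along_iff
proof (intro conjI allI ballI)
  fix d assume d: "d \<in> B"
  show "smooth_in A (f -` dom_chart d) (\<lambda>q. X (f q) d)"
    by (rule smooth_in_pullback[OF _ tgt.chart_homeomorphism(1)[OF d]]) (use X d in \<open>auto simp: tgt.vector_field_iff\<close>)
qed (rule tgt.vector_field_tangent[OF X])

lemma field_along_coord_field:
  assumes V: "smooth_field_along A B f V" and c: "c \<in> B" "f q \<in> dom_chart c"
  shows "coord_field B c (V q c) (f q) = V q"
  using V c by (intro tgt.coord_field_eq) (auto simp: field_along_iff)

lemma field_along_scaleR:
  assumes V: "smooth_field_along A B f V" and h: "smooth_in A UNIV h"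
  shows "smooth_field_along A B f (\<lambda>q c. h q *\<^sub>R V q c)"
  using V unfolding field_along_iff
  by (auto intro!: tgt.tangent_scaleR src.smooth_in_scaleR open_dom_preimage src.smooth_in_subset[OF h])

lemma field_along_add:
  assumes V: "smooth_field_along A B f V" and W: "smooth_field_along A B f W"
  shows "smooth_field_along A B f (\<lambda>q c. V q c + W q c)"
  using V W unfolding field_along_iff
  by (auto intro!: tgt.tangent_add src.smooth_in_add open_dom_preimage)

end

lemma smooth_map_compose:
  assumes "smooth_manifold_map A B f" "smooth_manifold_map B C h"
  shows "smooth_manifold_map A C (\<lambda>x. h (f x))"
proof -
  interpret f: smooth_manifold_map A B f by fact
  interpret h: smooth_manifold_map B C h by fact
  have "smooth_map A C (\<lambda>x. h (f x))"
    unfolding smooth_map_def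
  proof (intro conjI ballI)
    show "continuous_on UNIV (\<lambda>x. h (f x))"
      using f.smooth h.smooth unfolding smooth_map_def by (auto intro: continuous_on_compose2)
    fix c d assume c: "c \<in> A" and d: "d \<in> C"
    have "smooth_in A (f -` (h -` dom_chart d)) (\<lambda>q. coord d (h (f q)))"
      by (rule f.smooth_in_pullback[OF h.smooth_in_coord_map[OF d] h.open_dom_preimage[OF d]])
    then show "smooth_on (coord c ` (dom_chart c \<inter> (\<lambda>x. h (f x)) -` dom_chart d)) (coord d \<circ> (\<lambda>x. h (f x)) \<circ> chart_inv c)"
      using c by (simp add: smooth_in_def o_def vimage_def)
  qed
  then show ?thesis by unfold_locales
qed

lemma differential_compose:
  assumes "smooth_manifold_map A B f" "smooth_manifold_map B C h"
  shows "differential A C (\<lambda>x. h (f x)) p v = differential B C h (f p) (differential A B f p v)"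
proof -
  interpret f: smooth_manifold_map A B f by fact
  interpret h: smooth_manifold_map B C h by fact
  interpret hf: smooth_manifold_map A C "\<lambda>x. h (f x)" by (rule smooth_map_compose[OF assms])
  show ?thesis
  proof
    fix d
    show "differential A C (\<lambda>x. h (f x)) p v d = differential B C h (f p) (differential A B f p v) d"
    proof (cases "d \<in> C \<and> h (f p) \<in> dom_chart d")
      case True
      then show ?thesis
        using f.dir_deriv_pullback[OF h.smooth_in_coord_map h.open_dom_preimage, of d p v]
        by (simp add: hf.differential_component h.differential_component)
    qed (auto simp: differential_def)
  qed
qed

subsection \<open>Lorentzian metrics and the Levi-Civita connection\<close>

text \<open>The Minkowski form written as the Euclidean inner product with one sign reversed, so
  that the Euclidean Cauchy-Schwarz inequality becomes applicable.\<close>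

lemma lorentz_form_normal_form:
  fixes B :: "'e::euclidean_space \<Rightarrow> 'e \<Rightarrow> real"
  assumes "lorentz_form B"
  shows "\<exists>b\<in>Basis. \<exists>L :: 'e \<Rightarrow> 'e. linear L \<and> bij L \<and> (\<forall>u v. B (L u) (L v) = u \<bullet> v - 2 * (u \<bullet> b) * (v \<bullet> b))"
proof -
  from assms obtain b and L :: "'e \<Rightarrow> 'e" where bil: "bilinear B" and b: "b \<in> Basis" and L: "linear L" "bij L"
    and BL: "\<forall>i\<in>Basis. \<forall>j\<in>Basis. B (L i) (L j) = (if i \<noteq> j then 0 else if i = b then -1 else 1)"
    unfolding lorentz_form_def by blast
  have "B (L u) (L v) = u \<bullet> v - 2 * (u \<bullet> b) * (v \<bullet> b)" for u v
  proof -
    have l1: "linear (\<lambda>u. B (L u) z)" for z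
      using linear_compose[OF L(1) bilinear_linear(2)[OF bil]] by (simp add: o_def)
    have l2: "linear (\<lambda>v. B z (L v))" for z
      using linear_compose[OF L(1) bilinear_linear(1)[OF bil]] by (simp add: o_def)
    have 1: "B (L i) (L v) = (v \<bullet> i) * (if i = b then -1 else 1)" if i: "i \<in> Basis" for i
    proof -
      have "B (L i) (L v) = (\<Sum>j\<in>Basis. (v \<bullet> j) * B (L i) (L j))" using linear_expand[OF l2[of "L i"], of v] by simp
      also have "\<dots> = (\<Sum>j\<in>Basis. if j = i then (v \<bullet> i) * (if i = b then -1 else 1) else 0)"
        by (rule sum.cong[OF refl]) (use BL i in auto)
      finally show ?thesis using i by simp
    qed
    have "B (L u) (L v) = (\<Sum>i\<in>Basis. (u \<bullet> i) * B (L i) (L v))" using linear_expand[OF l1[of "L v"], of u] by simp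
    also have "\<dots> = (\<Sum>i\<in>Basis. (u \<bullet> i) * (v \<bullet> i) - (if i = b then 2 * (u \<bullet> b) * (v \<bullet> b) else 0))"
      by (rule sum.cong[OF refl]) (use 1 in auto)
    also have "\<dots> = u \<bullet> v - 2 * (u \<bullet> b) * (v \<bullet> b)"
      using b euclidean_inner[of u v] by (simp add: sum_subtractf)
    finally show ?thesis .
  qed
  then show ?thesis using b L by blast
qed

lemma lorentz_form_nondegenerate:
  fixes B :: "'e::euclidean_space \<Rightarrow> 'e \<Rightarrow> real"
  assumes "lorentz_form B" "\<And>v. B u v = 0"
  shows "u = 0"
proof -
  obtain b and L :: "'e \<Rightarrow> 'e" where L: "b \<in> Basis" "linear L" "bij L" "\<And>u v. B (L u) (L v) = u \<bullet> v - 2 * (u \<bullet> b) * (v \<bullet> b)"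
    using lorentz_form_normal_form[OF assms(1)] by blast
  obtain a where a: "u = L a" using bij_is_surj[OF L(3)] unfolding surj_def by blast
  have "a \<bullet> v = 2 * (a \<bullet> b) * (v \<bullet> b)" for v using L(4)[of a v] assms(2)[of "L v"] a by simp
  \<comment> \<open>Testing with \<open>b\<close> gives
    \<open>a \<bullet> b = 2 * (a \<bullet> b)\<close>, which kills the timelike component; testing
    with \<open>a\<close> then kills the rest.\<close>
  from this[of b] have ab: "a \<bullet> b = 0" using L(1) by (simp add: inner_Basis)
  from \<open>a \<bullet> a = 2 * (a \<bullet> b) * (a \<bullet> b)\<close> ab have "a = 0" by simp
  then show ?thesis using a L(2) by (simp add: linear_0)
qed

text \<open>Compare spatial parts: for a null vector the spatial length equals the time component in
  size, for a timelike one it is strictly smaller, and orthogonality makes the spatial product equal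
  to the product of the time components. Cauchy-Schwarz then leaves only a zero time
  component.\<close>

lemma lorentz_form_null_orthogonal_timelike:
  fixes B :: "'e::euclidean_space \<Rightarrow> 'e \<Rightarrow> real"
  assumes "lorentz_form B" "B u u = 0" "B t t < 0" "B u t = 0"
  shows "u = 0"
proof -
  obtain b and L :: "'e \<Rightarrow> 'e" where L: "b \<in> Basis" "linear L" "bij L" "\<And>u v. B (L u) (L v) = u \<bullet> v - 2 * (u \<bullet> b) * (v \<bullet> b)"
    using lorentz_form_normal_form[OF assms(1)] by blast
  obtain a where a: "u = L a" using bij_is_surj[OF L(3)] unfolding surj_def by blast
  obtain c where c: "t = L c" using bij_is_surj[OF L(3)] unfolding surj_def by blast
  have bb: "b \<bullet> b = 1" using L(1) by (simp add: inner_Basis)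
  have 1: "a \<bullet> a = 2 * (a \<bullet> b)\<^sup>2" "a \<bullet> c = 2 * (a \<bullet> b) * (c \<bullet> b)" "c \<bullet> c < 2 * (c \<bullet> b)\<^sup>2"
    using assms(2-4) unfolding a c L(4) by (auto simp: power2_eq_square)
  let ?a = "a - (a \<bullet> b) *\<^sub>R b" and ?c = "c - (c \<bullet> b) *\<^sub>R b"
  have i: "(x - (x \<bullet> b) *\<^sub>R b) \<bullet> (y - (y \<bullet> b) *\<^sub>R b) = x \<bullet> y - (x \<bullet> b) * (y \<bullet> b)" for x y
    using bb by (simp add: inner_diff_left inner_diff_right inner_commute[of b y] algebra_simps)
  have "(?a \<bullet> ?c)\<^sup>2 \<le> (?a \<bullet> ?a) * (?c \<bullet> ?c)" by (rule Cauchy_Schwarz_ineq)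
  then have "(a \<bullet> b)\<^sup>2 * (c \<bullet> b)\<^sup>2 \<le> (a \<bullet> b)\<^sup>2 * (c \<bullet> c - (c \<bullet> b)\<^sup>2)"
    unfolding i using 1(1,2) by (simp add: power2_eq_square mult_ac)
  moreover have "(a \<bullet> b)\<^sup>2 * (c \<bullet> c - (c \<bullet> b)\<^sup>2) < (a \<bullet> b)\<^sup>2 * (c \<bullet> b)\<^sup>2" if "a \<bullet> b \<noteq> 0"
    using 1(3) that by (intro mult_strict_left_mono) auto
  ultimately have "a \<bullet> b = 0" by (meson not_le)
  then have "a = 0" using 1(1) by simp
  then show ?thesis using a L(2) by (simp add: linear_0)
qed

text \<open>Nondegeneracy makes the Gram map injective, hence surjective in finite
  dimension.\<close>

lemma bilinear_form_represents:
  fixes B :: "'e::euclidean_space \<Rightarrow> 'e \<Rightarrow> real"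
  assumes B: "bilinear B" and nd: "\<And>u. (\<And>v. B u v = 0) \<Longrightarrow> u = 0" and \<alpha>: "linear \<alpha>"
  shows "\<exists>x. \<forall>z. B x z = \<alpha> z"
proof -
  let ?L = "\<lambda>u. \<Sum>b\<in>Basis. B u b *\<^sub>R b"
  have lin: "linear ?L"
    by (rule linearI)
      (auto simp: linear_add[OF bilinear_linear(2)[OF B]] linear_scale[OF bilinear_linear(2)[OF B]]
        scaleR_add_left sum.distrib scaleR_sum_right)
  have coef: "?L u \<bullet> b = B u b" if "b \<in> Basis" for u b
    using that by (simp add: inner_sum_left inner_Basis sum.delta if_distrib cong: if_cong)
  have "inj ?L"
  proof (subst linear_injective_0[OF lin], intro allI impI)
    fix u assume "?L u = 0"
    then have "B u b = 0" if "b \<in> Basis" for b using coef[OF that, of u] by simp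
    then have "B u v = 0" for v using linear_expand[OF bilinear_linear(1)[OF B], of u v] by simp
    then show "u = 0" by (rule nd)
  qed
  then have "surj ?L" by (rule linear_inj_imp_surj[OF lin])
  then obtain x where x: "(\<Sum>b\<in>Basis. \<alpha> b *\<^sub>R b) = ?L x" unfolding surj_def by blast
  have "B x b = \<alpha> b" if "b \<in> Basis" for b
    using coef[OF that, of x] that unfolding x[symmetric]
    by (simp add: inner_sum_left inner_Basis sum.delta if_distrib cong: if_cong)
  then have "B x z = \<alpha> z" for z
    using linear_expand[OF bilinear_linear(1)[OF B], of x z] linear_expand[OF \<alpha>, of z] by simp
  then show ?thesis by blast
qed

context smooth_manifold
begin

lemma coord_field_linear:
  assumes c: "c \<in> A" "p \<in> dom_chart c"
  shows "linear (\<lambda>u. coord_field A c u p d)"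
proof (cases "d \<in> A \<and> p \<in> dom_chart d")
  case True
  have "linear (frechet_derivative (\<lambda>x. coord d (chart_inv c x)) (at (coord c p)))"
    by (rule has_derivative_linear[OF smooth_on_has_derivative[OF transition_smooth[OF c(1)]]]) (use True c in auto)
  then show ?thesis using True by (simp add: coord_field_component)
next
  case False
  then have "(\<lambda>u. coord_field A c u p d) = (\<lambda>u. 0)" by (auto simp: coord_field_def)
  then show ?thesis by (simp add: module_hom_zero)
qed

lemma smooth_in_coord_field:
  assumes c: "c \<in> A" and d: "d \<in> A"
  shows "smooth_in A (dom_chart c \<inter> dom_chart d) (\<lambda>q. coord_field A c u q d)"
proof (rule smooth_in_chartI[OF c])
  show o: "open (dom_chart c \<inter> dom_chart d)"
    using chart_homeomorphism(1)[OF c] chart_homeomorphism(1)[OF d] by (rule open_Int)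
  have "open (coord c ` (dom_chart c \<inter> dom_chart d))" by (rule open_coord_image[OF c chart_homeomorphism(1)[OF d]])
  then show "smooth_on (coord c ` (dom_chart c \<inter> dom_chart d)) (\<lambda>x. coord_field A c u (chart_inv c x) d)"
    by (rule smooth_on_cong[OF smooth_on_frechet[OF transition_smooth[OF c d]]])
      (use d in_coord_imageD[OF c] in \<open>auto simp: coord_field_component\<close>)
qed auto

lemma dir_deriv_coord_field:
  assumes F: "smooth_in A U F" "open U" "p \<in> U" and c: "c \<in> A" "p \<in> dom_chart c"
  shows "dir_deriv A F p (coord_field A c u p) = frechet_derivative (\<lambda>x. F (chart_inv c x)) (at (coord c p)) u"
  using dir_deriv_chart[OF F c coord_field_tangent[OF c]] coord_field_self[OF c] by simp

lemma dir_deriv_family_linear: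
  fixes L :: "'a \<Rightarrow> 'b::euclidean_space \<Rightarrow> 'c::real_normed_vector"
  assumes "open U" "p \<in> U" "\<And>q. q \<in> U \<Longrightarrow> linear (L q)" "\<And>w. smooth_in A U (\<lambda>q. L q w)"
  shows "linear (\<lambda>w. dir_deriv A (\<lambda>q. L q w) p x)"
  unfolding dir_deriv_chart_at
  by (rule linear_frechet_family[OF open_coord_image[OF chart_at(1) assms(1)],
        where L = "\<lambda>x. L (chart_inv (chart_at A p) x)"])
    (use assms chart_at in_coord_imageD(2)[OF chart_at(1)] smooth_in_differentiable[OF assms(4) chart_at assms(2)] in auto)

text \<open>Both sides are second derivatives of the chart change from \<open>c\<close> to
  \<open>d\<close>. Geometrically this says that coordinate fields commute; it also makes the
  inhomogeneous term in the change of Christoffel forms symmetric.\<close>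

lemma hessian_symmetric:
  assumes c: "c \<in> A" "p \<in> dom_chart c" and d: "d \<in> A" "p \<in> dom_chart d"
  shows "dir_deriv A (\<lambda>q. coord_field A c u q d) p (coord_field A c v p) =
     dir_deriv A (\<lambda>q. coord_field A c v q d) p (coord_field A c u p)"
proof -
  let ?U = "dom_chart c \<inter> dom_chart d"
  have o: "open ?U" using chart_homeomorphism(1)[OF c(1)] chart_homeomorphism(1)[OF d(1)] by (rule open_Int)
  have oW: "open (coord c ` ?U)" by (rule open_coord_image[OF c(1) chart_homeomorphism(1)[OF d(1)]])
  have pU: "p \<in> ?U" using c d by auto
  then have pW: "coord c p \<in> coord c ` ?U" by blast
  let ?\<phi> = "\<lambda>x. coord d (chart_inv c x)"
  have *: "dir_deriv A (\<lambda>q. coord_field A c u q d) p (coord_field A c v p) =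
      frechet_derivative (\<lambda>x. frechet_derivative ?\<phi> (at x) u) (at (coord c p)) v" for u v
  proof -
    have "((\<lambda>x. coord_field A c u (chart_inv c x) d) has_derivative
        frechet_derivative (\<lambda>x. frechet_derivative ?\<phi> (at x) u) (at (coord c p))) (at (coord c p))"
      by (rule has_derivative_transform_within_open[OF smooth_on_has_derivative[OF smooth_on_frechet[OF
              transition_smooth[OF c(1) d(1)]] pW] oW pW])
        (use d in_coord_imageD[OF c(1)] in \<open>auto simp: coord_field_component\<close>)
    from frechet_derivative_eqI[OF this] show ?thesis
      using dir_deriv_coord_field[OF smooth_in_coord_field[OF c(1) d(1)] o pU c] by simp
  qed
  show ?thesis unfolding * by (rule second_derivative_symmetric[OF transition_smooth[OF c(1) d(1)] oW pW])
qed

end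

section \<open>Metric components and the Christoffel form\<close>

locale lorentz_manifold = smooth_manifold M
  for M :: "('m::{t2_space, second_countable_topology}, 'e::euclidean_space) chart set" +
  fixes g :: "('m, 'e) metric"
  assumes metric: "lorentz_metric M g"
begin

abbreviation mc where "mc \<equiv> metric_comp M g"

lemma metric_lorentz: "c \<in> M \<Longrightarrow> p \<in> dom_chart c \<Longrightarrow> lorentz_form (mc c p)"
  using metric by (auto simp: lorentz_metric_def)

lemma mc_bilinear: "c \<in> M \<Longrightarrow> p \<in> dom_chart c \<Longrightarrow> bilinear (mc c p)"
  and mc_sym: "c \<in> M \<Longrightarrow> p \<in> dom_chart c \<Longrightarrow> mc c p u v = mc c p v u"
  using metric_lorentz unfolding lorentz_form_def by blast+

lemma mc_nondegenerate: "c \<in> M \<Longrightarrow> p \<in> dom_chart c \<Longrightarrow> (\<And>v. mc c p u v = 0) \<Longrightarrow> u = 0"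
  using lorentz_form_nondegenerate[OF metric_lorentz] by blast

lemma mc_add_left: "c \<in> M \<Longrightarrow> p \<in> dom_chart c \<Longrightarrow> mc c p (u + v) w = mc c p u w + mc c p v w"
  and mc_add_right: "c \<in> M \<Longrightarrow> p \<in> dom_chart c \<Longrightarrow> mc c p w (u + v) = mc c p w u + mc c p w v"
  and mc_scale_left: "c \<in> M \<Longrightarrow> p \<in> dom_chart c \<Longrightarrow> mc c p (a *\<^sub>R u) w = a * mc c p u w"
  and mc_scale_right: "c \<in> M \<Longrightarrow> p \<in> dom_chart c \<Longrightarrow> mc c p w (a *\<^sub>R u) = a * mc c p w u"
  using linear_add[OF bilinear_linear(1)[OF mc_bilinear]] linear_add[OF bilinear_linear(2)[OF mc_bilinear]]
    linear_scale[OF bilinear_linear(1)[OF mc_bilinear]] linear_scale[OF bilinear_linear(2)[OF mc_bilinear]] by auto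

lemma smooth_in_mc: "c \<in> M \<Longrightarrow> smooth_in M (dom_chart c) (\<lambda>q. mc c q u v)"
  using metric by (intro smooth_in_chartI chart_homeomorphism(1)) (auto simp: lorentz_metric_def)

lemma metric_in_chart:
  assumes "v \<in> tangent_space M p" "w \<in> tangent_space M p" "c \<in> M" "p \<in> dom_chart c"
  shows "g p v w = mc c p (v c) (w c)"
  using assms by (simp add: metric_comp_def coord_field_eq)

lemma mc_transform:
  assumes "c \<in> M" "p \<in> dom_chart c" "d \<in> M" "p \<in> dom_chart d"
  shows "mc c p u v = mc d p (coord_field M c u p d) (coord_field M c v p d)"
  using metric_in_chart[OF coord_field_tangent[OF assms(1,2), of u] coord_field_tangent[OF assms(1,2), of v] assms(3,4)]
  by (simp add: metric_comp_def)

lemma metric_sym: "v \<in> tangent_space M p \<Longrightarrow> w \<in> tangent_space M p \<Longrightarrow> g p v w = g p w v"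
  using metric_in_chart[OF _ _ chart_at] mc_sym[OF chart_at] by simp

lemma metric_lincomb:
  assumes "u \<in> tangent_space M p" "v \<in> tangent_space M p" "w \<in> tangent_space M p"
  shows "g p (\<lambda>c. a *\<^sub>R u c + b *\<^sub>R v c) w = a * g p u w + b * g p v w"
  using assms
  by (simp add: metric_in_chart[OF _ _ chart_at] tangent_lincomb mc_add_left[OF chart_at] mc_scale_left[OF chart_at])

definition metric_deriv :: "('m, 'e) chart \<Rightarrow> 'm \<Rightarrow> 'e \<Rightarrow> 'e \<Rightarrow> 'e \<Rightarrow> real" where
  "metric_deriv c p w u v = dir_deriv M (\<lambda>q. mc c q u v) p (coord_field M c w p)"

text \<open>The Christoffel symbols of the first kind, as in the Koszul formula for commuting
  fields.\<close>

definition koszul :: "('m, 'e) chart \<Rightarrow> 'm \<Rightarrow> 'e \<Rightarrow> 'e \<Rightarrow> 'e \<Rightarrow> real" where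
  "koszul c p u v z = (metric_deriv c p u v z + metric_deriv c p v u z - metric_deriv c p z u v) / 2"

lemma metric_deriv_sym:
  assumes c: "c \<in> M" "p \<in> dom_chart c"
  shows "metric_deriv c p w u v = metric_deriv c p w v u"
  unfolding metric_deriv_def
  by (rule dir_deriv_cong[OF smooth_in_mc[OF c(1)] chart_homeomorphism(1)[OF c(1)] c(2)]) (rule mc_sym[OF c(1)])

lemma metric_deriv_frechet:
  assumes c: "c \<in> M" "p \<in> dom_chart c"
  shows "metric_deriv c p w u v = frechet_derivative (\<lambda>x. mc c (chart_inv c x) u v) (at (coord c p)) w"
  unfolding metric_deriv_def by (rule dir_deriv_coord_field[OF smooth_in_mc[OF c(1)] chart_homeomorphism(1)[OF c(1)] c(2) c])

lemma metric_deriv_linear: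
  assumes c: "c \<in> M" "p \<in> dom_chart c"
  shows "linear (\<lambda>w. metric_deriv c p w u v)" "linear (\<lambda>u. metric_deriv c p w u v)" "linear (\<lambda>v. metric_deriv c p w u v)"
proof -
  show "linear (\<lambda>w. metric_deriv c p w u v)"
    unfolding metric_deriv_frechet[OF c]
    by (rule has_derivative_linear[OF frechetI[OF smooth_in_differentiable[OF smooth_in_mc[OF c(1)] c c(2)]]])
  show *: "linear (\<lambda>v. metric_deriv c p w u v)" for u
    unfolding metric_deriv_def
    by (rule dir_deriv_family_linear[where L = "\<lambda>q. mc c q u", OF chart_homeomorphism(1)[OF c(1)] c(2) _ smooth_in_mc[OF c(1)]])
      (use bilinear_linear(1)[OF mc_bilinear[OF c(1)]] in blast)
  show "linear (\<lambda>u. metric_deriv c p w u v)" using *[of v] metric_deriv_sym[OF c, of w] by simp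
qed

lemma koszul_linear:
  assumes c: "c \<in> M" "p \<in> dom_chart c"
  shows "linear (koszul c p u v)" "linear (\<lambda>u. koszul c p u v z)" "linear (\<lambda>v. koszul c p u v z)"
  unfolding koszul_def
  by (auto intro!: linearI simp: linear_add[OF metric_deriv_linear(1)[OF c]] linear_scale[OF metric_deriv_linear(1)[OF c]]
      linear_add[OF metric_deriv_linear(2)[OF c]] linear_scale[OF metric_deriv_linear(2)[OF c]]
      linear_add[OF metric_deriv_linear(3)[OF c]] linear_scale[OF metric_deriv_linear(3)[OF c]] field_simps)

text \<open>The property under the description operator in \<open>christoffel\<close>, with the
  derivative of the metric abbreviated.\<close>

definition is_connection_form :: "('m, 'e) chart \<Rightarrow> 'm \<Rightarrow> ('e \<Rightarrow> 'e \<Rightarrow> 'e) \<Rightarrow> bool" where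
  "is_connection_form c p \<Gamma> \<longleftrightarrow> (\<forall>u v. \<Gamma> u v = \<Gamma> v u) \<and>
     (\<forall>u v w. metric_deriv c p w u v = mc c p (\<Gamma> w u) v + mc c p u (\<Gamma> w v))"

text \<open>In the alternating sum of the compatibility equation over its three arguments, symmetry
  of \<open>\<Gamma>\<close> leaves two equal terms.\<close>

lemma is_connection_form_koszul:
  assumes c: "c \<in> M" "p \<in> dom_chart c" and \<Gamma>: "is_connection_form c p \<Gamma>"
  shows "mc c p (\<Gamma> u v) z = koszul c p u v z"
proof -
  have s: "\<Gamma> u v = \<Gamma> v u" for u v using \<Gamma> by (auto simp: is_connection_form_def)
  have d: "metric_deriv c p w u v = mc c p (\<Gamma> w u) v + mc c p u (\<Gamma> w v)" for u v w
    using \<Gamma> by (auto simp: is_connection_form_def)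
  show ?thesis
    unfolding koszul_def d using s[of v u] s[of z u] s[of z v]
    by (simp add: mc_sym[OF c, of v] mc_sym[OF c, of u] mc_sym[OF c, of z])
qed

lemma is_connection_form_unique:
  assumes c: "c \<in> M" "p \<in> dom_chart c" and "is_connection_form c p \<Gamma>" "is_connection_form c p \<Gamma>'"
  shows "\<Gamma> = \<Gamma>'"
proof (intro ext)
  fix u v
  have "mc c p (\<Gamma> u v - \<Gamma>' u v) z = 0" for z
    using is_connection_form_koszul[OF c assms(3)] is_connection_form_koszul[OF c assms(4)]
      linear_diff[OF bilinear_linear(2)[OF mc_bilinear[OF c]]] by simp
  then have "\<Gamma> u v - \<Gamma>' u v = 0" by (rule mc_nondegenerate[OF c])
  then show "\<Gamma> u v = \<Gamma>' u v" by simp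
qed

lemma is_connection_form_exists:
  assumes c: "c \<in> M" "p \<in> dom_chart c"
  shows "\<exists>\<Gamma>. is_connection_form c p \<Gamma>"
proof -
  have "\<exists>x. \<forall>z. mc c p x z = koszul c p u v z" for u v
    by (rule bilinear_form_represents[OF mc_bilinear[OF c] mc_nondegenerate[OF c] koszul_linear(1)[OF c]])
  then obtain \<Gamma> where \<Gamma>: "\<And>u v z. mc c p (\<Gamma> u v) z = koszul c p u v z" by metis
  have "\<Gamma> u v = \<Gamma> v u" for u v
  proof -
    have "mc c p (\<Gamma> u v - \<Gamma> v u) z = 0" for z
      by (simp add: linear_diff[OF bilinear_linear(2)[OF mc_bilinear[OF c]]] \<Gamma> koszul_def
          metric_deriv_sym[OF c, of z u v])
    then have "\<Gamma> u v - \<Gamma> v u = 0" by (rule mc_nondegenerate[OF c])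
    then show ?thesis by simp
  qed
  moreover have "metric_deriv c p w u v = mc c p (\<Gamma> w u) v + mc c p u (\<Gamma> w v)" for u v w
    unfolding mc_sym[OF c, of u] \<Gamma> koszul_def
    using metric_deriv_sym[OF c, of w u v] metric_deriv_sym[OF c, of u w v] metric_deriv_sym[OF c, of v w u]
    by (simp add: field_simps)
  ultimately show ?thesis unfolding is_connection_form_def by blast
qed

abbreviation chr where "chr \<equiv> christoffel M g"

lemma christoffel_connection_form:
  assumes c: "c \<in> M" "p \<in> dom_chart c"
  shows "is_connection_form c p (chr c p)"
proof -
  have "chr c p = (THE \<Gamma>. is_connection_form c p \<Gamma>)"
    by (simp add: christoffel_def is_connection_form_def metric_deriv_def)
  moreover have "is_connection_form c p (THE \<Gamma>. is_connection_form c p \<Gamma>)"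
    using is_connection_form_exists[OF c] is_connection_form_unique[OF c] by (metis theI)
  ultimately show ?thesis by simp
qed

lemma christoffel_eqI: "c \<in> M \<Longrightarrow> p \<in> dom_chart c \<Longrightarrow> is_connection_form c p \<Gamma> \<Longrightarrow> chr c p = \<Gamma>"
  by (rule is_connection_form_unique[OF _ _ christoffel_connection_form])

lemma christoffel_sym: "c \<in> M \<Longrightarrow> p \<in> dom_chart c \<Longrightarrow> chr c p u v = chr c p v u"
  using christoffel_connection_form by (simp add: is_connection_form_def)

lemma metric_deriv_christoffel:
  "c \<in> M \<Longrightarrow> p \<in> dom_chart c \<Longrightarrow> metric_deriv c p w u v = mc c p (chr c p w u) v + mc c p u (chr c p w v)"
  using christoffel_connection_form by (simp add: is_connection_form_def)

lemma christoffel_koszul: "c \<in> M \<Longrightarrow> p \<in> dom_chart c \<Longrightarrow> mc c p (chr c p u v) z = koszul c p u v z"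
  by (rule is_connection_form_koszul[OF _ _ christoffel_connection_form])

text \<open>\<open>christoffel\<close> is described as a bare function of two vectors; linearity is
  recovered from the Koszul expression by nondegeneracy of the metric.\<close>

lemma christoffel_bilinear:
  assumes c: "c \<in> M" "p \<in> dom_chart c"
  shows "bilinear (chr c p)"
proof -
  have l: "linear (\<lambda>u. chr c p u v)" for v
  proof (rule linearI)
    fix x y and r :: real
    have "mc c p (chr c p (x + y) v - (chr c p x v + chr c p y v)) z = 0" for z
      using linear_diff[OF bilinear_linear(2)[OF mc_bilinear[OF c]]] linear_add[OF koszul_linear(2)[OF c]]
      by (simp add: christoffel_koszul[OF c] mc_add_left[OF c])
    from mc_nondegenerate[OF c this] show "chr c p (x + y) v = chr c p x v + chr c p y v" by simp
    have "mc c p (chr c p (r *\<^sub>R x) v - r *\<^sub>R chr c p x v) z = 0" for z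
      using linear_diff[OF bilinear_linear(2)[OF mc_bilinear[OF c]]] linear_scale[OF koszul_linear(2)[OF c]]
      by (simp add: christoffel_koszul[OF c] mc_scale_left[OF c])
    from mc_nondegenerate[OF c this] show "chr c p (r *\<^sub>R x) v = r *\<^sub>R chr c p x v" by simp
  qed
  moreover have "linear (chr c p v)" for v
  proof -
    have "chr c p v = (\<lambda>u. chr c p u v)" by (rule ext) (rule christoffel_sym[OF c])
    then show ?thesis using l by simp
  qed
  ultimately show ?thesis using l by (simp add: bilinear_def)
qed

lemma smooth_in_christoffel:
  assumes c: "c \<in> M"
  shows "smooth_in M (dom_chart c) (\<lambda>q. chr c q u v)"
proof (rule smooth_in_chartI[OF c chart_homeomorphism(1)[OF c] order_refl])
  note ch = chart_homeomorphism[OF c]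
  let ?S = "coord c ` dom_chart c"
  have smc: "smooth_on ?S (\<lambda>x. mc c (chart_inv c x) u v)" for u v
    using metric c by (auto simp: lorentz_metric_def)
  have smd: "smooth_on ?S (\<lambda>x. metric_deriv c (chart_inv c x) w u v)" for u v w
    by (rule smooth_on_cong[OF smooth_on_frechet[OF smc] ch(2)]) (use ch(6,7) in \<open>auto simp: metric_deriv_frechet[OF c]\<close>)
  show "smooth_on ?S (\<lambda>x. chr c (chart_inv c x) u v)"
  proof (rule smooth_on_bilinear_system[where B = "\<lambda>x. mc c (chart_inv c x)"
        and \<alpha> = "\<lambda>x. koszul c (chart_inv c x) u v", OF ch(2)])
    show "smooth_on ?S (\<lambda>x. koszul c (chart_inv c x) u v z)" for z
      unfolding koszul_def divide_inverse
      by (intro smooth_on_mult smooth_on_add smooth_on_diff smooth_on_const smd ch(2))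
    show "u = 0" if "y \<in> ?S" "\<And>v. mc c (chart_inv c y) u v = 0" for y u
      using that by (intro mc_nondegenerate[OF c ch(6)])
  qed (use mc_bilinear[OF c] christoffel_koszul[OF c] ch(6) smc in auto)
qed

text \<open>Instead of transforming the Koszul formula, the right-hand side, carried over to the
  chart \<open>c\<close>, is verified to be symmetric and compatible with the metric. Uniqueness of
  the connection form then gives the law, including the second derivative of the chart
  change.\<close>

lemma christoffel_transform:
  assumes c: "c \<in> M" "p \<in> dom_chart c" and d: "d \<in> M" "p \<in> dom_chart d"
  shows "coord_field M c (chr c p w u) p d =
     dir_deriv M (\<lambda>q. coord_field M c u q d) p (coord_field M c w p) +
     chr d p (coord_field M c w p d) (coord_field M c u p d)"
proof -
  let ?U = "dom_chart c \<inter> dom_chart d"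
  have o: "open ?U" using chart_homeomorphism(1)[OF c(1)] chart_homeomorphism(1)[OF d(1)] by (rule open_Int)
  have pU: "p \<in> ?U" using c d by auto
  let ?E = "\<lambda>u q. coord_field M c u q d"
  let ?H = "\<lambda>w u. dir_deriv M (?E u) p (coord_field M c w p)"
  let ?\<Gamma> = "\<lambda>w u. coord_field M d (?H w u + chr d p (?E w p) (?E u p)) p c"
  have bk: "coord_field M c (coord_field M d x p c) p d = x" for x
    using coord_field_eq[OF coord_field_tangent[OF d] c] coord_field_self[OF d] by simp
  have mcE: "mc c p u v = mc d p (?E u p) (?E v p)" for u v by (rule mc_transform[OF c d])
  have "is_connection_form c p ?\<Gamma>"
    unfolding is_connection_form_def
  proof (intro conjI allI)
    show "?\<Gamma> u v = ?\<Gamma> v u" for u v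
      using hessian_symmetric[OF c d, of u v] christoffel_sym[OF d, of "?E u p" "?E v p"] by simp
    fix u v w
    have s: "smooth_in M ?U (\<lambda>q. mc d q a b)" for a b by (rule smooth_in_subset[OF smooth_in_mc[OF d(1)]]) auto
    have "metric_deriv c p w u v = dir_deriv M (\<lambda>q. mc d q (?E u q) (?E v q)) p (coord_field M c w p)"
      unfolding metric_deriv_def
      by (rule dir_deriv_cong[OF smooth_in_subset[OF smooth_in_mc[OF c(1)]] o pU])
        (use mc_transform[OF c(1) _ d(1)] in auto)
    also have "\<dots> = dir_deriv M (\<lambda>q. mc d q (?E u p) (?E v p)) p (coord_field M c w p)
       + mc d p (?H w u) (?E v p) + mc d p (?E u p) (?H w v)"
      by (rule dir_deriv_bilinear_family[OF o pU mc_bilinear[OF d(1)] s smooth_in_coord_field[OF c(1) d(1)]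
            smooth_in_coord_field[OF c(1) d(1)]]) auto
    also have "dir_deriv M (\<lambda>q. mc d q (?E u p) (?E v p)) p (coord_field M c w p) =
        metric_deriv d p (?E w p) (?E u p) (?E v p)"
      unfolding metric_deriv_def using coord_field_eq[OF coord_field_tangent[OF c] d] by simp
    also have "\<dots> = mc d p (chr d p (?E w p) (?E u p)) (?E v p) + mc d p (?E u p) (chr d p (?E w p) (?E v p))"
      by (rule metric_deriv_christoffel[OF d])
    finally show "metric_deriv c p w u v = mc c p (?\<Gamma> w u) v + mc c p u (?\<Gamma> w v)"
      unfolding mcE bk by (simp add: mc_add_left[OF d] mc_add_right[OF d])
  qed
  from christoffel_eqI[OF c this] show ?thesis by (simp add: bk)
qed

end

section \<open>Covariant derivatives of fields along a map\<close>

locale lorentz_map = smooth_manifold_map A M f + lorentz_manifold M g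
  for A :: "('a::{t2_space, second_countable_topology}, 'd::euclidean_space) chart set"
    and M :: "('m::{t2_space, second_countable_topology}, 'e::euclidean_space) chart set"
    and f :: "'a \<Rightarrow> 'm" and g :: "('m, 'e) metric"
begin

abbreviation fld where "fld \<equiv> smooth_field_along A M f"
abbreviation df where "df \<equiv> differential A M f"
abbreviation nab where "nab \<equiv> cov_deriv A M g f"

lemma fld_tangent: "fld V \<Longrightarrow> V q \<in> tangent_space M (f q)"
  by (simp add: field_along_iff)

lemma fld_smooth: "fld V \<Longrightarrow> d \<in> M \<Longrightarrow> smooth_in A (f -` dom_chart d) (\<lambda>q. V q d)"
  by (simp add: field_along_iff)

lemma cov_deriv_component:
  "d \<in> M \<Longrightarrow> f p \<in> dom_chart d \<Longrightarrow>
    nab V p x d = dir_deriv A (\<lambda>q. V q d) p x + chr d (f p) (df p x d) (V p d)"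
  by (simp add: cov_deriv_def)

lemma smooth_in_christoffel_along: "d \<in> M \<Longrightarrow> smooth_in A (f -` dom_chart d) (\<lambda>q. chr d (f q) u v)"
  by (rule smooth_in_pullback[OF smooth_in_christoffel tgt.chart_homeomorphism(1)])

text \<open>Differentiating the Jacobian of the chart change produces exactly the inhomogeneous term
  in the transformation law of the Christoffel form, so the components match in all charts.\<close>

lemma cov_deriv_tangent:
  assumes V: "fld V"
  shows "nab V p x \<in> tangent_space M (f p)"
proof (rule tgt.tangentI[OF tgt.chart_at])
  let ?c = "chart_at M (f p)"
  note c = tgt.chart_at[of "f p"]
  fix d assume d: "d \<in> M" "f p \<in> dom_chart d"
  let ?U = "f -` (dom_chart ?c \<inter> dom_chart d)"
  have oI: "open (dom_chart ?c \<inter> dom_chart d)"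
    using tgt.chart_homeomorphism(1)[OF c(1)] tgt.chart_homeomorphism(1)[OF d(1)] by (rule open_Int)
  have o: "open ?U" by (rule open_preimage[OF oI])
  have pU: "p \<in> ?U" using c d by auto
  let ?E = "\<lambda>u q. coord_field M ?c u q d"
  have sE: "smooth_in A ?U (\<lambda>q. ?E u (f q))" for u
    by (rule smooth_in_pullback[OF tgt.smooth_in_coord_field[OF c(1) d(1)] oI])
  have sV: "smooth_in A ?U (\<lambda>q. V q ?c)" by (rule src.smooth_in_subset[OF fld_smooth[OF V c(1)]]) auto
  have linE: "linear (\<lambda>u. ?E u (f q))" if "q \<in> ?U" for q
    by (rule tgt.coord_field_linear[OF c(1)]) (use that in auto)
  have Ve: "V q d = ?E (V q ?c) (f q)" if "q \<in> ?U" for q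
    using field_along_coord_field[OF V c(1), of q] that by simp
  have df: "coord_field M ?c (df p x ?c) (f p) = df p x" by (rule tgt.coord_field_eq[OF differential_tangent c])
  have "dir_deriv A (\<lambda>q. V q d) p x = dir_deriv A (\<lambda>q. ?E (V q ?c) (f q)) p x"
    by (rule src.dir_deriv_cong[OF src.smooth_in_subset[OF fld_smooth[OF V d(1)]] o pU]) (use Ve in auto)
  also have "\<dots> = dir_deriv A (\<lambda>q. ?E (V p ?c) (f q)) p x + ?E (dir_deriv A (\<lambda>q. V q ?c) p x) (f p)"
    by (rule src.dir_deriv_linear_family[OF o pU linE sE sV])
  also have "dir_deriv A (\<lambda>q. ?E (V p ?c) (f q)) p x = dir_deriv M (?E (V p ?c)) (f p) (df p x)"
    by (rule dir_deriv_pullback[OF tgt.smooth_in_coord_field[OF c(1) d(1)] oI]) (use pU in auto)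
  finally have 1: "dir_deriv A (\<lambda>q. V q d) p x =
     dir_deriv M (?E (V p ?c)) (f p) (df p x) + ?E (dir_deriv A (\<lambda>q. V q ?c) p x) (f p)" .
  have 2: "?E (chr ?c (f p) (df p x ?c) (V p ?c)) (f p) =
     dir_deriv M (?E (V p ?c)) (f p) (df p x) + chr d (f p) (df p x d) (V p d)"
    using christoffel_transform[OF c d, of "df p x ?c" "V p ?c"] Ve[OF pU] unfolding df by simp
  have "nab V p x d = ?E (nab V p x ?c) (f p)"
    unfolding cov_deriv_component[OF d] cov_deriv_component[OF c] linear_add[OF linE[OF pU]] 1 2 by simp
  then show "nab V p x d = frechet_derivative (\<lambda>x. coord d (chart_inv ?c x)) (at (coord ?c (f p))) (nab V p x ?c)"
    using tgt.coord_field_component[OF d] by simp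
qed (auto simp: cov_deriv_def)

lemma cov_deriv_field:
  assumes V: "fld V" and X: "X \<in> vector_fields A"
  shows "fld (\<lambda>q. nab V q (X q))"
  unfolding field_along_iff
proof (intro conjI allI ballI cov_deriv_tangent[OF V])
  fix d assume d: "d \<in> M"
  note o = open_dom_preimage[OF d]
  have s: "smooth_in A (f -` dom_chart d) (\<lambda>q. df q (X q) d)"
    using differential_field[OF X] d by (simp add: field_along_iff)
  show "smooth_in A (f -` dom_chart d) (\<lambda>q. nab V q (X q) d)"
  proof (rule src.smooth_in_cong[OF _ o])
    show "smooth_in A (f -` dom_chart d) (\<lambda>q. dir_deriv A (\<lambda>q. V q d) q (X q) + chr d (f q) (df q (X q) d) (V q d))"
      by (intro src.smooth_in_add o src.smooth_in_dir_deriv[OF X] fld_smooth[OF V d]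
          src.smooth_in_bilinear_family[OF o _ smooth_in_christoffel_along[OF d] s])
        (use christoffel_bilinear[OF d] in auto)
  qed (use d in \<open>auto simp: cov_deriv_component\<close>)
qed

lemma cov_deriv_metric:
  assumes V: "fld V" and W: "fld W"
  shows "dir_deriv A (\<lambda>q. g (f q) (V q) (W q)) p x = g (f p) (nab V p x) (W p) + g (f p) (V p) (nab W p x)"
proof -
  let ?d = "chart_at M (f p)"
  note d = tgt.chart_at[of "f p"]
  let ?U = "f -` dom_chart ?d"
  note o = open_dom_preimage[OF d(1)]
  have pU: "p \<in> ?U" using d by auto
  have sm: "smooth_in A ?U (\<lambda>q. mc ?d (f q) u v)" for u v
    by (rule smooth_in_pullback[OF smooth_in_mc[OF d(1)] tgt.chart_homeomorphism(1)[OF d(1)]])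
  have bil: "bilinear (mc ?d (f q))" if "q \<in> ?U" for q using mc_bilinear[OF d(1)] that by simp
  note sV = fld_smooth[OF V d(1)] and sW = fld_smooth[OF W d(1)]
  have "dir_deriv A (\<lambda>q. g (f q) (V q) (W q)) p x = dir_deriv A (\<lambda>q. mc ?d (f q) (V q ?d) (W q ?d)) p x"
    by (rule src.dir_deriv_cong[OF src.smooth_in_bilinear_family[OF o bil sm sV sW] o pU, symmetric])
      (use metric_in_chart[OF fld_tangent[OF V] fld_tangent[OF W] d(1)] in auto)
  also have "\<dots> = dir_deriv A (\<lambda>q. mc ?d (f q) (V p ?d) (W p ?d)) p x
      + mc ?d (f p) (dir_deriv A (\<lambda>q. V q ?d) p x) (W p ?d) + mc ?d (f p) (V p ?d) (dir_deriv A (\<lambda>q. W q ?d) p x)"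
    by (rule src.dir_deriv_bilinear_family[OF o pU bil sm sV sW])
  also have "dir_deriv A (\<lambda>q. mc ?d (f q) (V p ?d) (W p ?d)) p x = metric_deriv ?d (f p) (df p x ?d) (V p ?d) (W p ?d)"
    unfolding metric_deriv_def tgt.coord_field_eq[OF differential_tangent d]
    by (rule dir_deriv_pullback[OF smooth_in_mc[OF d(1)] tgt.chart_homeomorphism(1)[OF d(1)] d(2)])
  finally show ?thesis
    unfolding metric_deriv_christoffel[OF d] metric_in_chart[OF cov_deriv_tangent[OF V] fld_tangent[OF W] d]
      metric_in_chart[OF fld_tangent[OF V] cov_deriv_tangent[OF W] d] cov_deriv_component[OF d]
    by (simp add: mc_add_left[OF d] mc_add_right[OF d])
qed

lemma smooth_in_metric:
  assumes V: "fld V" and W: "fld W"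
  shows "smooth_in A UNIV (\<lambda>q. g (f q) (V q) (W q))"
proof (rule src.smooth_in_local)
  fix p
  let ?d = "chart_at M (f p)"
  note d = tgt.chart_at[of "f p"]
  let ?U = "f -` dom_chart ?d"
  note o = open_dom_preimage[OF d(1)]
  have sm: "smooth_in A ?U (\<lambda>q. mc ?d (f q) u v)" for u v
    by (rule smooth_in_pullback[OF smooth_in_mc[OF d(1)] tgt.chart_homeomorphism(1)[OF d(1)]])
  have bil: "bilinear (mc ?d (f q))" if "q \<in> ?U" for q using mc_bilinear[OF d(1)] that by simp
  have "smooth_in A ?U (\<lambda>q. g (f q) (V q) (W q))"
    by (rule src.smooth_in_cong[OF src.smooth_in_bilinear_family[OF o bil sm fld_smooth[OF V d(1)] fld_smooth[OF W d(1)]] o])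
      (use metric_in_chart[OF fld_tangent[OF V] fld_tangent[OF W] d(1)] in auto)
  then show "\<exists>V'. open V' \<and> p \<in> V' \<and> smooth_in A V' (\<lambda>q. g (f q) (V q) (W q))" using o d(2) by blast
qed

lemma cov_deriv_scaleR:
  assumes V: "fld V" and h: "smooth_in A UNIV h"
  shows "nab (\<lambda>q c. h q *\<^sub>R V q c) p x = (\<lambda>c. dir_deriv A h p x *\<^sub>R V p c + h p *\<^sub>R nab V p x c)"
proof
  fix d
  show "nab (\<lambda>q c. h q *\<^sub>R V q c) p x d = dir_deriv A h p x *\<^sub>R V p d + h p *\<^sub>R nab V p x d"
  proof (cases "d \<in> M \<and> f p \<in> dom_chart d")
    case True
    then have d: "d \<in> M" "f p \<in> dom_chart d" by auto
    have "smooth_in A (f -` dom_chart d) h" by (rule src.smooth_in_subset[OF h]) auto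
    from src.dir_deriv_scaleR[OF this fld_smooth[OF V d(1)], of p x] d(2)
    show ?thesis
      using linear_scale[OF bilinear_linear(1)[OF christoffel_bilinear[OF d]]]
      by (simp add: cov_deriv_component[OF d] scaleR_add_right)
  next
    case False
    then show ?thesis using tgt.tangent_spaceD(2)[OF fld_tangent[OF V]] by (auto simp: cov_deriv_def)
  qed
qed

lemma cov_deriv_add:
  assumes V: "fld V" and W: "fld W"
  shows "nab (\<lambda>q c. V q c + W q c) p x = (\<lambda>c. nab V p x c + nab W p x c)"
proof
  fix d
  show "nab (\<lambda>q c. V q c + W q c) p x d = nab V p x d + nab W p x d"
  proof (cases "d \<in> M \<and> f p \<in> dom_chart d")
    case True
    then have d: "d \<in> M" "f p \<in> dom_chart d" by auto
    then show ?thesis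
      using src.dir_deriv_add[OF fld_smooth[OF V d(1)] fld_smooth[OF W d(1)]]
        linear_add[OF bilinear_linear(1)[OF christoffel_bilinear[OF d]]]
      by (simp add: cov_deriv_component[OF d])
  qed (auto simp: cov_deriv_def)
qed

lemma cov_deriv_lincomb_vec:
  assumes V: "fld V"
  shows "nab V p (\<lambda>c. a *\<^sub>R x c + b *\<^sub>R y c) = (\<lambda>c. a *\<^sub>R nab V p x c + b *\<^sub>R nab V p y c)"
proof
  fix d
  show "nab V p (\<lambda>c. a *\<^sub>R x c + b *\<^sub>R y c) d = a *\<^sub>R nab V p x d + b *\<^sub>R nab V p y d"
  proof (cases "d \<in> M \<and> f p \<in> dom_chart d")
    case True
    then have d: "d \<in> M" "f p \<in> dom_chart d" by auto
    note l = bilinear_linear(2)[OF christoffel_bilinear[OF d]]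
    show ?thesis
      using src.dir_deriv_linear[OF fld_smooth[OF V d(1)], of p a x b y] d(2)
      by (simp add: cov_deriv_component[OF d] differential_lincomb linear_add[OF l] linear_scale[OF l] scaleR_add_right)
  qed (auto simp: cov_deriv_def)
qed

text \<open>In a chart the Christoffel terms cancel by symmetry, and what remains is the commutator
  of second derivatives of the coordinate function along the map.\<close>

lemma cov_deriv_torsion_free:
  assumes X: "X \<in> vector_fields A" and Y: "Y \<in> vector_fields A"
  shows "(\<lambda>c. nab (\<lambda>q. df q (Y q)) p (X p) c - nab (\<lambda>q. df q (X q)) p (Y p) c) = df p (lie_bracket A X Y p)"
proof
  fix d
  show "nab (\<lambda>q. df q (Y q)) p (X p) d - nab (\<lambda>q. df q (X q)) p (Y p) d = df p (lie_bracket A X Y p) d"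
  proof (cases "d \<in> M \<and> f p \<in> dom_chart d")
    case True
    then have d: "d \<in> M" "f p \<in> dom_chart d" by auto
    note o = open_dom_preimage[OF d(1)]
    have *: "dir_deriv A (\<lambda>q. df q (Z q) d) p v = dir_deriv A (\<lambda>q. dir_deriv A (\<lambda>q. coord d (f q)) q (Z q)) p v"
      if Z: "Z \<in> vector_fields A" for Z v
      by (rule src.dir_deriv_cong[OF src.smooth_in_dir_deriv[OF Z smooth_in_coord_map[OF d(1)] o] o, symmetric])
        (use d in \<open>auto simp: differential_component\<close>)
    show ?thesis
      using src.dir_deriv_lie_bracket[OF X Y smooth_in_coord_map[OF d(1)] o, of p] d(2)
        christoffel_sym[OF d, of "df p (X p) d" "df p (Y p) d"]
      by (simp add: cov_deriv_component[OF d] *[OF X] *[OF Y] differential_component[OF d])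
  qed (auto simp: cov_deriv_def differential_def)
qed

end

section \<open>Curvature along a map\<close>

context lorentz_manifold
begin

lemma differential_id:
  assumes "v \<in> tangent_space M p" "d \<in> M" "p \<in> dom_chart d"
  shows "differential M M id p v d = v d"
  using tangent_coord[OF assms] assms by (simp add: differential_def)

lemma cov_deriv_coord_field:
  assumes d: "d \<in> M" "q \<in> dom_chart d" and w: "w \<in> tangent_space M q"
  shows "cov_deriv M M g id (coord_field M d z) q w d = chr d q (w d) z"
proof -
  have "dir_deriv M (\<lambda>q. coord_field M d z q d) q w = dir_deriv M (\<lambda>q. z) q w"
    by (rule dir_deriv_cong[OF smooth_in_const chart_homeomorphism(1)[OF d(1)] d(2), symmetric])
      (rule coord_field_self[OF d(1), symmetric])
  then show ?thesis
    using differential_id[OF w d] coord_field_self[OF d] d by (simp add: cov_deriv_def dir_deriv_const)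
qed

lemma lie_bracket_coord_fields:
  assumes d: "d \<in> M" "p \<in> dom_chart d"
  shows "lie_bracket M (coord_field M d x) (coord_field M d y) p = (\<lambda>c. 0)"
  using hessian_symmetric[OF d] by (auto simp: lie_bracket_def)

text \<open>The component in \<open>d\<close> is defined by the coordinate fields of this same
  \<open>d\<close>: their bracket vanishes and, on the chart domain, their covariant derivatives are
  values of the Christoffel form. The classical formula in terms of \<open>\<Gamma>\<close>
  remains.\<close>

lemma riemann_component:
  assumes d: "d \<in> M" "p \<in> dom_chart d"
  shows "riemann M g p x y z d =
     dir_deriv M (\<lambda>q. chr d q (y d) (z d)) p (coord_field M d (x d) p)
     - dir_deriv M (\<lambda>q. chr d q (x d) (z d)) p (coord_field M d (y d) p)
     + chr d p (x d) (chr d p (y d) (z d)) - chr d p (y d) (chr d p (x d) (z d))"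
proof -
  let ?D = "cov_deriv M M g id"
  have second: "?D (\<lambda>q. ?D (coord_field M d w) q (coord_field M d v q)) p (coord_field M d u p) d =
      dir_deriv M (\<lambda>q. chr d q v w) p (coord_field M d u p) + chr d p u (chr d p v w)" for u v w
  proof -
    have *: "?D (coord_field M d w) q (coord_field M d v q) d = chr d q v w" if "q \<in> dom_chart d" for q
      using cov_deriv_coord_field[OF d(1) that coord_field_tangent[OF d(1) that]] coord_field_self[OF d(1) that] by simp
    have "dir_deriv M (\<lambda>q. ?D (coord_field M d w) q (coord_field M d v q) d) p (coord_field M d u p) =
        dir_deriv M (\<lambda>q. chr d q v w) p (coord_field M d u p)"
      by (rule dir_deriv_cong[OF smooth_in_christoffel[OF d(1)] chart_homeomorphism(1)[OF d(1)] d(2), symmetric])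
        (use * in simp)
    then show ?thesis
      using differential_id[OF coord_field_tangent[OF d] d] coord_field_self[OF d] d *[OF d(2)]
      by (subst cov_deriv_def) simp
  qed
  have "?D (coord_field M d (z d)) p (lie_bracket M (coord_field M d (x d)) (coord_field M d (y d)) p) d = 0"
    unfolding lie_bracket_coord_fields[OF d] cov_deriv_coord_field[OF d tangent_zero]
    using linear_0[OF bilinear_linear(2)[OF christoffel_bilinear[OF d]]] by simp
  then show ?thesis using d by (simp add: riemann_def curvature_def second)
qed

end

context lorentz_map
begin

text \<open>The left side is built from fields along \<open>f\<close> alone, the right side is the
  ambient tensor at \<open>f p\<close>. In a chart both reduce to the same expression in the
  Christoffel form and its derivative.\<close>

lemma curvature_pullback:
  assumes X: "X \<in> vector_fields A" and Y: "Y \<in> vector_fields A" and Z: "fld Z"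
  shows "curvature A nab X Y Z p = riemann M g (f p) (df p (X p)) (df p (Y p)) (Z p)"
proof
  fix d
  show "curvature A nab X Y Z p d = riemann M g (f p) (df p (X p)) (df p (Y p)) (Z p) d"
  proof (cases "d \<in> M \<and> f p \<in> dom_chart d")
    case True
    then have d: "d \<in> M" "f p \<in> dom_chart d" by auto
    let ?U = "f -` dom_chart d"
    note o = open_dom_preimage[OF d(1)]
    have pU: "p \<in> ?U" using d(2) by simp
    let ?z = "\<lambda>q. Z q d" and ?F = "\<lambda>X q. df q (X q) d"
    note sZ = fld_smooth[OF Z d(1)]
    have sF: "smooth_in A ?U (?F X)" if "X \<in> vector_fields A" for X
      using differential_field[OF that] d(1) by (simp add: field_along_iff)
    note add = linear_add[OF bilinear_linear(1)[OF christoffel_bilinear[OF d]]]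
      linear_add[OF bilinear_linear(2)[OF christoffel_bilinear[OF d]]]
      linear_diff[OF bilinear_linear(2)[OF christoffel_bilinear[OF d]]]
    have bil: "bilinear (chr d (f q))" if "q \<in> ?U" for q using christoffel_bilinear[OF d(1)] that by simp
    \<comment> \<open>Exchanging \<open>X\<close> and \<open>Y\<close> swaps the two terms that
      contain a first derivative of \<open>?z\<close> next to \<open>?F\<close>, so they cancel in
      the commutator. The derivatives of \<open>?F\<close> and the second derivatives of
      \<open>?z\<close> combine into the bracket term by \<open>lF\<close> and
      \<open>lZ\<close>.\<close>
    have outer: "nab (\<lambda>q. nab Z q (Y q)) p (X p) d =
        dir_deriv A (\<lambda>q. dir_deriv A ?z q (Y q)) p (X p)
        + dir_deriv M (\<lambda>q. chr d q (?F Y p) (?z p)) (f p) (df p (X p))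
        + chr d (f p) (dir_deriv A (?F Y) p (X p)) (?z p)
        + chr d (f p) (?F Y p) (dir_deriv A ?z p (X p))
        + chr d (f p) (?F X p) (dir_deriv A ?z p (Y p)) + chr d (f p) (?F X p) (chr d (f p) (?F Y p) (?z p))"
      if X: "X \<in> vector_fields A" and Y: "Y \<in> vector_fields A" for X Y
    proof -
      have s1: "smooth_in A ?U (\<lambda>q. dir_deriv A ?z q (Y q))" by (rule src.smooth_in_dir_deriv[OF Y sZ o])
      have s2: "smooth_in A ?U (\<lambda>q. chr d (f q) (?F Y q) (?z q))"
        by (rule src.smooth_in_bilinear_family[OF o bil smooth_in_christoffel_along[OF d(1)] sF[OF Y] sZ])
      have "dir_deriv A (\<lambda>q. nab Z q (Y q) d) p (X p) =
          dir_deriv A (\<lambda>q. dir_deriv A ?z q (Y q) + chr d (f q) (?F Y q) (?z q)) p (X p)"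
        by (rule src.dir_deriv_cong[OF src.smooth_in_add[OF o s1 s2] o pU, symmetric])
          (use d(1) in \<open>auto simp: cov_deriv_component\<close>)
      also have "\<dots> = dir_deriv A (\<lambda>q. dir_deriv A ?z q (Y q)) p (X p) + dir_deriv A (\<lambda>q. chr d (f q) (?F Y q) (?z q)) p (X p)"
        by (rule src.dir_deriv_add[OF s1 s2 pU])
      also have "dir_deriv A (\<lambda>q. chr d (f q) (?F Y q) (?z q)) p (X p) =
          dir_deriv A (\<lambda>q. chr d (f q) (?F Y p) (?z p)) p (X p)
          + chr d (f p) (dir_deriv A (?F Y) p (X p)) (?z p) + chr d (f p) (?F Y p) (dir_deriv A ?z p (X p))"
        by (rule src.dir_deriv_bilinear_family[OF o pU bil smooth_in_christoffel_along[OF d(1)] sF[OF Y] sZ])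
      also have "dir_deriv A (\<lambda>q. chr d (f q) (?F Y p) (?z p)) p (X p) =
          dir_deriv M (\<lambda>q. chr d q (?F Y p) (?z p)) (f p) (df p (X p))"
        by (rule dir_deriv_pullback[OF smooth_in_christoffel[OF d(1)] tgt.chart_homeomorphism(1)[OF d(1)] d(2)])
      finally show ?thesis by (simp add: cov_deriv_component[OF d] add)
    qed
    have lF: "df p (lie_bracket A X Y p) d = dir_deriv A (?F Y) p (X p) - dir_deriv A (?F X) p (Y p)"
    proof -
      have *: "dir_deriv A (?F Z) p v = dir_deriv A (\<lambda>q. dir_deriv A (\<lambda>q. coord d (f q)) q (Z q)) p v"
        if Z: "Z \<in> vector_fields A" for Z v
        by (rule src.dir_deriv_cong[OF src.smooth_in_dir_deriv[OF Z smooth_in_coord_map[OF d(1)] o] o pU, symmetric])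
          (use d in \<open>auto simp: differential_component\<close>)
      show ?thesis
        unfolding *[OF X] *[OF Y] differential_component[OF d]
        by (rule src.dir_deriv_lie_bracket[OF X Y smooth_in_coord_map[OF d(1)] o pU])
    qed
    have lZ: "dir_deriv A ?z p (lie_bracket A X Y p) =
      dir_deriv A (\<lambda>q. dir_deriv A ?z q (Y q)) p (X p) - dir_deriv A (\<lambda>q. dir_deriv A ?z q (X q)) p (Y p)"
      by (rule src.dir_deriv_lie_bracket[OF X Y sZ o pU])
    show ?thesis
      unfolding riemann_component[OF d] tgt.coord_field_eq[OF differential_tangent d]
      by (simp add: curvature_def outer[OF X Y] outer[OF Y X] cov_deriv_component[OF d, of Z "lie_bracket A X Y p"] lF lZ add)
  next
    case False
    then show ?thesis by (auto simp: curvature_def cov_deriv_def riemann_def)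
  qed
qed

end

subsection \<open>Linear algebra of the normal plane\<close>

text \<open>A dimension count. If \<open>n\<close> and \<open>\<xi>\<close> were independent, their
  span of dimension 2 would be \<open>B\<close>-orthogonal to the range of \<open>E\<close> together
  with \<open>\<xi>\<close>, of dimension \<open>DIM('d) + 1\<close>. By nondegeneracy the two
  dimensions add up to at most \<open>DIM('e)\<close>, one less than their sum.\<close>

lemma null_line_of_codim_two:
  fixes B :: "'e::euclidean_space \<Rightarrow> 'e \<Rightarrow> real" and E :: "'d::euclidean_space \<Rightarrow> 'e"
  assumes B: "bilinear B" and nd: "\<And>u. (\<And>v. B u v = 0) \<Longrightarrow> u = 0" and sym: "\<And>u v. B u v = B v u"
    and dim: "DIM('e) = DIM('d) + 2" and E: "linear E" "inj E" and \<xi>: "\<xi> \<notin> range E"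
    and o: "\<And>u. B \<xi> (E u) = 0" "B \<xi> \<xi> = 0" "\<And>u. B n (E u) = 0" "B n \<xi> = 0"
  shows "\<exists>a. n = a *\<^sub>R \<xi>"
proof (rule ccontr)
  assume not: "\<nexists>a. n = a *\<^sub>R \<xi>"
  have \<xi>0: "\<xi> \<noteq> 0" using \<xi> linear_0[OF E(1)] by (metis rangeI)
  have ind: "independent {n, \<xi>}"
    using not \<xi>0 by (auto simp: independent_insert span_singleton)
  have "n \<noteq> \<xi>" using not by (metis scaleR_one)
  \<comment> \<open>This map converts \<open>B\<close>-orthogonality into Euclidean orthogonality,
    for which the dimension formula is stated.\<close>
  let ?L = "\<lambda>u. \<Sum>b\<in>Basis. B u b *\<^sub>R b"
  have L_inner: "?L u \<bullet> v = B u v" for u v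
  proof -
    have "?L u \<bullet> v = (\<Sum>b\<in>Basis. (v \<bullet> b) *\<^sub>R B u b)" by (simp add: inner_sum_left inner_commute[of v] mult.commute)
    then show ?thesis using linear_expand[OF bilinear_linear(1)[OF B], of u v] by simp
  qed
  let ?K = "\<lambda>(u, a). ?L (E u + a *\<^sub>R \<xi>)"
  have K_inner: "?K x \<bullet> v = B (E (fst x)) v + snd x * B \<xi> v" for x v
    using linear_add[OF bilinear_linear(2)[OF B], of "E (fst x)" "snd x *\<^sub>R \<xi>" v]
      linear_scale[OF bilinear_linear(2)[OF B], of "snd x" \<xi> v]
    by (simp add: split_beta L_inner)
  have linK: "linear ?K"
  proof (rule linearI)
    fix x y :: "'d \<times> real" and r :: real
    have "?K (x + y) \<bullet> v = (?K x + ?K y) \<bullet> v" for v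
      unfolding inner_add_left K_inner
      using linear_add[OF E(1), of "fst x" "fst y"] linear_add[OF bilinear_linear(2)[OF B], of "E (fst x)" "E (fst y)" v]
      by (simp add: algebra_simps)
    then show "?K (x + y) = ?K x + ?K y" by (intro vector_eq_rdot[THEN iffD1]) blast
    have "?K (r *\<^sub>R x) \<bullet> v = (r *\<^sub>R ?K x) \<bullet> v" for v
      unfolding inner_scaleR_left K_inner
      using linear_scale[OF E(1), of r "fst x"] linear_scale[OF bilinear_linear(2)[OF B], of r "E (fst x)" v]
      by (simp add: algebra_simps)
    then show "?K (r *\<^sub>R x) = r *\<^sub>R ?K x" by (intro vector_eq_rdot[THEN iffD1]) blast
  qed
  have injK: "inj ?K"
  proof (subst linear_injective_0[OF linK], intro allI impI)
    fix x assume "?K x = 0"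
    then have "B (E (fst x) + snd x *\<^sub>R \<xi>) v = 0" for v
      using L_inner[of "E (fst x) + snd x *\<^sub>R \<xi>" v] by (simp add: split_beta)
    then have *: "E (fst x) + snd x *\<^sub>R \<xi> = 0" by (rule nd)
    have s: "snd x = 0"
    proof (rule ccontr)
      assume s: "snd x \<noteq> 0"
      have "\<xi> = (1 / snd x) *\<^sub>R (snd x *\<^sub>R \<xi>)" using s by simp
      also have "snd x *\<^sub>R \<xi> = - E (fst x)" using * by (simp add: add_eq_0_iff)
      finally have "\<xi> = (1 / snd x) *\<^sub>R (- E (fst x))" .
      then have "\<xi> = E ((- 1 / snd x) *\<^sub>R fst x)" by (simp add: linear_scale[OF E(1)] linear_neg[OF E(1)])
      then show False using \<xi> by blast
    qed
    with * have "E (fst x) = 0" by simp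
    then have "fst x = 0" using E linear_injective_0 by blast
    with s show "x = 0" by (simp add: prod_eq_iff)
  qed
  have sub: "range ?K \<subseteq> {y \<in> UNIV. \<forall>x\<in>span {n, \<xi>}. orthogonal x y}"
  proof (clarsimp)
    fix u a x assume x: "x \<in> span {n, \<xi>}"
    have "orthogonal (?K (u, a)) x"
    proof (rule orthogonal_to_span[OF x])
      fix y assume "y \<in> {n, \<xi>}"
      then show "orthogonal (?K (u, a)) y"
        unfolding orthogonal_def K_inner using o sym by auto
    qed
    then show "orthogonal x (\<Sum>b\<in>Basis. B (E u + a *\<^sub>R \<xi>) b *\<^sub>R b)" by (simp add: orthogonal_commute)
  qed
  have "DIM('d) + 1 = dim (range ?K)"
    using dim_image_eq[OF linK inj_on_subset[OF injK subset_UNIV], of UNIV] by (simp add: dim_UNIV)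
  also have "\<dots> \<le> dim {y \<in> UNIV. \<forall>x\<in>span {n, \<xi>}. orthogonal x y}" by (rule dim_subset[OF sub])
  finally have "DIM('d) + 1 + dim (span {n, \<xi>}) \<le> DIM('e)"
    using dim_subspace_orthogonal_to_vectors[of "span {n, \<xi>}" "UNIV :: 'e set"] by simp
  moreover have "dim (span {n, \<xi>}) = 2" using dim_eq_card_independent[OF ind] \<open>n \<noteq> \<xi>\<close> by simp
  ultimately show False using dim by simp
qed

section \<open>Closed one-forms on simply connected manifolds\<close>

context smooth_manifold
begin

text \<open>The bracket depends only on the fields near \<open>p\<close>, so global extensions of
  coordinate fields still commute there.\<close>

lemma lie_bracket_local_coord_fields:
  assumes c: "c \<in> A" "p \<in> dom_chart c" and W: "open W" "p \<in> W" "W \<subseteq> dom_chart c"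
    and XY: "\<And>q. q \<in> W \<Longrightarrow> X q = coord_field A c u q" "\<And>q. q \<in> W \<Longrightarrow> Y q = coord_field A c v q"
  shows "lie_bracket A X Y p = (\<lambda>d. 0)"
proof
  fix d
  show "lie_bracket A X Y p d = 0"
  proof (cases "d \<in> A \<and> p \<in> dom_chart d")
    case True
    then have d: "d \<in> A" "p \<in> dom_chart d" by auto
    have o: "open (W \<inter> dom_chart d)" using W(1) chart_homeomorphism(1)[OF d(1)] by (rule open_Int)
    have *: "dir_deriv A (\<lambda>q. Z q d) p v = dir_deriv A (\<lambda>q. coord_field A c w q d) p v"
      if "\<And>q. q \<in> W \<Longrightarrow> Z q = coord_field A c w q" for Z w v
      by (rule dir_deriv_cong[OF smooth_in_subset[OF smooth_in_coord_field[OF c(1) d(1)]] o, symmetric])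
        (use W d that in auto)
    show ?thesis
      using hessian_symmetric[OF c d, of u v] True XY[OF W(2)] *[OF XY(1)] *[OF XY(2)] by (simp add: lie_bracket_def)
  qed (auto simp: lie_bracket_def)
qed

text \<open>
  One-forms are functions of tangent vectors; smoothness and closedness are tested on vector fields,
  and bump functions provide enough of these.
\<close>

lemma closed_form_local_primitive:
  fixes \<tau> :: "'a \<Rightarrow> ('a, 'e) tvec \<Rightarrow> real"
  assumes lin: "\<And>p v w a b. v \<in> tangent_space A p \<Longrightarrow> w \<in> tangent_space A p \<Longrightarrow>
      \<tau> p (\<lambda>c. a *\<^sub>R v c + b *\<^sub>R w c) = a * \<tau> p v + b * \<tau> p w"
    and sm: "\<And>X. X \<in> vector_fields A \<Longrightarrow> smooth_in A UNIV (\<lambda>q. \<tau> q (X q))"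
    and closed: "\<And>X Y p. X \<in> vector_fields A \<Longrightarrow> Y \<in> vector_fields A \<Longrightarrow>
      dir_deriv A (\<lambda>q. \<tau> q (Y q)) p (X p) - dir_deriv A (\<lambda>q. \<tau> q (X q)) p (Y p) = \<tau> p (lie_bracket A X Y p)"
  shows "\<exists>U f. open U \<and> p \<in> U \<and> smooth_in A U f \<and>
     (\<forall>q\<in>U. \<forall>x\<in>tangent_space A q. dir_deriv A f q x = \<tau> q x)"
proof -
  let ?c = "chart_at A p"
  note c = chart_at[of p]
  note ch = chart_homeomorphism[OF c(1)]
  let ?t = "\<lambda>u q. \<tau> q (coord_field A ?c u q)"
  have tlin: "linear (\<lambda>u. ?t u q)" if q: "q \<in> dom_chart ?c" for q
  proof (rule linearI)
    have *: "coord_field A ?c (a *\<^sub>R u + b *\<^sub>R v) q = (\<lambda>d. a *\<^sub>R coord_field A ?c u q d + b *\<^sub>R coord_field A ?c v q d)" for a b u v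
      by (rule ext) (simp add: linear_add[OF coord_field_linear[OF c(1) q]] linear_scale[OF coord_field_linear[OF c(1) q]])
    fix u v and r :: real
    show "?t (u + v) q = ?t u q + ?t v q"
      using *[of 1 u 1 v] lin[OF coord_field_tangent[OF c(1) q] coord_field_tangent[OF c(1) q], of 1 u 1 v] by simp
    show "?t (r *\<^sub>R u) q = r *\<^sub>R ?t u q"
      using *[of r u 0 u] lin[OF coord_field_tangent[OF c(1) q] coord_field_tangent[OF c(1) q], of r u 0 u] by simp
  qed
  have ts: "smooth_in A (dom_chart ?c) (?t u)" for u
  proof (rule smooth_in_local)
    fix q assume q: "q \<in> dom_chart ?c"
    obtain X W where X: "X \<in> vector_fields A" "open W" "q \<in> W" "W \<subseteq> dom_chart ?c"
      "\<forall>q\<in>W. X q = coord_field A ?c u q"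
      using extend_coord_field[OF c(1) q, of u] by blast
    have "smooth_in A W (?t u)"
      by (rule smooth_in_cong[OF smooth_in_subset[OF sm[OF X(1)]] X(2)]) (use X(5) in auto)
    then show "\<exists>V. open V \<and> q \<in> V \<and> smooth_in A V (?t u)" using X by blast
  qed
  \<comment> \<open>For commuting fields the bracket term of \<open>closed\<close> drops out,
    leaving the symmetry required by the Poincare lemma.\<close>
  have tc: "dir_deriv A (?t w) q (coord_field A ?c u q) = dir_deriv A (?t u) q (coord_field A ?c w q)"
    if q: "q \<in> dom_chart ?c" for q u w
  proof -
    obtain X V where X: "X \<in> vector_fields A" "open V" "q \<in> V" "V \<subseteq> dom_chart ?c" "\<forall>q\<in>V. X q = coord_field A ?c u q"
      using extend_coord_field[OF c(1) q, of u] by blast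
    obtain Y W where Y: "Y \<in> vector_fields A" "open W" "q \<in> W" "W \<subseteq> dom_chart ?c" "\<forall>q\<in>W. Y q = coord_field A ?c w q"
      using extend_coord_field[OF c(1) q, of w] by blast
    have "lie_bracket A X Y q = (\<lambda>d. 0)"
      by (rule lie_bracket_local_coord_fields[OF c(1) q, of "V \<inter> W"]) (use X Y in auto)
    then have "\<tau> q (lie_bracket A X Y q) = 0"
      using lin[OF tangent_zero tangent_zero, of q 0 0] by simp
    moreover have "dir_deriv A (\<lambda>q. \<tau> q (Y q)) q (X q) = dir_deriv A (?t w) q (X q)"
      by (rule dir_deriv_cong[OF smooth_in_subset[OF sm[OF Y(1)]] Y(2,3)]) (use Y(5) in auto)
    moreover have "dir_deriv A (\<lambda>q. \<tau> q (X q)) q (Y q) = dir_deriv A (?t u) q (Y q)"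
      by (rule dir_deriv_cong[OF smooth_in_subset[OF sm[OF X(1)]] X(2,3)]) (use X(5) in auto)
    ultimately show ?thesis using closed[OF X(1) Y(1), of q] X(3,5) Y(3,5) by simp
  qed
  let ?O = "coord ?c ` dom_chart ?c"
  \<comment> \<open>The coefficient vector of the form in the chart, dual to it under the Euclidean
    inner product.\<close>
  define a where "a y = (\<Sum>b\<in>Basis. ?t b (chart_inv ?c y) *\<^sub>R b)" for y
  have aw: "a y \<bullet> w = ?t w (chart_inv ?c y)" if "y \<in> ?O" for y w
    using linear_expand[OF tlin[OF ch(6)[OF that]], of w]
    by (simp add: a_def inner_sum_left inner_commute[of w] mult.commute)
  have ts': "smooth_on ?O (\<lambda>y. ?t w (chart_inv ?c y))" for w
    using smooth_inD[OF ts c(1)] by simp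
  have as: "smooth_on ?O a"
    unfolding a_def by (intro smooth_on_sum smooth_on_scaleR ch(2) ts' smooth_on_const)
  obtain r where r: "r > 0" "ball (coord ?c p) r \<subseteq> ?O" using ch(2) c(2) by (meson imageI openE)
  have das: "frechet_derivative a (at y) u \<bullet> w = dir_deriv A (?t w) (chart_inv ?c y) (coord_field A ?c u (chart_inv ?c y))"
    if y: "y \<in> ?O" for y u w
  proof -
    have "((\<lambda>y. ?t w (chart_inv ?c y)) has_derivative (\<lambda>u. frechet_derivative a (at y) u \<bullet> w)) (at y)"
      by (rule has_derivative_transform_within_open[OF has_derivative_inner_left[OF smooth_on_has_derivative[OF as y]] ch(2) y])
        (rule aw)
    from frechet_derivative_eqI[OF this]
    show ?thesis
      using dir_deriv_coord_field[OF ts ch(1) ch(6)[OF y] c(1) ch(6)[OF y], of w u] ch(7)[OF y] by simp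
  qed
  have "\<exists>f. \<forall>x\<in>ball (coord ?c p) r. (f has_derivative (\<lambda>u. a x \<bullet> u)) (at x)"
  proof (rule poincare_lemma[OF smooth_on_subset[OF as r(2)]])
    fix x u w assume "x \<in> ball (coord ?c p) r"
    then have x: "x \<in> ?O" using r(2) by blast
    show "frechet_derivative a (at x) u \<bullet> w = frechet_derivative a (at x) w \<bullet> u"
      unfolding das[OF x] by (rule tc[OF ch(6)[OF x]])
  qed
  then obtain f where f: "\<And>x. x \<in> ball (coord ?c p) r \<Longrightarrow> (f has_derivative (\<lambda>u. a x \<bullet> u)) (at x)" by blast
  \<comment> \<open>The Poincare lemma gives differentiability only; smoothness follows because the
    derivative of \<open>f\<close> is given by the smooth \<open>a\<close>.\<close>
  have fs: "smooth_on (ball (coord ?c p) r) f"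
    unfolding smooth_on_Suc_iff[of _ f]
  proof (intro conjI ballI allI)
    show "f differentiable at x" if "x \<in> ball (coord ?c p) r" for x using f[OF that] by (rule differentiableI)
    show "smooth_on (ball (coord ?c p) r) (\<lambda>x. frechet_derivative f (at x) v)" for v
      by (rule smooth_on_cong[OF smooth_on_inner[OF open_ball smooth_on_subset[OF as r(2)] smooth_on_const[of _ v]] open_ball])
        (simp add: frechet_derivative_eqI[OF f])
  qed
  let ?U = "{q \<in> dom_chart ?c. coord ?c q \<in> ball (coord ?c p) r}"
  have oU: "open ?U" by (rule open_chart_preimage[OF c(1) open_ball])
  have sc: "smooth_in A ?U (coord ?c)" by (rule smooth_in_subset[OF smooth_in_coord[OF c(1)]]) auto
  have "smooth_in A ?U (\<lambda>q. f (coord ?c q))"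
    by (rule smooth_in_compose[OF oU sc _ fs]) auto
  moreover have "dir_deriv A (\<lambda>q. f (coord ?c q)) q x = \<tau> q x" if q: "q \<in> ?U" and x: "x \<in> tangent_space A q" for q x
  proof -
    have qc: "q \<in> dom_chart ?c" and qb: "coord ?c q \<in> ball (coord ?c p) r" using q by auto
    have "dir_deriv A (\<lambda>q. f (coord ?c q)) q x = frechet_derivative f (at (coord ?c q)) (dir_deriv A (coord ?c) q x)"
      by (rule dir_deriv_compose[OF sc q smooth_on_differentiable[OF fs qb]])
    also have "\<dots> = a (coord ?c q) \<bullet> x ?c"
      using frechet_derivative_eqI[OF f[OF qb]] tangent_coord[OF x c(1) qc] by simp
    also have "\<dots> = \<tau> q x"
      using aw[of "coord ?c q" "x ?c"] ch(5)[OF qc] coord_field_eq[OF x c(1) qc] qc by simp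
    finally show ?thesis .
  qed
  ultimately show ?thesis using oU c(2) r(1) by (intro exI[of _ ?U] exI[of _ "\<lambda>q. f (coord ?c q)"]) auto
qed

text \<open>Two local primitives have a difference with zero derivative, hence locally constant:
  this is the compatibility required for continuation. The resulting function is locally a smooth
  primitive plus a constant.\<close>

lemma closed_form_exact:
  fixes \<tau> :: "'a \<Rightarrow> ('a, 'e) tvec \<Rightarrow> real"
  assumes sc: "simply_connected (UNIV :: 'a set)"
    and lin: "\<And>p v w a b. v \<in> tangent_space A p \<Longrightarrow> w \<in> tangent_space A p \<Longrightarrow>
      \<tau> p (\<lambda>c. a *\<^sub>R v c + b *\<^sub>R w c) = a * \<tau> p v + b * \<tau> p w"
    and sm: "\<And>X. X \<in> vector_fields A \<Longrightarrow> smooth_in A UNIV (\<lambda>q. \<tau> q (X q))"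
    and closed: "\<And>X Y p. X \<in> vector_fields A \<Longrightarrow> Y \<in> vector_fields A \<Longrightarrow>
      dir_deriv A (\<lambda>q. \<tau> q (Y q)) p (X p) - dir_deriv A (\<lambda>q. \<tau> q (X q)) p (Y p) = \<tau> p (lie_bracket A X Y p)"
  shows "\<exists>F. smooth_in A UNIV F \<and> (\<forall>p. \<forall>x\<in>tangent_space A p. dir_deriv A F p x = \<tau> p x)"
proof -
  define \<F> where "\<F> = {(U, f). open U \<and> smooth_in A U f \<and>
     (\<forall>q\<in>U. \<forall>x\<in>tangent_space A q. dir_deriv A f q x = \<tau> q x)}"
  have ex: "\<exists>U f. (U, f) \<in> \<F> \<and> p \<in> U" for p
    using closed_form_local_primitive[of \<tau> p, OF lin sm closed] unfolding \<F>_def by blast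
  interpret local_primitives \<F>
  proof
    show "open U" if "(U, f) \<in> \<F>" for U f using that by (simp add: \<F>_def)
    show "\<exists>U f. (U, f) \<in> \<F> \<and> p \<in> U" for p by (rule ex)
    fix U f V h p assume f: "(U, f) \<in> \<F>" and h: "(V, h) \<in> \<F>" and p: "p \<in> U" "p \<in> V"
    have o: "open (U \<inter> V)" using f h by (auto simp: \<F>_def)
    have sf: "smooth_in A (U \<inter> V) f" and sh: "smooth_in A (U \<inter> V) h"
      using f h by (auto simp: \<F>_def intro: smooth_in_subset)
    have "\<forall>\<^sub>F q in nhds p. f q - h q = f p - h p"
    proof (rule dir_deriv_zero_locally_constant[OF smooth_in_diff[OF o sf sh] o])
      show "dir_deriv A (\<lambda>q. f q - h q) q v = 0" if "q \<in> U \<inter> V" "v \<in> tangent_space A q" for q v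
        using dir_deriv_diff[OF sf sh that(1)] that f h by (auto simp: \<F>_def)
    qed (use p in auto)
    then show "\<forall>\<^sub>F q in nhds p. f q - f p = h q - h p" by eventually_elim simp
  qed
  have "\<exists>F. \<forall>U f p. (U, f) \<in> \<F> \<longrightarrow> p \<in> U \<longrightarrow> (\<forall>\<^sub>F q in nhds p. F q - F p = f q - f p)"
    by (rule global_primitive_exists[OF sc]) (rule locally_path_connected[OF open_dom])
  then obtain F where F: "\<And>U f p. (U, f) \<in> \<F> \<Longrightarrow> p \<in> U \<Longrightarrow> \<forall>\<^sub>F q in nhds p. F q - F p = f q - f p" by blast
  have loc: "\<exists>V. open V \<and> p \<in> V \<and> smooth_in A V F \<and> (\<forall>x\<in>tangent_space A p. dir_deriv A F p x = \<tau> p x)" for p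
  proof -
    obtain U f where f: "(U, f) \<in> \<F>" "p \<in> U" using ex by blast
    obtain W where W: "open W" "p \<in> W" "\<forall>q\<in>W. F q - F p = f q - f p"
      using F[OF f] unfolding eventually_nhds by blast
    have o: "open (W \<inter> U)" using W(1) open_dom[OF f(1)] by (rule open_Int)
    have sf: "smooth_in A (W \<inter> U) f" using f(1) by (auto simp: \<F>_def intro: smooth_in_subset)
    let ?h = "\<lambda>q. f q + (F p - f p)"
    have sh: "smooth_in A (W \<inter> U) ?h" by (rule smooth_in_add[OF o sf smooth_in_const])
    have eq: "?h q = F q" if "q \<in> W \<inter> U" for q
    proof -
      have "F q - F p = f q - f p" using W(3) that by blast
      then show ?thesis by simp
    qed
    have "smooth_in A (W \<inter> U) F" by (rule smooth_in_cong[OF sh o eq])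
    moreover have "dir_deriv A F p x = \<tau> p x" if "x \<in> tangent_space A p" for x
    proof -
      have "dir_deriv A F p x = dir_deriv A ?h p x"
        by (rule dir_deriv_cong[OF sh o _ eq, symmetric]) (use W f in auto)
      also have "\<dots> = dir_deriv A f p x"
        using dir_deriv_add[OF sf smooth_in_const, of p] W f by (simp add: dir_deriv_const)
      finally show ?thesis using f that by (auto simp: \<F>_def)
    qed
    ultimately show ?thesis using o W(2) f(2) by blast
  qed
  have "smooth_in A UNIV F" by (rule smooth_in_local) (use loc in blast)
  then show ?thesis using loc by blast
qed

end

subsection \<open>The normal bundle of a spacelike submanifold of codimension two\<close>

context smooth_manifold_map
begin

lemma differential_coord_field_linear:
  assumes c: "c \<in> A" "q \<in> dom_chart c"
  shows "linear (\<lambda>u. differential A B f q (coord_field A c u q) d)"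
proof (rule linearI)
  have *: "coord_field A c (a *\<^sub>R u + b *\<^sub>R v) q = (\<lambda>d. a *\<^sub>R coord_field A c u q d + b *\<^sub>R coord_field A c v q d)" for a b u v
    by (rule ext) (simp add: linear_add[OF src.coord_field_linear[OF c]] linear_scale[OF src.coord_field_linear[OF c]])
  fix u v and r :: real
  show "differential A B f q (coord_field A c (u + v) q) d =
      differential A B f q (coord_field A c u q) d + differential A B f q (coord_field A c v q) d"
    using *[of 1 u 1 v] differential_lincomb[of q 1 "coord_field A c u q" 1 "coord_field A c v q"] by simp
  show "differential A B f q (coord_field A c (r *\<^sub>R u) q) d = r *\<^sub>R differential A B f q (coord_field A c u q) d"
    using *[of r u 0 u] differential_lincomb[of q r "coord_field A c u q" 0 "coord_field A c u q"] by simp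
qed

lemma smooth_in_differential_coord_field:
  assumes c: "c \<in> A" and d: "d \<in> B"
  shows "smooth_in A (dom_chart c \<inter> f -` dom_chart d) (\<lambda>q. differential A B f q (coord_field A c u q) d)"
proof (rule src.smooth_in_chartI[OF c])
  note o = open_dom_preimage[OF d]
  show "open (dom_chart c \<inter> f -` dom_chart d)" using src.chart_homeomorphism(1)[OF c] o by (rule open_Int)
  have op: "open (coord c ` (dom_chart c \<inter> f -` dom_chart d))" by (rule src.open_coord_image[OF c o])
  show "smooth_on (coord c ` (dom_chart c \<inter> f -` dom_chart d))
      (\<lambda>x. differential A B f (chart_inv c x) (coord_field A c u (chart_inv c x)) d)"
  proof (rule smooth_on_cong[OF smooth_on_frechet[OF src.smooth_inD[OF smooth_in_coord_map[OF d] c]] op])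
    fix x assume x: "x \<in> coord c ` (dom_chart c \<inter> f -` dom_chart d)"
    note q = src.in_coord_imageD[OF c x]
    show "frechet_derivative (\<lambda>x. coord d (f (chart_inv c x))) (at x) u =
        differential A B f (chart_inv c x) (coord_field A c u (chart_inv c x)) d"
      using src.dir_deriv_coord_field[OF smooth_in_coord_map[OF d] o q(2) c q(1), of u] q d
      by (simp add: differential_component)
  qed
qed auto

end

context lorentz_manifold
begin

lemma metric_lincomb_right:
  assumes "u \<in> tangent_space M p" "v \<in> tangent_space M p" "w \<in> tangent_space M p"
  shows "g p w (\<lambda>c. a *\<^sub>R u c + b *\<^sub>R v c) = a * g p w u + b * g p w v"
  using metric_lincomb[OF assms, of a b] assms by (simp add: metric_sym tangent_lincomb)

lemma metric_diff:
  assumes "u \<in> tangent_space M p" "v \<in> tangent_space M p" "w \<in> tangent_space M p"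
  shows "g p (\<lambda>c. u c - v c) w = g p u w - g p v w"
  using metric_lincomb[OF assms, of 1 "-1"] by simp

lemma metric_add:
  assumes "u \<in> tangent_space M p" "v \<in> tangent_space M p" "w \<in> tangent_space M p"
  shows "g p (\<lambda>c. u c + v c) w = g p u w + g p v w"
  using metric_lincomb[OF assms, of 1 1] by simp

lemma null_orthogonal_timelike:
  assumes "u \<in> tangent_space M p" "t \<in> tangent_space M p" "g p u u = 0" "g p t t < 0" "g p u t = 0"
  shows "u = (\<lambda>c. 0)"
proof (rule tangent_eqI[OF assms(1) tangent_zero chart_at])
  show "u (chart_at M p) = 0"
    by (rule lorentz_form_null_orthogonal_timelike[OF metric_lorentz[OF chart_at], of p _ "t (chart_at M p)"])
      (use assms metric_in_chart[OF _ _ chart_at] in auto)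
qed

end

section \<open>Tangential and normal parts along the immersion\<close>

locale spacelike_codim_two = lorentz_map S M \<psi> g
  for S :: "('s::{t2_space, second_countable_topology}, 'd::euclidean_space) chart set"
    and M :: "('m::{t2_space, second_countable_topology}, 'e::euclidean_space) chart set"
    and \<psi> :: "'s \<Rightarrow> 'm" and g :: "('m, 'e) metric" +
  assumes spacelike: "spacelike_submanifold S M g \<psi>"
    and codim: "DIM('e) = DIM('d) + 2"
begin

abbreviation nsp where "nsp \<equiv> normal_space S M g \<psi>"
abbreviation nproj where "nproj \<equiv> normal_proj S M g \<psi>"
abbreviation gg where "gg p \<equiv> g (\<psi> p)"

lemma positive_definite:
  assumes "x \<in> tangent_space S p" "gg p (df p x) (df p x) = 0"
  shows "x = (\<lambda>c. 0)"
proof (rule ccontr)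
  assume "x \<noteq> (\<lambda>c. 0)"
  then have "gg p (df p x) (df p x) > 0" using assms(1) spacelike unfolding spacelike_submanifold_def by blast
  with assms(2) show False by simp
qed

lemma df_zero: "df p (\<lambda>c. 0) = (\<lambda>c. 0)"
  using differential_lincomb[of p 0 "\<lambda>c. 0" 0 "\<lambda>c. 0"] by simp

lemma df_diff: "df p (\<lambda>c. x c - y c) = (\<lambda>c. df p x c - df p y c)"
  using differential_lincomb[of p 1 x "-1" y] by simp

lemma nsp_tangent: "n \<in> nsp p \<Longrightarrow> n \<in> tangent_space M (\<psi> p)"
  and nsp_orthogonal: "n \<in> nsp p \<Longrightarrow> x \<in> tangent_space S p \<Longrightarrow> gg p n (df p x) = 0"
  and nsp_orthogonal': "n \<in> nsp p \<Longrightarrow> x \<in> tangent_space S p \<Longrightarrow> gg p (df p x) n = 0"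
  using metric_sym[OF differential_tangent, of n p x] by (auto simp: normal_space_def)

lemma nsp_lincomb:
  assumes "m \<in> nsp p" "n \<in> nsp p"
  shows "(\<lambda>c. a *\<^sub>R m c + b *\<^sub>R n c) \<in> nsp p"
  using assms metric_lincomb[OF nsp_tangent[OF assms(1)] nsp_tangent[OF assms(2)] differential_tangent]
  by (auto simp: normal_space_def tgt.tangent_lincomb)

text \<open>The first fundamental form in the coordinates of \<open>c\<close>.\<close>

definition induced :: "('s, 'd) chart \<Rightarrow> 's \<Rightarrow> 'd \<Rightarrow> 'd \<Rightarrow> real" where
  "induced c q u v = gg q (df q (coord_field S c u q)) (df q (coord_field S c v q))"

lemma induced_in_chart:
  assumes "d \<in> M" "\<psi> q \<in> dom_chart d"
  shows "induced c q u v = mc d (\<psi> q) (df q (coord_field S c u q) d) (df q (coord_field S c v q) d)"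
  unfolding induced_def by (rule metric_in_chart[OF differential_tangent differential_tangent assms])

lemma induced_bilinear:
  assumes c: "c \<in> S" "q \<in> dom_chart c"
  shows "bilinear (induced c q)"
proof -
  note l = differential_coord_field_linear[OF c]
  note d = tgt.chart_at[of "\<psi> q"]
  show ?thesis
    unfolding bilinear_def induced_in_chart[OF d]
    by (auto intro!: linearI simp: linear_add[OF l] linear_scale[OF l] mc_add_left[OF d] mc_add_right[OF d]
        mc_scale_left[OF d] mc_scale_right[OF d])
qed

lemma induced_nondegenerate:
  assumes c: "c \<in> S" "q \<in> dom_chart c" and "\<And>v. induced c q u v = 0"
  shows "u = 0"
proof -
  have "coord_field S c u q = (\<lambda>c. 0)"
    by (rule positive_definite[OF src.coord_field_tangent[OF c]]) (use assms(3)[of u] in \<open>simp add: induced_def\<close>)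
  then show ?thesis using src.coord_field_self[OF c, of u] by simp
qed

text \<open>The pairing of \<open>w\<close> with tangent vectors is a linear functional, and the
  nondegenerate induced metric represents it by a tangent vector, the tangential part of
  \<open>w\<close>.\<close>

lemma decomposition:
  assumes w: "w \<in> tangent_space M (\<psi> p)"
  shows "\<exists>x\<in>tangent_space S p. (\<lambda>c. w c - df p x c) \<in> nsp p"
proof -
  let ?c = "chart_at S p"
  note c = src.chart_at[of p] and d = tgt.chart_at[of "\<psi> p"]
  note l = differential_coord_field_linear[OF c]
  have "linear (\<lambda>v. gg p w (df p (coord_field S ?c v p)))"
    unfolding metric_in_chart[OF w differential_tangent d]
    by (auto intro!: linearI simp: linear_add[OF l] linear_scale[OF l] mc_add_right[OF d] mc_scale_right[OF d])
  from bilinear_form_represents[OF induced_bilinear[OF c] induced_nondegenerate[OF c] this]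
  obtain u where u: "\<And>v. induced ?c p u v = gg p w (df p (coord_field S ?c v p))" by blast
  let ?x = "coord_field S ?c u p"
  have "gg p (\<lambda>c. w c - df p ?x c) (df p y) = 0" if y: "y \<in> tangent_space S p" for y
    using u[of "y ?c"] src.coord_field_eq[OF y c] metric_diff[OF w differential_tangent[of p ?x] differential_tangent[of p y]]
    by (simp add: induced_def)
  then have "(\<lambda>c. w c - df p ?x c) \<in> nsp p"
    using tgt.tangent_diff[OF w differential_tangent] by (simp add: normal_space_def)
  then show ?thesis using src.coord_field_tangent[OF c] by blast
qed

text \<open>The difference of the tangential parts maps to a vector that is both tangent and normal,
  hence orthogonal to itself, and the induced metric is positive definite.\<close>

lemma decomposition_unique:
  assumes x: "x \<in> tangent_space S p" "x' \<in> tangent_space S p" and n: "n \<in> nsp p" "n' \<in> nsp p"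
    and eq: "(\<lambda>c. df p x c + n c) = (\<lambda>c. df p x' c + n' c)"
  shows "x = x'" "n = n'"
proof -
  let ?y = "\<lambda>c. x c - x' c"
  have y: "?y \<in> tangent_space S p" by (rule src.tangent_diff[OF x])
  have "df p ?y = (\<lambda>c. 1 *\<^sub>R n' c + (-1) *\<^sub>R n c)"
    unfolding df_diff using fun_cong[OF eq] by (auto simp: fun_eq_iff algebra_simps)
  then have "df p ?y \<in> nsp p" using nsp_lincomb[OF n(2,1), of 1 "-1"] by simp
  then have "?y = (\<lambda>c. 0)" by (intro positive_definite[OF y] nsp_orthogonal[OF _ y])
  then have *: "x c = x' c" for c using fun_cong[of ?y "\<lambda>c. 0" c] by simp
  then show x': "x = x'" by blast
  have "n c = n' c" for c using fun_cong[OF eq, of c] x' by simp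
  then show "n = n'" by blast
qed

lemma nproj_eqI:
  assumes "n \<in> nsp p" "x \<in> tangent_space S p" "w = (\<lambda>c. df p x c + n c)"
  shows "nproj p w = n"
  unfolding normal_proj_def
proof (rule the_equality)
  show "n \<in> nsp p \<and> (\<exists>x\<in>tangent_space S p. w = (\<lambda>c. df p x c + n c))" using assms by blast
  fix n' assume "n' \<in> nsp p \<and> (\<exists>x\<in>tangent_space S p. w = (\<lambda>c. df p x c + n' c))"
  then obtain x' where "n' \<in> nsp p" "x' \<in> tangent_space S p" "w = (\<lambda>c. df p x' c + n' c)" by blast
  then show "n' = n" using decomposition_unique(2)[of x' p x n' n] assms by simp
qed

lemma nproj_decomposition:
  assumes w: "w \<in> tangent_space M (\<psi> p)"
  shows "\<exists>x\<in>tangent_space S p. w = (\<lambda>c. df p x c + nproj p w c)" "nproj p w \<in> nsp p"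
proof -
  obtain x where x: "x \<in> tangent_space S p" "(\<lambda>c. w c - df p x c) \<in> nsp p" using decomposition[OF w] by blast
  have e: "nproj p w = (\<lambda>c. w c - df p x c)" by (rule nproj_eqI[OF x(2,1)]) simp
  show "nproj p w \<in> nsp p" using x(2) e by simp
  show "\<exists>x\<in>tangent_space S p. w = (\<lambda>c. df p x c + nproj p w c)" using x(1) by (intro bexI[of _ x]) (simp_all add: e)
qed

lemma metric_nproj_right:
  assumes "w \<in> tangent_space M (\<psi> p)" "n \<in> nsp p"
  shows "gg p w n = gg p (nproj p w) n"
proof -
  obtain x where x: "x \<in> tangent_space S p" "w = (\<lambda>c. df p x c + nproj p w c)"
    using nproj_decomposition(1)[OF assms(1)] by blast
  have "gg p w n = gg p (df p x) n + gg p (nproj p w) n"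
    by (subst x(2), rule metric_add[OF differential_tangent nsp_tangent[OF nproj_decomposition(2)[OF assms(1)]] nsp_tangent[OF assms(2)]])
  then show ?thesis using nsp_orthogonal'[OF assms(2) x(1)] by simp
qed

text \<open>The tangential coefficients solve a linear system whose matrix is the induced metric and
  whose right-hand side is the pairing of \<open>W\<close> with coordinate directions; both are
  smooth, so the tangential part is, and it is subtracted from \<open>W\<close>.\<close>

lemma normal_proj_field:
  assumes W: "fld W"
  shows "fld (\<lambda>q. nproj q (W q))"
  unfolding field_along_iff
proof (intro conjI allI ballI)
  show "nproj q (W q) \<in> tangent_space M (\<psi> q)" for q
    by (rule nsp_tangent[OF nproj_decomposition(2)[OF fld_tangent[OF W]]])
  \<comment> \<open>The tangential parts are selected point by point, without any regularity;
    smoothness is recovered from the equations \<open>eq\<close>.\<close>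
  obtain t where t: "\<And>q. t q \<in> tangent_space S q" "\<And>q. W q = (\<lambda>c. df q (t q) c + nproj q (W q) c)"
    using nproj_decomposition(1)[OF fld_tangent[OF W]] by metis
  fix d assume d: "d \<in> M"
  show "smooth_in S (\<psi> -` dom_chart d) (\<lambda>q. nproj q (W q) d)"
  proof (rule src.smooth_in_local)
    fix p assume p: "p \<in> \<psi> -` dom_chart d"
    let ?c = "chart_at S p"
    note c = src.chart_at[of p]
    let ?U = "dom_chart ?c \<inter> \<psi> -` dom_chart d"
    have o: "open ?U" using src.chart_homeomorphism(1)[OF c(1)] open_dom_preimage[OF d] by (rule open_Int)
    let ?E = "\<lambda>q u. df q (coord_field S ?c u q) d"
    have sE: "smooth_in S ?U (\<lambda>q. ?E q u)" for u by (rule smooth_in_differential_coord_field[OF c(1) d])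
    have linE: "linear (?E q)" if "q \<in> ?U" for q
      by (rule differential_coord_field_linear[OF c(1)]) (use that in auto)
    have sW: "smooth_in S ?U (\<lambda>q. W q d)" by (rule src.smooth_in_subset[OF fld_smooth[OF W d]]) auto
    have sm: "smooth_in S ?U (\<lambda>q. mc d (\<psi> q) u v)" for u v
      by (rule src.smooth_in_subset[OF smooth_in_pullback[OF smooth_in_mc[OF d] tgt.chart_homeomorphism(1)[OF d]]]) auto
    have bil: "bilinear (mc d (\<psi> q))" if "q \<in> ?U" for q using mc_bilinear[OF d] that by simp
    have s1: "smooth_in S ?U (\<lambda>q. induced ?c q u v)" for u v
      by (rule src.smooth_in_cong[OF src.smooth_in_bilinear_family[OF o bil sm sE[of u] sE[of v]] o])
        (use induced_in_chart[OF d] in auto)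
    have s2: "smooth_in S ?U (\<lambda>q. gg q (W q) (df q (coord_field S ?c v q)))" for v
      by (rule src.smooth_in_cong[OF src.smooth_in_bilinear_family[OF o bil sm sW sE[of v]] o])
        (use metric_in_chart[OF fld_tangent[OF W] differential_tangent d] in auto)
    have eq: "induced ?c q (t q ?c) v = gg q (W q) (df q (coord_field S ?c v q))" if q: "q \<in> ?U" for q v
    proof -
      have qc: "q \<in> dom_chart ?c" using q by simp
      note y = src.coord_field_tangent[OF c(1) qc, of v]
      have "gg q (W q) (df q (coord_field S ?c v q)) =
          gg q (df q (t q)) (df q (coord_field S ?c v q)) + gg q (nproj q (W q)) (df q (coord_field S ?c v q))"
        by (subst t(2), rule metric_add[OF differential_tangent nsp_tangent[OF nproj_decomposition(2)[OF fld_tangent[OF W]]] differential_tangent])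
      also have "gg q (nproj q (W q)) (df q (coord_field S ?c v q)) = 0"
        by (rule nsp_orthogonal[OF nproj_decomposition(2)[OF fld_tangent[OF W]] y])
      finally show ?thesis using src.coord_field_eq[OF t(1) c(1) qc] by (simp add: induced_def)
    qed
    have so: "dom_chart ?c \<inter> ?U = ?U" by auto
    have oO: "open (coord ?c ` ?U)" using src.open_coord_image[OF c(1) o] by (simp add: so)
    have inU: "chart_inv ?c x \<in> ?U" if "x \<in> coord ?c ` ?U" for x
      using src.in_coord_imageD(1,2)[OF c(1), of x "\<psi> -` dom_chart d"] that by blast
    have "smooth_on (coord ?c ` ?U) (\<lambda>x. t (chart_inv ?c x) ?c)"
    proof (rule smooth_on_bilinear_system[where B = "\<lambda>x. induced ?c (chart_inv ?c x)"
          and \<alpha> = "\<lambda>x v. gg (chart_inv ?c x) (W (chart_inv ?c x)) (df (chart_inv ?c x) (coord_field S ?c v (chart_inv ?c x)))", OF oO])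
      fix y assume "y \<in> coord ?c ` ?U"
      note i = inU[OF this]
      then have ic: "chart_inv ?c y \<in> dom_chart ?c" by simp
      show "bilinear (induced ?c (chart_inv ?c y))" by (rule induced_bilinear[OF c(1) ic])
      show "u = 0" if "\<And>v. induced ?c (chart_inv ?c y) u v = 0" for u
        by (rule induced_nondegenerate[OF c(1) ic that])
      show "induced ?c (chart_inv ?c y) (t (chart_inv ?c y) ?c) v =
         gg (chart_inv ?c y) (W (chart_inv ?c y)) (df (chart_inv ?c y) (coord_field S ?c v (chart_inv ?c y)))" for v
        by (rule eq[OF i])
    next
      show "smooth_on (coord ?c ` ?U) (\<lambda>x. induced ?c (chart_inv ?c x) u v)" for u v
        using src.smooth_inD[OF s1 c(1)] by (simp add: so)
      show "smooth_on (coord ?c ` ?U) (\<lambda>x. gg (chart_inv ?c x) (W (chart_inv ?c x)) (df (chart_inv ?c x) (coord_field S ?c v (chart_inv ?c x))))" for v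
        using src.smooth_inD[OF s2 c(1)] by (simp add: so)
    qed
    then have st: "smooth_in S ?U (\<lambda>q. t q ?c)" by (intro src.smooth_in_chartI[OF c(1) o]) auto
    have "smooth_in S ?U (\<lambda>q. W q d - ?E q (t q ?c))"
      by (intro src.smooth_in_diff o sW src.smooth_in_linear_family[OF o linE sE st])
    then have "smooth_in S ?U (\<lambda>q. nproj q (W q) d)"
    proof (rule src.smooth_in_cong[OF _ o])
      fix q assume "q \<in> ?U"
      then have "coord_field S ?c (t q ?c) q = t q" using src.coord_field_eq[OF t(1) c(1)] by simp
      then show "W q d - ?E q (t q ?c) = nproj q (W q) d" using fun_cong[OF t(2), of q d] by simp
    qed
    then show "\<exists>V. open V \<and> p \<in> V \<and> smooth_in S V (\<lambda>q. nproj q (W q) d)" using o p c(2) by blast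
  qed
qed

lemma normal_fields_iff: "\<zeta> \<in> normal_fields S M g \<psi> \<longleftrightarrow> fld \<zeta> \<and> (\<forall>p. \<zeta> p \<in> nsp p)"
  by (simp add: normal_fields_def)

section \<open>Null frames of the normal plane\<close>

definition null_frame :: "('s \<Rightarrow> ('m, 'e) tvec) \<Rightarrow> ('s \<Rightarrow> ('m, 'e) tvec) \<Rightarrow> bool" where
  "null_frame \<xi> \<eta> \<longleftrightarrow> \<xi> \<in> normal_fields S M g \<psi> \<and> \<eta> \<in> normal_fields S M g \<psi> \<and>
     (\<forall>p. gg p (\<xi> p) (\<xi> p) = 0 \<and> gg p (\<eta> p) (\<eta> p) = 0 \<and> gg p (\<xi> p) (\<eta> p) = 1)"

lemma null_frameD:
  assumes "null_frame \<xi> \<eta>"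
  shows "fld \<xi>" "fld \<eta>" "\<xi> p \<in> nsp p" "\<eta> p \<in> nsp p"
    "gg p (\<xi> p) (\<xi> p) = 0" "gg p (\<eta> p) (\<eta> p) = 0" "gg p (\<xi> p) (\<eta> p) = 1" "gg p (\<eta> p) (\<xi> p) = 1"
proof -
  show *: "fld \<xi>" "fld \<eta>" "\<xi> p \<in> nsp p" "\<eta> p \<in> nsp p"
    "gg p (\<xi> p) (\<xi> p) = 0" "gg p (\<eta> p) (\<eta> p) = 0" "gg p (\<xi> p) (\<eta> p) = 1"
    using assms by (auto simp: null_frame_def normal_fields_iff)
  show "gg p (\<eta> p) (\<xi> p) = 1" using metric_sym[OF nsp_tangent[OF *(4)] nsp_tangent[OF *(3)]] *(7) by simp
qed

lemma null_frame_comb: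
  assumes F: "null_frame \<xi> \<eta>"
  shows "gg p (\<lambda>c. a *\<^sub>R \<xi> p c + b *\<^sub>R \<eta> p c) (\<eta> p) = a" "gg p (\<lambda>c. a *\<^sub>R \<xi> p c + b *\<^sub>R \<eta> p c) (\<xi> p) = b"
  using null_frameD(3-8)[OF F, of p]
    metric_lincomb[OF nsp_tangent[OF null_frameD(3)[OF F]] nsp_tangent[OF null_frameD(4)[OF F]]]
  by (simp_all add: nsp_tangent)

lemma null_line:
  assumes F: "null_frame \<xi> \<eta>" and n: "n \<in> nsp p" "gg p n (\<xi> p) = 0"
  shows "\<exists>a. n = (\<lambda>c. a *\<^sub>R \<xi> p c)"
proof -
  let ?c = "chart_at S p" and ?d = "chart_at M (\<psi> p)"
  note c = src.chart_at[of p] and d = tgt.chart_at[of "\<psi> p"]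
  note \<xi> = null_frameD(1,2)[OF F] null_frameD(3-8)[OF F, of p]
  let ?E = "\<lambda>u. df p (coord_field S ?c u p) ?d"
  have linE: "linear ?E" by (rule differential_coord_field_linear[OF c])
  have E0: "coord_field S ?c u p = (\<lambda>c. 0)" if "mc ?d (\<psi> p) (?E u) (?E u) = 0" for u
    by (rule positive_definite[OF src.coord_field_tangent[OF c]])
      (use that metric_in_chart[OF differential_tangent differential_tangent d] in simp)
  have "\<exists>a. n ?d = a *\<^sub>R \<xi> p ?d"
  proof (rule null_line_of_codim_two[OF mc_bilinear[OF d] mc_nondegenerate[OF d] mc_sym[OF d] codim linE])
    show "inj ?E"
    proof (subst linear_injective_0[OF linE], intro allI impI)
      fix u assume "?E u = 0"
      then have "coord_field S ?c u p = (\<lambda>c. 0)" using E0[of u] mc_scale_left[OF d, of 0 0 0] by simp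
      then show "u = 0" using src.coord_field_self[OF c, of u] by simp
    qed
    \<comment> \<open>Tangent vectors are spacelike, so a null vector tangent to S would vanish,
      contradicting its product 1 with \<open>\<eta>\<close>.\<close>
    show "\<xi> p ?d \<notin> range ?E"
    proof
      assume "\<xi> p ?d \<in> range ?E"
      then obtain u where u: "\<xi> p ?d = ?E u" by blast
      then have eq: "\<xi> p = df p (coord_field S ?c u p)"
        by (intro tgt.tangent_eqI[OF nsp_tangent[OF \<xi>(3)] differential_tangent d])
      have "mc ?d (\<psi> p) (?E u) (?E u) = 0"
        using \<xi>(5) metric_in_chart[OF nsp_tangent[OF \<xi>(3)] nsp_tangent[OF \<xi>(3)] d] u by simp
      from E0[OF this] have "\<xi> p = (\<lambda>c. 0)" using eq df_zero by simp
      then show False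
        using \<xi>(7) metric_in_chart[OF nsp_tangent[OF \<xi>(3)] nsp_tangent[OF \<xi>(4)] d] mc_scale_left[OF d, of 0 0] by simp
    qed
    show "mc ?d (\<psi> p) (\<xi> p ?d) (?E u) = 0" for u
      using nsp_orthogonal[OF \<xi>(3) src.coord_field_tangent[OF c]] metric_in_chart[OF nsp_tangent[OF \<xi>(3)] differential_tangent d] by simp
    show "mc ?d (\<psi> p) (n ?d) (?E u) = 0" for u
      using nsp_orthogonal[OF n(1) src.coord_field_tangent[OF c]] metric_in_chart[OF nsp_tangent[OF n(1)] differential_tangent d] by simp
    show "mc ?d (\<psi> p) (\<xi> p ?d) (\<xi> p ?d) = 0" "mc ?d (\<psi> p) (n ?d) (\<xi> p ?d) = 0"
      using \<xi>(5) n metric_in_chart[OF nsp_tangent[OF \<xi>(3)] nsp_tangent[OF \<xi>(3)] d]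
        metric_in_chart[OF nsp_tangent[OF n(1)] nsp_tangent[OF \<xi>(3)] d] by simp_all
  qed
  then obtain a where a: "n ?d = a *\<^sub>R \<xi> p ?d" by blast
  have "n = (\<lambda>c. a *\<^sub>R \<xi> p c)"
    by (rule tgt.tangent_eqI[OF nsp_tangent[OF n(1)] tgt.tangent_scaleR[OF nsp_tangent[OF \<xi>(3)]] d a])
  then show ?thesis by blast
qed

text \<open>Subtracting the multiple of \<open>\<eta>\<close> with coefficient
  \<open>gg p n (\<xi> p)\<close> leaves a normal vector orthogonal to \<open>\<xi>\<close>, hence a
  multiple of \<open>\<xi>\<close> by \<open>null_line\<close>.\<close>

lemma normal_expand:
  assumes F: "null_frame \<xi> \<eta>" and n: "n \<in> nsp p"
  shows "n = (\<lambda>c. gg p n (\<eta> p) *\<^sub>R \<xi> p c + gg p n (\<xi> p) *\<^sub>R \<eta> p c)"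
proof -
  note \<xi> = null_frameD(1,2)[OF F] null_frameD(3-8)[OF F, of p]
  let ?b = "gg p n (\<xi> p)"
  let ?m = "\<lambda>c. 1 *\<^sub>R n c + (- ?b) *\<^sub>R \<eta> p c"
  have "?m \<in> nsp p" by (rule nsp_lincomb[OF n \<xi>(4)])
  moreover have "gg p ?m (\<xi> p) = 0"
    using metric_lincomb[OF nsp_tangent[OF n] nsp_tangent[OF \<xi>(4)] nsp_tangent[OF \<xi>(3)], of 1 "- ?b"] \<xi>(8) by simp
  ultimately obtain a where a: "?m = (\<lambda>c. a *\<^sub>R \<xi> p c)" using null_line[OF F] by blast
  have e: "n = (\<lambda>c. a *\<^sub>R \<xi> p c + ?b *\<^sub>R \<eta> p c)"
    using fun_cong[OF a] by (auto simp: fun_eq_iff algebra_simps)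
  have "gg p n (\<eta> p) = a" by (subst e) (rule null_frame_comb(1)[OF F])
  with e show ?thesis by simp
qed

lemma nproj_frame:
  assumes F: "null_frame \<xi> \<eta>" and w: "w \<in> tangent_space M (\<psi> p)"
  shows "nproj p w = (\<lambda>c. gg p w (\<eta> p) *\<^sub>R \<xi> p c + gg p w (\<xi> p) *\<^sub>R \<eta> p c)"
  using normal_expand[OF F nproj_decomposition(2)[OF w]] metric_nproj_right[OF w] null_frameD(3,4)[OF F] by simp

lemma null_frame_exists:
  assumes \<xi>: "\<xi> \<in> normal_fields S M g \<psi>" "\<And>p. lightlike g (\<psi> p) (\<xi> p)"
    and T: "T \<in> vector_fields M" "\<And>m. g m (T m) (T m) < 0"
  shows "\<exists>\<eta>. null_frame \<xi> \<eta>"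
proof -
  have f\<xi>: "fld \<xi>" and n\<xi>: "\<And>p. \<xi> p \<in> nsp p" using \<xi>(1) by (auto simp: normal_fields_iff)
  have \<xi>0: "gg p (\<xi> p) (\<xi> p) = 0" "\<xi> p \<noteq> (\<lambda>c. 0)" for p using \<xi>(2)[of p] by (auto simp: lightlike_def)
  have fT: "fld (\<lambda>q. T (\<psi> q))" by (rule vector_field_pullback[OF T(1)])
  define \<nu> where "\<nu> q = nproj q (T (\<psi> q))" for q
  have f\<nu>: "fld \<nu>" unfolding \<nu>_def by (rule normal_proj_field[OF fT])
  have n\<nu>: "\<nu> p \<in> nsp p" for p unfolding \<nu>_def by (rule nproj_decomposition(2)[OF fld_tangent[OF fT]])
  define s where "s q = gg q (\<xi> q) (\<nu> q)" for q
  define k where "k q = gg q (\<nu> q) (\<nu> q)" for q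
  have s0: "s p \<noteq> 0" for p
  proof
    assume "s p = 0"
    then have "gg p (\<nu> p) (\<xi> p) = 0" using metric_sym[OF nsp_tangent[OF n\<xi>] nsp_tangent[OF n\<nu>]] by (simp add: s_def)
    then have "gg p (T (\<psi> p)) (\<xi> p) = 0" using metric_nproj_right[OF fld_tangent[OF fT] n\<xi>] by (simp add: \<nu>_def)
    then have "gg p (\<xi> p) (T (\<psi> p)) = 0" using metric_sym[OF nsp_tangent[OF n\<xi>] fld_tangent[OF fT]] by simp
    then have "\<xi> p = (\<lambda>c. 0)"
      by (rule null_orthogonal_timelike[OF nsp_tangent[OF n\<xi>] fld_tangent[OF fT] \<xi>0(1) T(2)])
    then show False using \<xi>0(2) by blast
  qed
  \<comment> \<open>For \<open>\<eta> = a \<nu> + b \<xi>\<close> the condition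
    \<open>g(\<xi>, \<eta>) = 1\<close> reads \<open>a s = 1\<close>, and
    \<open>g(\<eta>, \<eta>) = 0\<close> reads \<open>a (a k + 2 b s) = 0\<close>; these determine
    \<open>a\<close> and \<open>b\<close>.\<close>
  define a where "a q = inverse (s q)" for q
  define b where "b q = - (k q * inverse (2 * s q * s q))" for q
  define \<eta> where "\<eta> q = (\<lambda>c. a q *\<^sub>R \<nu> q c + b q *\<^sub>R \<xi> q c)" for q
  have ss: "smooth_in S UNIV s" unfolding s_def by (rule smooth_in_metric[OF f\<xi> f\<nu>])
  have sk: "smooth_in S UNIV k" unfolding k_def by (rule smooth_in_metric[OF f\<nu> f\<nu>])
  have sa: "smooth_in S UNIV a" unfolding a_def by (rule src.smooth_in_inverse[OF open_UNIV ss s0])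
  have sb: "smooth_in S UNIV b"
    unfolding b_def using s0
    by (intro src.smooth_in_minus src.smooth_in_mult src.smooth_in_inverse src.smooth_in_const open_UNIV ss sk) auto
  have f\<eta>: "fld \<eta>"
    unfolding \<eta>_def by (intro field_along_add field_along_scaleR f\<xi> f\<nu> sa sb)
  have n\<eta>: "\<eta> p \<in> nsp p" for p unfolding \<eta>_def by (rule nsp_lincomb[OF n\<nu> n\<xi>])
  have \<xi>\<eta>: "gg p (\<xi> p) (\<eta> p) = 1" for p
    unfolding \<eta>_def using metric_lincomb_right[OF nsp_tangent[OF n\<nu>] nsp_tangent[OF n\<xi>] nsp_tangent[OF n\<xi>], of p "a p" "b p"] \<xi>0(1)[of p] s0[of p]
    by (simp add: a_def s_def)
  have \<nu>\<eta>: "gg p (\<nu> p) (\<eta> p) = a p * k p + b p * s p" for p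
    unfolding \<eta>_def using metric_lincomb_right[OF nsp_tangent[OF n\<nu>] nsp_tangent[OF n\<xi>] nsp_tangent[OF n\<nu>], of p "a p" "b p"]
      metric_sym[OF nsp_tangent[OF n\<nu>] nsp_tangent[OF n\<xi>], of p]
    by (simp add: s_def k_def)
  have "gg p (\<eta> p) (\<eta> p) = a p * (a p * k p + b p * s p) + b p" for p
  proof -
    have "gg p (\<eta> p) (\<eta> p) = a p * gg p (\<nu> p) (\<eta> p) + b p * gg p (\<xi> p) (\<eta> p)"
      by (subst \<eta>_def) (rule metric_lincomb[OF nsp_tangent[OF n\<nu>] nsp_tangent[OF n\<xi>] nsp_tangent[OF n\<eta>]])
    then show ?thesis by (simp add: \<nu>\<eta> \<xi>\<eta>)
  qed
  moreover have "a p * (a p * k p + b p * s p) + b p = 0" for p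
    using s0[of p] by (simp add: a_def b_def field_simps)
  ultimately have "null_frame \<xi> \<eta>"
    using \<xi>(1) f\<eta> n\<eta> \<xi>0 \<xi>\<eta> by (simp add: null_frame_def normal_fields_iff)
  then show ?thesis by blast
qed

end

section \<open>The normal connection in a null frame\<close>

context spacelike_codim_two
begin

abbreviation ncon where "ncon \<equiv> normal_conn S M g \<psi>"

text \<open>A vector without normal part is tangent to S, so it pairs to zero with every normal
  vector.\<close>

lemma nproj_zero_orthogonal:
  assumes "w \<in> tangent_space M (\<psi> p)" "nproj p w = (\<lambda>c. 0)" "n \<in> nsp p"
  shows "gg p w n = 0" "gg p n w = 0"
proof -
  obtain x where x: "x \<in> tangent_space S p" "w = (\<lambda>c. df p x c + nproj p w c)"
    using nproj_decomposition(1)[OF assms(1)] by blast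
  then have "w = df p x" using assms(2) by simp
  then show "gg p w n = 0" "gg p n w = 0"
    using nsp_orthogonal[OF assms(3) x(1)] nsp_orthogonal'[OF assms(3) x(1)] by simp_all
qed

lemma normal_conn_frame:
  assumes F: "null_frame \<xi> \<eta>" and \<zeta>: "fld \<zeta>"
  shows "ncon \<zeta> p x = (\<lambda>c. gg p (nab \<zeta> p x) (\<eta> p) *\<^sub>R \<xi> p c + gg p (nab \<zeta> p x) (\<xi> p) *\<^sub>R \<eta> p c)"
  unfolding normal_conn_def by (rule nproj_frame[OF F cov_deriv_tangent[OF \<zeta>]])

text \<open>Differentiate the constant products 0, 0 and 1 of the frame. One one-form therefore
  carries all of the normal connection.\<close>

lemma null_frame_conn:
  assumes F: "null_frame \<xi> \<eta>"
  shows "gg p (nab \<xi> p x) (\<xi> p) = 0" "gg p (nab \<eta> p x) (\<eta> p) = 0"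
    "gg p (\<xi> p) (nab \<eta> p x) = - gg p (nab \<xi> p x) (\<eta> p)"
    "gg p (nab \<eta> p x) (\<xi> p) = - gg p (nab \<xi> p x) (\<eta> p)"
proof -
  note \<xi> = null_frameD(1,2)[OF F] null_frameD(3-8)[OF F, of p]
  have s: "gg p (\<zeta> p) (nab \<zeta>' p x) = gg p (nab \<zeta>' p x) (\<zeta> p)" if "fld \<zeta>" "fld \<zeta>'" for \<zeta> \<zeta>'
    by (rule metric_sym[OF fld_tangent[OF that(1)] cov_deriv_tangent[OF that(2)]])
  show "gg p (nab \<xi> p x) (\<xi> p) = 0"
    using cov_deriv_metric[OF \<xi>(1,1), of p x] s[OF \<xi>(1,1)] null_frameD(5)[OF F] by (simp add: src.dir_deriv_const)
  show "gg p (nab \<eta> p x) (\<eta> p) = 0"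
    using cov_deriv_metric[OF \<xi>(2,2), of p x] s[OF \<xi>(2,2)] null_frameD(6)[OF F] by (simp add: src.dir_deriv_const)
  show *: "gg p (\<xi> p) (nab \<eta> p x) = - gg p (nab \<xi> p x) (\<eta> p)"
    using cov_deriv_metric[OF \<xi>(1,2), of p x] null_frameD(7)[OF F] by (simp add: src.dir_deriv_const)
  then show "gg p (nab \<eta> p x) (\<xi> p) = - gg p (nab \<xi> p x) (\<eta> p)" using s[OF \<xi>(1,2)] by simp
qed

text \<open>\<open>shape_operator\<close> is a definite description; the splitting into tangential
  and normal part shows that it denotes, with the sign of the Weingarten formula.\<close>

lemma shape_operator_decomposition:
  assumes \<zeta>: "fld \<zeta>"
  shows "nab \<zeta> p x = (\<lambda>c. - df p (shape_operator S M g \<psi> \<zeta> p x) c + ncon \<zeta> p x c)"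
proof -
  let ?P = "\<lambda>a. a \<in> tangent_space S p \<and> nab \<zeta> p x = (\<lambda>c. - df p a c + ncon \<zeta> p x c)"
  note w = cov_deriv_tangent[OF \<zeta>, of p x]
  have n: "ncon \<zeta> p x \<in> nsp p" unfolding normal_conn_def by (rule nproj_decomposition(2)[OF w])
  have neg: "df p (\<lambda>c. - a c) = (\<lambda>c. - df p a c)" for a
    using differential_lincomb[of p "-1" a 0 a] by simp
  obtain y where y: "y \<in> tangent_space S p" "nab \<zeta> p x = (\<lambda>c. df p y c + ncon \<zeta> p x c)"
    using nproj_decomposition(1)[OF w] unfolding normal_conn_def by blast
  have tneg: "(\<lambda>c. - a c) \<in> tangent_space S p" if "a \<in> tangent_space S p" for a
    using src.tangent_scaleR[OF that, of "-1"] by simp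
  have P: "?P (\<lambda>c. - y c)" using tneg[OF y(1)] y(2) by (simp add: neg)
  have "a = (\<lambda>c. - y c)" if "?P a" for a
  proof -
    have "(\<lambda>c. df p (\<lambda>c. - a c) c + ncon \<zeta> p x c) = (\<lambda>c. df p y c + ncon \<zeta> p x c)"
      using that y(2) by (simp add: neg)
    from decomposition_unique(1)[OF tneg y(1) n n this] that have "(\<lambda>c. - a c) = y" by blast
    then have "- a c = y c" for c by (rule fun_cong)
    then have "a c = - y c" for c by (metis minus_minus)
    then show ?thesis by (rule ext)
  qed
  then have "?P (THE a. ?P a)" using theI[of ?P, OF P] by blast
  then show ?thesis by (simp add: shape_operator_def)
qed

text \<open>The normal part is along \<open>\<xi>\<close> alone since \<open>g(\<xi>, \<xi>)\<close>
  is constant, and the tangential part is a multiple of the direction by umbilicity.\<close>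

lemma umbilical_cov_deriv:
  assumes F: "null_frame \<xi> \<eta>" and x: "shape_operator S M g \<psi> \<xi> p x = (\<lambda>c. r *\<^sub>R x c)"
  shows "nab \<xi> p x = (\<lambda>c. (- r) *\<^sub>R df p x c + gg p (nab \<xi> p x) (\<eta> p) *\<^sub>R \<xi> p c)"
proof -
  have "df p (\<lambda>c. r *\<^sub>R x c) = (\<lambda>c. r *\<^sub>R df p x c)" using differential_lincomb[of p r x 0 x] by simp
  then show ?thesis
    using shape_operator_decomposition[OF null_frameD(1)[OF F], of p x]
      normal_conn_frame[OF F null_frameD(1)[OF F], of p x] null_frame_conn(1)[OF F, of p x]
    unfolding x by simp
qed

text \<open>
  The connection form \<open>\<tau>(x) = g(\<nabla>\<^sub>x \<xi>, \<eta>)\<close> of the normal bundle.  Umbilicity enters only through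
  \<open>g(\<nabla>\<^sub>Y \<xi>, \<nabla>\<^sub>X \<eta>) = \<rho> g(\<nabla>\<^sub>X d\<psi>(Y), \<eta>) - \<tau>(X) \<tau>(Y)\<close>, which is symmetric in \<open>X\<close> and \<open>Y\<close> up to
  \<open>\<rho> g(d\<psi>[X, Y], \<eta>) = 0\<close>.
\<close>

definition conn_form :: "('s \<Rightarrow> ('m, 'e) tvec) \<Rightarrow> ('s \<Rightarrow> ('m, 'e) tvec) \<Rightarrow> 's \<Rightarrow> ('s, 'd) tvec \<Rightarrow> real" where
  "conn_form \<xi> \<eta> p x = gg p (nab \<xi> p x) (\<eta> p)"

lemma conn_form_linear:
  assumes F: "null_frame \<xi> \<eta>"
  shows "conn_form \<xi> \<eta> p (\<lambda>c. a *\<^sub>R v c + b *\<^sub>R w c) = a * conn_form \<xi> \<eta> p v + b * conn_form \<xi> \<eta> p w"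
  using metric_lincomb[OF cov_deriv_tangent[OF null_frameD(1)[OF F]]
      cov_deriv_tangent[OF null_frameD(1)[OF F]] fld_tangent[OF null_frameD(2)[OF F]]]
  unfolding conn_form_def cov_deriv_lincomb_vec[OF null_frameD(1)[OF F]] by blast

lemma conn_form_smooth:
  assumes F: "null_frame \<xi> \<eta>" and X: "X \<in> vector_fields S"
  shows "smooth_in S UNIV (\<lambda>q. conn_form \<xi> \<eta> q (X q))"
  unfolding conn_form_def by (rule smooth_in_metric[OF cov_deriv_field[OF null_frameD(1)[OF F] X] null_frameD(2)[OF F]])

lemma conn_form_closed:
  assumes F: "null_frame \<xi> \<eta>"
    and umb: "\<And>p x. x \<in> tangent_space S p \<Longrightarrow> shape_operator S M g \<psi> \<xi> p x = (\<lambda>c. \<rho> p *\<^sub>R x c)"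
    and R: "\<And>X Y p. X \<in> vector_fields S \<Longrightarrow> Y \<in> vector_fields S \<Longrightarrow>
      nproj p (riemann M g (\<psi> p) (df p (X p)) (df p (Y p)) (\<xi> p)) = (\<lambda>c. 0)"
    and X: "X \<in> vector_fields S" and Y: "Y \<in> vector_fields S"
  shows "dir_deriv S (\<lambda>q. conn_form \<xi> \<eta> q (Y q)) p (X p) - dir_deriv S (\<lambda>q. conn_form \<xi> \<eta> q (X q)) p (Y p)
     = conn_form \<xi> \<eta> p (lie_bracket S X Y p)"
proof -
  let ?\<tau> = "conn_form \<xi> \<eta>"
  note f\<xi> = null_frameD(1)[OF F] and f\<eta> = null_frameD(2)[OF F] and n\<eta> = null_frameD(4)[OF F]
  have half: "dir_deriv S (\<lambda>q. ?\<tau> q (Y q)) p (X p) =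
      gg p (nab (\<lambda>q. nab \<xi> q (Y q)) p (X p)) (\<eta> p) + \<rho> p * gg p (nab (\<lambda>q. df q (Y q)) p (X p)) (\<eta> p)
      - ?\<tau> p (X p) * ?\<tau> p (Y p)"
    if X: "X \<in> vector_fields S" and Y: "Y \<in> vector_fields S" for X Y
  proof -
    note Yp = src.vector_field_tangent[OF Y, of p]
    have "dir_deriv S (\<lambda>q. ?\<tau> q (Y q)) p (X p) =
        gg p (nab (\<lambda>q. nab \<xi> q (Y q)) p (X p)) (\<eta> p) + gg p (nab \<xi> p (Y p)) (nab \<eta> p (X p))"
      unfolding conn_form_def by (rule cov_deriv_metric[OF cov_deriv_field[OF f\<xi> Y] f\<eta>])
    also have "gg p (nab \<xi> p (Y p)) (nab \<eta> p (X p)) =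
        - \<rho> p * gg p (df p (Y p)) (nab \<eta> p (X p)) + ?\<tau> p (Y p) * gg p (\<xi> p) (nab \<eta> p (X p))"
      by (subst umbilical_cov_deriv[OF F umb[OF Yp]])
        (simp only: conn_form_def metric_lincomb[OF differential_tangent fld_tangent[OF f\<xi>] cov_deriv_tangent[OF f\<eta>]])
    also have "gg p (\<xi> p) (nab \<eta> p (X p)) = - ?\<tau> p (X p)"
      unfolding conn_form_def by (rule null_frame_conn(3)[OF F])
    \<comment> \<open>Differentiating \<open>g(d\<psi> Y, \<eta>) = 0\<close> moves the derivative
      from \<open>\<eta>\<close> to \<open>d\<psi> Y\<close>, the form in which the torsion-free law
      can be applied.\<close>
    also have "gg p (df p (Y p)) (nab \<eta> p (X p)) = - gg p (nab (\<lambda>q. df q (Y q)) p (X p)) (\<eta> p)"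
    proof -
      have "gg q (df q (Y q)) (\<eta> q) = 0" for q by (rule nsp_orthogonal'[OF n\<eta> src.vector_field_tangent[OF Y]])
      then show ?thesis
        using cov_deriv_metric[OF differential_field[OF Y] f\<eta>, of p "X p"] by (simp add: src.dir_deriv_const)
    qed
    finally show ?thesis by (simp add: mult.commute)
  qed
  let ?XY = "nab (\<lambda>q. nab \<xi> q (Y q)) p (X p)" and ?YX = "nab (\<lambda>q. nab \<xi> q (X q)) p (Y p)"
  let ?L = "nab \<xi> p (lie_bracket S X Y p)"
  have tXY: "?XY \<in> tangent_space M (\<psi> p)" by (rule cov_deriv_tangent[OF cov_deriv_field[OF f\<xi> Y]])
  have tYX: "?YX \<in> tangent_space M (\<psi> p)" by (rule cov_deriv_tangent[OF cov_deriv_field[OF f\<xi> X]])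
  note tL = cov_deriv_tangent[OF f\<xi>, of p "lie_bracket S X Y p"] and t\<eta> = fld_tangent[OF f\<eta>, of p]
  \<comment> \<open>The curvature hypothesis enters here: the commutator of the derivatives of
    \<open>\<xi>\<close> is tangent to S, so its product with \<open>\<eta>\<close>
    vanishes.\<close>
  have "(\<lambda>c. (?XY c - ?YX c) - ?L c) = riemann M g (\<psi> p) (df p (X p)) (df p (Y p)) (\<xi> p)"
    using curvature_pullback[OF X Y f\<xi>, of p] by (simp add: curvature_def fun_eq_iff)
  then have "nproj p (\<lambda>c. (?XY c - ?YX c) - ?L c) = (\<lambda>c. 0)" using R[OF X Y] by simp
  from nproj_zero_orthogonal(1)[OF tgt.tangent_diff[OF tgt.tangent_diff[OF tXY tYX] tL] this n\<eta>]
  have 1: "gg p ?XY (\<eta> p) - gg p ?YX (\<eta> p) = ?\<tau> p (lie_bracket S X Y p)"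
    using metric_diff[OF tgt.tangent_diff[OF tXY tYX] tL t\<eta>] metric_diff[OF tXY tYX t\<eta>]
    by (simp add: conn_form_def)
  have "gg p (df p (lie_bracket S X Y p)) (\<eta> p) = 0"
    by (rule nsp_orthogonal'[OF n\<eta> src.lie_bracket_tangent[OF X Y]])
  \<comment> \<open>The two terms differ by \<open>g(d\<psi> [X, Y], \<eta>)\<close>, a tangent
    vector paired with a normal one.\<close>
  then have 2: "gg p (nab (\<lambda>q. df q (Y q)) p (X p)) (\<eta> p) = gg p (nab (\<lambda>q. df q (X q)) p (Y p)) (\<eta> p)"
    using metric_diff[OF cov_deriv_tangent[OF differential_field[OF Y]] cov_deriv_tangent[OF differential_field[OF X]] t\<eta>, of "X p" "Y p"]
    unfolding cov_deriv_torsion_free[OF X Y, symmetric] by simp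
  show ?thesis unfolding half[OF X Y] half[OF Y X] 2 using 1 by simp
qed

lemma null_frame_rescale:
  assumes F: "null_frame \<xi> \<eta>" and h: "smooth_in S UNIV h" "smooth_in S UNIV k" "\<And>p. h p * k p = 1"
  shows "null_frame (\<lambda>p c. h p *\<^sub>R \<xi> p c) (\<lambda>p c. k p *\<^sub>R \<eta> p c)"
proof -
  note f\<xi> = null_frameD(1)[OF F] and f\<eta> = null_frameD(2)[OF F]
  have n: "(\<lambda>c. a *\<^sub>R m c) \<in> nsp p" if "m \<in> nsp p" for a m p using nsp_lincomb[OF that that, of a 0] by simp
  have l: "gg p (\<lambda>c. a *\<^sub>R u c) (\<lambda>c. b *\<^sub>R v c) = a * b * gg p u v"
    if "u \<in> tangent_space M (\<psi> p)" "v \<in> tangent_space M (\<psi> p)" for a b u v p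
    using metric_lincomb[OF that(1,1) tgt.tangent_scaleR[OF that(2)], of a 0 b]
      metric_lincomb_right[OF that(2,2,1), of b 0] by simp
  show ?thesis
    unfolding null_frame_def normal_fields_iff
    using field_along_scaleR[OF f\<xi> h(1)] field_along_scaleR[OF f\<eta> h(2)] n[OF null_frameD(3)[OF F]] n[OF null_frameD(4)[OF F]]
      null_frameD(5-7)[OF F] h(3) by (simp add: l fld_tangent[OF f\<xi>] fld_tangent[OF f\<eta>])
qed

section \<open>Parallel null frames and flatness\<close>

definition parallel_frame :: "('s \<Rightarrow> ('m, 'e) tvec) \<Rightarrow> ('s \<Rightarrow> ('m, 'e) tvec) \<Rightarrow> bool" where
  "parallel_frame \<xi> \<eta> \<longleftrightarrow> null_frame \<xi> \<eta> \<and> parallel_normal S M g \<psi> \<xi> \<and> parallel_normal S M g \<psi> \<eta>"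

lemma parallel_frame_exists:
  assumes F: "null_frame \<xi> \<eta>" and sc: "simply_connected (UNIV :: 's set)"
    and closed: "\<And>X Y p. X \<in> vector_fields S \<Longrightarrow> Y \<in> vector_fields S \<Longrightarrow>
      dir_deriv S (\<lambda>q. conn_form \<xi> \<eta> q (Y q)) p (X p) - dir_deriv S (\<lambda>q. conn_form \<xi> \<eta> q (X q)) p (Y p)
        = conn_form \<xi> \<eta> p (lie_bracket S X Y p)"
  shows "\<exists>h \<eta>'. smooth_in S UNIV h \<and> (\<forall>p. h p \<noteq> 0) \<and> parallel_frame (\<lambda>p c. h p *\<^sub>R \<xi> p c) \<eta>'"
proof -
  obtain f where f: "smooth_in S UNIV f" "\<And>p x. x \<in> tangent_space S p \<Longrightarrow> dir_deriv S f p x = conn_form \<xi> \<eta> p x"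
    using src.closed_form_exact[OF sc conn_form_linear[OF F] conn_form_smooth[OF F] closed] by blast
  define h where "h p = exp (- f p)" for p
  define k where "k p = exp (f p)" for p
  have sf: "smooth_in S UNIV (\<lambda>p. - f p)" by (rule src.smooth_in_minus[OF open_UNIV f(1)])
  have sh: "smooth_in S UNIV h"
    unfolding h_def by (rule src.smooth_in_compose[OF open_UNIV sf subset_UNIV smooth_on_exp])
  have sk: "smooth_in S UNIV k"
    unfolding k_def by (rule src.smooth_in_compose[OF open_UNIV f(1) subset_UNIV smooth_on_exp])
  have hk: "h p * k p = 1" for p by (simp add: h_def k_def exp_minus)
  have dh: "dir_deriv S h p x = - h p * conn_form \<xi> \<eta> p x" if x: "x \<in> tangent_space S p" for p x
  proof -
    have dexp: "((\<lambda>t. exp (- t)) has_derivative (\<lambda>v. v * - exp (- f p))) (at (f p))"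
      by (auto intro!: derivative_eq_intros)
    have "dir_deriv S h p x = frechet_derivative (\<lambda>t. exp (- t)) (at (f p)) (dir_deriv S f p x)"
      unfolding h_def by (rule src.dir_deriv_compose[OF f(1)]) (use dexp in \<open>auto intro: differentiableI\<close>)
    then show ?thesis using frechet_derivative_eqI[OF dexp] f(2)[OF x] by (simp add: h_def)
  qed
  let ?\<xi> = "\<lambda>p c. h p *\<^sub>R \<xi> p c" and ?\<eta> = "\<lambda>p c. k p *\<^sub>R \<eta> p c"
  have F': "null_frame ?\<xi> ?\<eta>" by (rule null_frame_rescale[OF F sh sk hk])
  note f\<xi> = null_frameD(1)[OF F]
  \<comment> \<open>The derivative of \<open>h\<close> cancels the connection form. By
    \<open>null_frame_conn\<close> every other coefficient of the rescaled frame is zero or minus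
    this one, so both of its fields become parallel.\<close>
  have 0: "gg p (nab ?\<xi> p x) (?\<eta> p) = 0" if x: "x \<in> tangent_space S p" for p x
  proof -
    have "gg p (nab ?\<xi> p x) (?\<eta> p) =
        dir_deriv S h p x * gg p (\<xi> p) (?\<eta> p) + h p * gg p (nab \<xi> p x) (?\<eta> p)"
      unfolding cov_deriv_scaleR[OF f\<xi> sh]
      by (rule metric_lincomb[OF fld_tangent[OF f\<xi>] cov_deriv_tangent[OF f\<xi>] fld_tangent[OF null_frameD(2)[OF F']]])
    moreover have "gg p v (?\<eta> p) = k p * gg p v (\<eta> p)" if "v \<in> tangent_space M (\<psi> p)" for v
      using metric_lincomb_right[OF fld_tangent[OF null_frameD(2)[OF F]] fld_tangent[OF null_frameD(2)[OF F]] that, of "k p" 0] by simp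
    ultimately show ?thesis
      using dh[OF x] null_frameD(7)[OF F] fld_tangent[OF f\<xi>, of p] cov_deriv_tangent[OF f\<xi>, of p x]
      by (simp add: conn_form_def algebra_simps)
  qed
  have "parallel_normal S M g \<psi> ?\<xi>" "parallel_normal S M g \<psi> ?\<eta>"
    unfolding parallel_normal_def
    using normal_conn_frame[OF F' null_frameD(1)[OF F']] normal_conn_frame[OF F' null_frameD(2)[OF F']]
      null_frame_conn[OF F'] 0 by simp_all
  then have "parallel_frame ?\<xi> ?\<eta>" using F' by (simp add: parallel_frame_def)
  then show ?thesis using sh by (intro exI[of _ h] exI[of _ ?\<eta>]) (simp add: h_def)
qed

lemma parallel_orthogonal:
  assumes "parallel_normal S M g \<psi> \<zeta>" "fld \<zeta>" "n \<in> nsp p" "x \<in> tangent_space S p"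
  shows "gg p n (nab \<zeta> p x) = 0"
  using assms cov_deriv_tangent[OF assms(2)] nproj_zero_orthogonal(2)
  unfolding parallel_normal_def normal_conn_def by blast

text \<open>The derivative of a product with a parallel normal field has only one term left, because
  the derivative of that field is tangent to S and orthogonal to \<open>\<zeta>\<close>.\<close>

lemma normal_conn_parallel_frame:
  assumes F: "parallel_frame \<xi> \<eta>" and \<zeta>: "\<zeta> \<in> normal_fields S M g \<psi>" and x: "x \<in> tangent_space S p"
  shows "ncon \<zeta> p x = (\<lambda>c. dir_deriv S (\<lambda>q. gg q (\<zeta> q) (\<eta> q)) p x *\<^sub>R \<xi> p c
     + dir_deriv S (\<lambda>q. gg q (\<zeta> q) (\<xi> q)) p x *\<^sub>R \<eta> p c)"
proof -
  have F': "null_frame \<xi> \<eta>" and p: "parallel_normal S M g \<psi> \<xi>" "parallel_normal S M g \<psi> \<eta>"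
    using F by (auto simp: parallel_frame_def)
  have f\<zeta>: "fld \<zeta>" and n\<zeta>: "\<zeta> p \<in> nsp p" using \<zeta> by (auto simp: normal_fields_iff)
  show ?thesis
    unfolding normal_conn_frame[OF F' f\<zeta>]
    using cov_deriv_metric[OF f\<zeta> null_frameD(1)[OF F'], of p x] cov_deriv_metric[OF f\<zeta> null_frameD(2)[OF F'], of p x]
      parallel_orthogonal[OF p(1) null_frameD(1)[OF F'] n\<zeta> x] parallel_orthogonal[OF p(2) null_frameD(2)[OF F'] n\<zeta> x]
    by simp
qed

lemma flat_of_parallel_frame:
  assumes F: "parallel_frame \<xi> \<eta>"
  shows "flat_normal_connection S M g \<psi>"
  unfolding flat_normal_connection_def
proof (intro ballI allI)
  fix X Y \<zeta> p
  assume X: "X \<in> vector_fields S" and Y: "Y \<in> vector_fields S" and \<zeta>: "\<zeta> \<in> normal_fields S M g \<psi>"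
  have F': "null_frame \<xi> \<eta>" using F by (simp add: parallel_frame_def)
  let ?a = "\<lambda>q. gg q (\<zeta> q) (\<eta> q)" and ?b = "\<lambda>q. gg q (\<zeta> q) (\<xi> q)"
  have f\<zeta>: "fld \<zeta>" using \<zeta> by (simp add: normal_fields_iff)
  have sa: "smooth_in S UNIV ?a" by (rule smooth_in_metric[OF f\<zeta> null_frameD(2)[OF F']])
  have sb: "smooth_in S UNIV ?b" by (rule smooth_in_metric[OF f\<zeta> null_frameD(1)[OF F']])
  have second: "ncon (\<lambda>q. ncon \<zeta> q (Y q)) p (X p) =
      (\<lambda>c. dir_deriv S (\<lambda>q. dir_deriv S ?a q (Y q)) p (X p) *\<^sub>R \<xi> p c
         + dir_deriv S (\<lambda>q. dir_deriv S ?b q (Y q)) p (X p) *\<^sub>R \<eta> p c)"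
    if X: "X \<in> vector_fields S" and Y: "Y \<in> vector_fields S" for X Y
  proof -
    have e': "ncon \<zeta> q (Y q) = (\<lambda>c. dir_deriv S ?a q (Y q) *\<^sub>R \<xi> q c + dir_deriv S ?b q (Y q) *\<^sub>R \<eta> q c)" for q
      by (rule normal_conn_parallel_frame[OF F \<zeta> src.vector_field_tangent[OF Y]])
    then have e: "(\<lambda>q. ncon \<zeta> q (Y q)) = (\<lambda>q c. dir_deriv S ?a q (Y q) *\<^sub>R \<xi> q c + dir_deriv S ?b q (Y q) *\<^sub>R \<eta> q c)"
      by (rule ext)
    \<comment> \<open>Being a smooth normal field again, the derivative can be differentiated a
      second time by the same formula.\<close>
    have N: "(\<lambda>q. ncon \<zeta> q (Y q)) \<in> normal_fields S M g \<psi>"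
      unfolding e normal_fields_iff
      by (intro conjI allI field_along_add field_along_scaleR null_frameD(1,2)[OF F'] src.smooth_in_dir_deriv[OF Y]
          sa sb open_UNIV nsp_lincomb null_frameD(3,4)[OF F'])
    show ?thesis
      unfolding normal_conn_parallel_frame[OF F N src.vector_field_tangent[OF X]]
      unfolding e' null_frame_comb[OF F'] ..
  qed
  \<comment> \<open>The commutator identity for the two component functions is all that flatness
    amounts to in this frame.\<close>
  note L = src.dir_deriv_lie_bracket[OF X Y sa open_UNIV UNIV_I, of p]
    src.dir_deriv_lie_bracket[OF X Y sb open_UNIV UNIV_I, of p]
  show "curvature S ncon X Y \<zeta> p = (\<lambda>c. 0)"
    unfolding curvature_def second[OF X Y] second[OF Y X]
      normal_conn_parallel_frame[OF F \<zeta> src.lie_bracket_tangent[OF X Y]] L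
    by (simp add: algebra_simps)
qed

end

subsection \<open>Normal holonomy\<close>

lemma line_smooth_manifold: "smooth_manifold line_atlas"
proof
  have inv: "inv_into UNIV id = (id :: real \<Rightarrow> real)" by (simp add: fun_eq_iff inv_into_f_f)
  have "smooth_on UNIV (id :: real \<Rightarrow> real)" unfolding id_def by (rule smooth_on_ident)
  then show "smooth_atlas line_atlas"
    by (auto simp: smooth_atlas_def line_atlas_def is_chart_def inv homeomorphism_def)
qed

interpretation line: smooth_manifold line_atlas by (rule line_smooth_manifold)

lemma chart_at_line: "chart_at line_atlas t = (UNIV, id)"
  using line.chart_at(1)[of t] by (simp add: line_atlas_def)

lemma smooth_in_line_DERIV:
  fixes a :: "real \<Rightarrow> real"
  assumes "smooth_in line_atlas UNIV a"
  shows "(a has_real_derivative dir_deriv line_atlas a t (d_dt t)) (at t)"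
proof -
  have inv: "inv_into UNIV id = (id :: real \<Rightarrow> real)" by (simp add: fun_eq_iff inv_into_f_f)
  have d: "a differentiable at t"
    using line.smooth_in_differentiable[OF assms, of "(UNIV, id)" t] by (simp add: line_atlas_def inv)
  have "d_dt t (UNIV, id) = 1"
    unfolding d_dt_def by (rule line.coord_field_self) (auto simp: line_atlas_def)
  then have "dir_deriv line_atlas a t (d_dt t) = frechet_derivative a (at t) 1"
    by (simp add: line.dir_deriv_chart_at chart_at_line inv)
  moreover have "frechet_derivative a (at t) v = frechet_derivative a (at t) 1 * v" for v
    using linear_scale[OF linear_frechet_derivative[OF d], of v 1] by simp
  then have "frechet_derivative a (at t) = (*) (frechet_derivative a (at t) 1)" by (rule ext)
  then have "(a has_real_derivative frechet_derivative a (at t) 1) (at t)"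
    using frechetI[OF d] by (simp add: has_field_derivative_def)
  ultimately show ?thesis by simp
qed

context lorentz_map
begin

text \<open>Chain rule: restricting a field to a curve turns its derivative in the velocity
  direction into the derivative along the curve. Parallel fields on S thus give parallel fields
  along every curve.\<close>

lemma cov_deriv_reparametrize:
  assumes \<gamma>: "smooth_manifold_map B A \<gamma>" and V: "fld V"
  shows "smooth_field_along B M (\<lambda>t. f (\<gamma> t)) (\<lambda>t. V (\<gamma> t))"
    and "cov_deriv B M g (\<lambda>t. f (\<gamma> t)) (\<lambda>t. V (\<gamma> t)) t x = nab V (\<gamma> t) (differential B A \<gamma> t x)"
proof -
  interpret \<gamma>: smooth_manifold_map B A \<gamma> by fact
  have f: "smooth_manifold_map A M f" by unfold_locales
  interpret f\<gamma>: smooth_manifold_map B M "\<lambda>t. f (\<gamma> t)" by (rule smooth_map_compose[OF \<gamma> f])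
  have eq: "(\<lambda>t. f (\<gamma> t)) -` dom_chart d = \<gamma> -` (f -` dom_chart d)" for d by auto
  show "smooth_field_along B M (\<lambda>t. f (\<gamma> t)) (\<lambda>t. V (\<gamma> t))"
    unfolding f\<gamma>.field_along_iff
  proof (intro conjI allI ballI fld_tangent[OF V])
    fix d assume d: "d \<in> M"
    show "smooth_in B ((\<lambda>t. f (\<gamma> t)) -` dom_chart d) (\<lambda>t. V (\<gamma> t) d)"
      unfolding eq by (rule \<gamma>.smooth_in_pullback[OF fld_smooth[OF V d] open_dom_preimage[OF d]])
  qed
  show "cov_deriv B M g (\<lambda>t. f (\<gamma> t)) (\<lambda>t. V (\<gamma> t)) t x = nab V (\<gamma> t) (differential B A \<gamma> t x)"
  proof
    fix d
    show "cov_deriv B M g (\<lambda>t. f (\<gamma> t)) (\<lambda>t. V (\<gamma> t)) t x d = nab V (\<gamma> t) (differential B A \<gamma> t x) d"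
    proof (cases "d \<in> M \<and> f (\<gamma> t) \<in> dom_chart d")
      case True
      then have d: "d \<in> M" "f (\<gamma> t) \<in> dom_chart d" by auto
      show ?thesis
        using \<gamma>.dir_deriv_pullback[OF fld_smooth[OF V d(1)] open_dom_preimage[OF d(1)], of t x] d
          differential_compose[OF \<gamma> f, of t x]
        by (simp add: cov_deriv_component[OF d] cov_deriv_def)
    qed (auto simp: cov_deriv_def)
  qed
qed

end

section \<open>Parallel transport in a parallel frame\<close>

context spacelike_codim_two
begin

text \<open>Products with the parallel frame fields are constant along the curve, and they are the
  coefficients in \<open>normal_expand\<close>. Conversely, constant combinations are visibly
  parallel, so each initial vector has an explicit transport.\<close>

lemma parallel_along_iff:
  assumes F: "parallel_frame \<xi> \<eta>" and \<gamma>: "smooth_map line_atlas S \<gamma>"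
  shows "parallel_along S M g \<psi> \<gamma> V \<longleftrightarrow>
     (\<exists>a b. V = (\<lambda>t c. a *\<^sub>R \<xi> (\<gamma> t) c + b *\<^sub>R \<eta> (\<gamma> t) c))"
proof -
  have F': "null_frame \<xi> \<eta>" and par: "parallel_normal S M g \<psi> \<xi>" "parallel_normal S M g \<psi> \<eta>"
    using F by (auto simp: parallel_frame_def)
  interpret \<gamma>: smooth_manifold_map line_atlas S \<gamma> using \<gamma> by unfold_locales
  have \<gamma>': "smooth_manifold_map line_atlas S \<gamma>" by unfold_locales
  have \<psi>': "smooth_manifold_map S M \<psi>" by unfold_locales
  interpret c: smooth_manifold_map line_atlas M "\<lambda>t. \<psi> (\<gamma> t)" by (rule smooth_map_compose[OF \<gamma>' \<psi>'])
  interpret c: lorentz_map line_atlas M "\<lambda>t. \<psi> (\<gamma> t)" g by unfold_locales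
  note re = cov_deriv_reparametrize[OF \<gamma>']
  let ?v = "\<lambda>t. differential line_atlas S \<gamma> t (d_dt t)"
  have v: "?v t \<in> tangent_space S (\<gamma> t)" for t by (rule \<gamma>.differential_tangent)
  have par': "nproj (\<gamma> t) (nab \<zeta> (\<gamma> t) (?v t)) = (\<lambda>c. 0)" if "parallel_normal S M g \<psi> \<zeta>" for \<zeta> t
    using that v[of t] by (simp add: parallel_normal_def normal_conn_def)
  show ?thesis
  proof
    assume P: "parallel_along S M g \<psi> \<gamma> V"
    then have fV: "c.fld V" and nV: "\<And>t. V t \<in> nsp (\<gamma> t)"
      and DV: "\<And>t. nproj (\<gamma> t) (c.nab V t (d_dt t)) = (\<lambda>c. 0)"
      by (auto simp: parallel_along_def o_def)
    have const: "\<exists>k. \<forall>t. gg (\<gamma> t) (V t) (\<zeta> (\<gamma> t)) = k"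
      if \<zeta>: "fld \<zeta>" "\<And>p. \<zeta> p \<in> nsp p" "parallel_normal S M g \<psi> \<zeta>" for \<zeta>
    proof -
      let ?a = "\<lambda>t. gg (\<gamma> t) (V t) (\<zeta> (\<gamma> t))"
      have s: "smooth_in line_atlas UNIV ?a" by (rule c.smooth_in_metric[OF fV re(1)[OF \<zeta>(1)]])
      have "dir_deriv line_atlas ?a t (d_dt t) = 0" for t
        unfolding c.cov_deriv_metric[OF fV re(1)[OF \<zeta>(1)]] re(2)[OF \<zeta>(1)]
        using nproj_zero_orthogonal(1)[OF c.cov_deriv_tangent[OF fV] DV \<zeta>(2)]
          nproj_zero_orthogonal(2)[OF cov_deriv_tangent[OF \<zeta>(1)] par'[OF \<zeta>(3)] nV] by simp
      then have "(?a has_real_derivative 0) (at t)" for t using smooth_in_line_DERIV[OF s, of t] by simp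
      then have "?a x = ?a 0" for x by (rule DERIV_isconst_all[rule_format])
      then show ?thesis by blast
    qed
    obtain a where a: "\<And>t. gg (\<gamma> t) (V t) (\<eta> (\<gamma> t)) = a"
      using const[OF null_frameD(2,4)[OF F'] par(2)] by blast
    obtain b where b: "\<And>t. gg (\<gamma> t) (V t) (\<xi> (\<gamma> t)) = b"
      using const[OF null_frameD(1,3)[OF F'] par(1)] by blast
    have "V = (\<lambda>t c. a *\<^sub>R \<xi> (\<gamma> t) c + b *\<^sub>R \<eta> (\<gamma> t) c)"
      using normal_expand[OF F' nV] unfolding a b by (rule ext)
    then show "\<exists>a b. V = (\<lambda>t c. a *\<^sub>R \<xi> (\<gamma> t) c + b *\<^sub>R \<eta> (\<gamma> t) c)" by blast
  next
    assume "\<exists>a b. V = (\<lambda>t c. a *\<^sub>R \<xi> (\<gamma> t) c + b *\<^sub>R \<eta> (\<gamma> t) c)"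
    then obtain a b where V: "V = (\<lambda>t c. a *\<^sub>R \<xi> (\<gamma> t) c + b *\<^sub>R \<eta> (\<gamma> t) c)" by blast
    have fsc: "c.fld (\<lambda>t c. k *\<^sub>R \<zeta> (\<gamma> t) c)" if "fld \<zeta>" for \<zeta> k
      by (rule c.field_along_scaleR[OF re(1)[OF that] line.smooth_in_const])
    have fV: "c.fld V" unfolding V by (intro c.field_along_add fsc null_frameD(1,2)[OF F'])
    have nV: "V t \<in> nsp (\<gamma> t)" for t unfolding V by (intro nsp_lincomb null_frameD(3,4)[OF F'])
    have "nproj (\<gamma> t) (c.nab V t (d_dt t)) = (\<lambda>c. 0)" for t
    proof -
      have D: "c.nab V t (d_dt t) = (\<lambda>c. a *\<^sub>R nab \<xi> (\<gamma> t) (?v t) c + b *\<^sub>R nab \<eta> (\<gamma> t) (?v t) c)"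
        unfolding V c.cov_deriv_add[OF fsc[OF null_frameD(1)[OF F']] fsc[OF null_frameD(2)[OF F']]]
          c.cov_deriv_scaleR[OF re(1)[OF null_frameD(1)[OF F']] line.smooth_in_const]
          c.cov_deriv_scaleR[OF re(1)[OF null_frameD(2)[OF F']] line.smooth_in_const]
          re(2)[OF null_frameD(1)[OF F']] re(2)[OF null_frameD(2)[OF F']]
        by (simp add: line.dir_deriv_const)
      note t\<xi> = cov_deriv_tangent[OF null_frameD(1)[OF F'], of "\<gamma> t" "?v t"]
        and t\<eta> = cov_deriv_tangent[OF null_frameD(2)[OF F'], of "\<gamma> t" "?v t"]
      \<comment> \<open>Orthogonality to all normal vectors, in particular to the two frame fields,
        makes both coefficients in \<open>nproj_frame\<close> vanish.\<close>
      have "gg (\<gamma> t) (c.nab V t (d_dt t)) n = 0" if "n \<in> nsp (\<gamma> t)" for n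
        unfolding D metric_lincomb[OF t\<xi> t\<eta> nsp_tangent[OF that]]
        using nproj_zero_orthogonal(1)[OF t\<xi> par'[OF par(1)] that] nproj_zero_orthogonal(1)[OF t\<eta> par'[OF par(2)] that]
        by simp
      then show ?thesis
        using nproj_frame[OF F' c.cov_deriv_tangent[OF fV], of t "d_dt t"] null_frameD(3,4)[OF F'] by simp
    qed
    then show "parallel_along S M g \<psi> \<gamma> V" using fV nV by (simp add: parallel_along_def o_def)
  qed
qed

text \<open>Along any path the transport keeps the frame coefficients, so its graph depends on the
  end points only; at a closed path it is the identity relation.\<close>

lemma trivial_holonomy_of_parallel_frame:
  assumes F: "parallel_frame \<xi> \<eta>"
  shows "trivial_normal_holonomy S M g \<psi>"
proof -
  have F': "null_frame \<xi> \<eta>" using F by (simp add: parallel_frame_def)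
  define K where "K p a b = (\<lambda>c. a *\<^sub>R \<xi> p c + b *\<^sub>R \<eta> p c)" for p a b
  have Kinj: "a = a' \<and> b = b'" if "K p a b = K p a' b'" for p a b a' b'
    using null_frame_comb[OF F', of p a b] null_frame_comb[OF F', of p a' b'] that by (simp add: K_def)
  have id: "Id_on (nsp p) = {(K p a b, K p a b) | a b. True}" for p
  proof -
    have "n \<in> nsp p \<longleftrightarrow> (\<exists>a b. n = K p a b)" for n
      using normal_expand[OF F', of n p] nsp_lincomb[OF null_frameD(3,4)[OF F']] by (auto simp: K_def)
    then show ?thesis by auto
  qed
  have P: "P = {(K p a b, K q a b) | a b. True}" if "normal_transport S M g \<psi> p q P" for p q P
    using that
  proof induction
    case const
    show ?case by (rule id)
  next
    case (step \<gamma> P)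
    have pa: "parallel_along S M g \<psi> \<gamma> V \<longleftrightarrow> (\<exists>a b. V = (\<lambda>t. K (\<gamma> t) a b))" for V
      unfolding K_def by (rule parallel_along_iff[OF F step(2)])
    have "{(V 0, V 1) | V. parallel_along S M g \<psi> \<gamma> V} = {(K (\<gamma> 0) a b, K (\<gamma> 1) a b) | a b. True}"
    proof (intro set_eqI iffI)
      fix z assume "z \<in> {(K (\<gamma> 0) a b, K (\<gamma> 1) a b) | a b. True}"
      then obtain a b where "z = (K (\<gamma> 0) a b, K (\<gamma> 1) a b)" by blast
      then show "z \<in> {(V 0, V 1) | V. parallel_along S M g \<psi> \<gamma> V}"
        by (intro CollectI exI[of _ "\<lambda>t. K (\<gamma> t) a b"]) (auto simp: pa)
    qed (auto simp: pa)
    \<comment> \<open>Injectivity of the coefficients identifies the intermediate vectors in the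
      relational composition, so the composed graph keeps the same coefficients.\<close>
    then show ?case unfolding step.IH using Kinj by (auto simp: relcomp_unfold) blast
  qed
  \<comment> \<open>The rule \<open>const\<close> supplies one element of the holonomy, so the set
    is exactly the singleton and not empty.\<close>
  show ?thesis
    unfolding trivial_normal_holonomy_def normal_holonomy_def
    using P id normal_transport.const[of S M g \<psi>] by blast
qed

end

theorem theorem5p3:
  fixes M :: "('m::{t2_space, second_countable_topology}, 'e::euclidean_space) chart set"
    and g :: "('m, 'e) metric"
    and T :: "'m \<Rightarrow> ('m, 'e) tvec"
    and S :: "('s::{t2_space, second_countable_topology}, 'd::euclidean_space) chart set"
    and \<psi> :: "'s \<Rightarrow> 'm"
    and \<xi> :: "'s \<Rightarrow> ('m, 'e) tvec"
  assumes "spacetime M g T"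
    and "spacelike_submanifold S M g \<psi>"
    and "DIM('e) = DIM('d) + 2"
    and "DIM('e) \<ge> 4"
    and "umbilical_lightlike_section S M g \<psi> \<xi>"
    and "simply_connected (UNIV :: 's set)"
    and "\<forall>X\<in>vector_fields S. \<forall>Y\<in>vector_fields S. \<forall>p.
           normal_proj S M g \<psi> p
             (riemann M g (\<psi> p) (differential S M \<psi> p (X p)) (differential S M \<psi> p (Y p)) (\<xi> p))
           = (\<lambda>c. 0)"
  shows "rescalable_to_parallel S M g \<psi> \<xi> \<and>
         flat_normal_connection S M g \<psi> \<and>
         trivial_normal_holonomy S M g \<psi>"
proof -
  interpret spacelike_codim_two S M \<psi> g
    using assms(1-3) by unfold_locales (auto simp: spacetime_def spacelike_submanifold_def)
  from assms(5) obtain \<rho> where \<xi>: "\<xi> \<in> normal_fields S M g \<psi>" "\<And>p. lightlike g (\<psi> p) (\<xi> p)"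
    and \<rho>: "\<And>p x. x \<in> tangent_space S p \<Longrightarrow> shape_operator S M g \<psi> \<xi> p x = (\<lambda>c. \<rho> p *\<^sub>R x c)"
    unfolding umbilical_lightlike_section_def by blast
  obtain \<eta> where F: "null_frame \<xi> \<eta>"
    using null_frame_exists[OF \<xi>, of T] assms(1) unfolding spacetime_def by blast
  obtain h \<eta>' where h: "smooth_in S UNIV h" "\<forall>p. h p \<noteq> 0" "parallel_frame (\<lambda>p c. h p *\<^sub>R \<xi> p c) \<eta>'"
    using parallel_frame_exists[OF F assms(6) conn_form_closed[OF F \<rho>]] assms(7) by blast
  have "rescalable_to_parallel S M g \<psi> \<xi>"
    using h unfolding rescalable_to_parallel_def src.smooth_fun_iff parallel_frame_def by blast
  then show ?thesis using flat_of_parallel_frame[OF h(3)] trivial_holonomy_of_parallel_frame[OF h(3)] by blast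
qed

end
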